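(* Let $\beta\in(0,3)$ and let $(q,\lambda)$ be a smooth localization pair on $\Omega=(0,1)$ (as defined in the context). Then there exists a constant $C>0$ such that for every $\delta\in(0,\delta_* )$ and every $u\in H^4(\Omega)\cap H_0^1(\Omega)$, $$\|\mathcal L_\delta u-(-u'')\|_{L^2(\Omega)}\le C\,\delta^2\,\|u\|_{H^4(\Omega)},$$ where $C$ is independent of $u$ and $\delta$.
   Context: Let $\Omega=(0,1)$, $d(x)=\operatorname{dist}(x,\partial\Omega)$, $\beta\in(0,3)$. Localization pair: functions $q:[0,\infty)\to[0,\infty)$ and $\lambda:\overline\Omega\to[0,\infty)$, together with constants $C_q\ge1$, $\kappa_0\ge1$, $\kappa_1,\kappa_2>0$, such that: (1) $q\in C^3([0,\infty))$, $q(0)=q'(0)=0$, $q''(0)>0$; $0<q(r)\le r$ for $r>0$; $0\le q'(r)\le1$ and $0\le q''(r)\le1$ for $r\ge0$; $q''\in C_b^1([0,\infty))$ (bounded with bounded continuous derivative); $q(2r)\le C_q q(r)$ for $r>0$. (2) $\lambda\in C^0(\overline\Omega)\cap C^2(\Omega)$; $\kappa_0^{-1}d(x)\le\lambda(x)\le\kappa_0 d(x)$ on $\overline\Omega$; $|\lambda(x)-\lambda(y)|\le\kappa_1|x-y|$ for $x,y\in\Omega$; $|\lambda^{(j)}(x)|\le\kappa_j d(x)^{1-j}$ for $x\in\Omega$, $j=0,1,2$; $\lambda'(0^+)=1$, $\lambda'(1^-)=-1$. Smooth localization pair: in addition $\lambda\in C^3(\Omega)$ and $|\lambda'''(x)|\le\kappa_3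 d(x)^{-2}$ on $\Omega$ for some constant $\kappa_3>0$. Range of $\delta$: $\delta_*:=\min\{\delta_0,\bar\delta_0\}$, where $\delta_0=\bigl(3\max\{1,\kappa_1,C_q\kappa_0^{\log_2 C_q}\}\bigr)^{-1}$ and $\bar\delta_0$ is the smallest positive root of $\frac{\delta(1+\kappa_1\delta)}{(1-\kappa_1\delta)^2}=\frac13$. Put $\eta(x)=q(\lambda(x))$, $\eta_\delta(x)=\delta\eta(x)$, $C_\beta=\frac{3-\beta}{2}$, $w_\delta(x)=C_\beta\,\eta_\delta(x)^{-(3-\beta)}$. Operator $\mathcal L_\delta$: for $\varepsilon>0$, $$\mathcal L_\delta^\varepsilon u(x)=\mathbf 1_{\{\eta(x)>\varepsilon\}}\int_0^1\Big[w_\delta(x)\mathbf 1_{\{\varepsilon\eta_\delta(x)<|x-y|<\eta_\delta(x)\}}+w_\delta(y)\mathbf 1_{\{\varepsilon\eta_\delta(y)<|x-y|<\eta_\delta(y)\}}\Big]\frac{u(x)-u(y)}{|x-y|^\beta}\,dy,$$ and for $u\in C^2(\overline\Omega)$, $\mathcal L_\delta u:=\lim_{\varepsilon\to0}\mathcal L^\varepsilon_\delta u$ in $L^2(\Omega)$ (this limit is known to exist). Note $H^4(\Omega)\subset C^3(\overline\Omega)$. *)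

theory Defs
  imports "HOL-Analysis.Analysis"
begin

subsection \<open>Classical differentiability, relative to a subset of the real line\<close>

text \<open>Derivatives are taken within \<open>S\<close>, hence one-sided at an endpoint belonging to \<open>S\<close>.\<close>

definition nth_deriv_on :: "nat \<Rightarrow> real set \<Rightarrow> (real \<Rightarrow> real) \<Rightarrow> real \<Rightarrow> real" where
  "nth_deriv_on k S f = ((\<lambda>g x. vector_derivative g (at x within S)) ^^ k) f"

definition Ck_on :: "nat \<Rightarrow> real set \<Rightarrow> (real \<Rightarrow> real) \<Rightarrow> bool" where
  "Ck_on k S f \<longleftrightarrow>
     (\<forall>j<k. nth_deriv_on j S f differentiable_on S) \<and> continuous_on S (nth_deriv_on k S f)"

definition Cb1_on :: "real set \<Rightarrow> (real \<Rightarrow> real) \<Rightarrow> bool" where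
  "Cb1_on S f \<longleftrightarrow> Ck_on 1 S f \<and> bounded (f ` S) \<and> bounded (nth_deriv_on 1 S f ` S)"

subsection \<open>Sobolev spaces on an open set\<close>

text \<open>Elements of \<open>L\<^sup>2\<close> and of the Sobolev spaces are represented by functions on the whole line;
  only their values almost everywhere on \<open>S\<close> matter.\<close>

definition L2_space :: "real set \<Rightarrow> (real \<Rightarrow> real) set" where
  "L2_space S = {f. f \<in> borel_measurable (lebesgue_on S) \<and>
                    integrable (lebesgue_on S) (\<lambda>x. (f x)\<^sup>2)}"

text \<open>Meaningful only on \<open>L2_space S\<close>: the Bochner integral of a non-integrable function is 0.\<close>

definition L2_norm :: "real set \<Rightarrow> (real \<Rightarrow> real) \<Rightarrow> real" where
  "L2_norm S f = sqrt (integral\<^sup>L (lebesgue_on S) (\<lambda>x. (f x)\<^sup>2))"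

definition test_function :: "real set \<Rightarrow> (real \<Rightarrow> real) \<Rightarrow> bool" where
  "test_function S \<phi> \<longleftrightarrow>
     (\<forall>k. Ck_on k S \<phi>) \<and> (\<exists>K. compact K \<and> K \<subseteq> S \<and> (\<forall>x\<in>S - K. \<phi> x = 0))"

definition locally_integrable :: "real set \<Rightarrow> (real \<Rightarrow> real) \<Rightarrow> bool" where
  "locally_integrable S f \<longleftrightarrow> (\<forall>K. compact K \<and> K \<subseteq> S \<longrightarrow> integrable (lebesgue_on K) f)"

definition has_weak_deriv :: "nat \<Rightarrow> real set \<Rightarrow> (real \<Rightarrow> real) \<Rightarrow> (real \<Rightarrow> real) \<Rightarrow> bool" where
  "has_weak_deriv k S u v \<longleftrightarrow>
     locally_integrable S u \<and> locally_integrable S v \<and>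
     (\<forall>\<phi>. test_function S \<phi> \<longrightarrow>
        integral\<^sup>L (lebesgue_on S) (\<lambda>x. u x * nth_deriv_on k S \<phi> x) =
        (- 1) ^ k * integral\<^sup>L (lebesgue_on S) (\<lambda>x. v x * \<phi> x))"

text \<open>Weak derivatives are unique up to null sets; this picks a representative.\<close>

definition weak_deriv :: "nat \<Rightarrow> real set \<Rightarrow> (real \<Rightarrow> real) \<Rightarrow> real \<Rightarrow> real" where
  "weak_deriv k S u = (SOME v. has_weak_deriv k S u v)"

definition H_space :: "nat \<Rightarrow> real set \<Rightarrow> (real \<Rightarrow> real) set" where
  "H_space k S = {u \<in> L2_space S. \<forall>j\<le>k. \<exists>v \<in> L2_space S. has_weak_deriv j S u v}"

definition H_norm :: "nat \<Rightarrow> real set \<Rightarrow> (real \<Rightarrow> real) \<Rightarrow> real" where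
  "H_norm k S u = sqrt (\<Sum>j\<le>k. (L2_norm S (weak_deriv j S u))\<^sup>2)"

text \<open>The closure of the test functions in \<open>H\<^sup>1\<close>.\<close>

definition H10_space :: "real set \<Rightarrow> (real \<Rightarrow> real) set" where
  "H10_space S = {u \<in> H_space 1 S. \<exists>\<phi>. (\<forall>n::nat. test_function S (\<phi> n)) \<and>
                    (\<lambda>n. H_norm 1 S (\<lambda>x. u x - \<phi> n x)) \<longlonglongrightarrow> 0}"

subsection \<open>Localization pairs\<close>

abbreviation \<Omega> :: "real set" where
  "\<Omega> \<equiv> {0<..<1}"

definition bdist :: "real \<Rightarrow> real" where
  "bdist x = infdist x (frontier \<Omega>)"

definition localization_pair ::
  "(real \<Rightarrow> real) \<Rightarrow> (real \<Rightarrow> real) \<Rightarrow> real \<Rightarrow> real \<Rightarrow> real \<Rightarrow> real \<Rightarrow> bool" where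
  "localization_pair q lam Cq \<kappa>0 \<kappa>1 \<kappa>2 \<longleftrightarrow>
     Cq \<ge> 1 \<and> \<kappa>0 \<ge> 1 \<and> \<kappa>1 > 0 \<and> \<kappa>2 > 0 \<and>
     \<comment> \<open>conditions on \<open>q\<close>\<close>
     q \<in> {0..} \<rightarrow> {0..} \<and>
     Ck_on 3 {0..} q \<and>
     q 0 = 0 \<and> nth_deriv_on 1 {0..} q 0 = 0 \<and> nth_deriv_on 2 {0..} q 0 > 0 \<and>
     (\<forall>r>0. 0 < q r \<and> q r \<le> r) \<and>
     (\<forall>r\<ge>0. 0 \<le> nth_deriv_on 1 {0..} q r \<and> nth_deriv_on 1 {0..} q r \<le> 1) \<and>
     (\<forall>r\<ge>0. 0 \<le> nth_deriv_on 2 {0..} q r \<and> nth_deriv_on 2 {0..} q r \<le> 1) \<and>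
     Cb1_on {0..} (nth_deriv_on 2 {0..} q) \<and>
     (\<forall>r>0. q (2 * r) \<le> Cq * q r) \<and>
     \<comment> \<open>conditions on \<open>lam\<close>\<close>
     lam \<in> closure \<Omega> \<rightarrow> {0..} \<and>
     continuous_on (closure \<Omega>) lam \<and> Ck_on 2 \<Omega> lam \<and>
     (\<forall>x\<in>closure \<Omega>. inverse \<kappa>0 * bdist x \<le> lam x \<and> lam x \<le> \<kappa>0 * bdist x) \<and>
     (\<forall>x\<in>\<Omega>. \<forall>y\<in>\<Omega>. \<bar>lam x - lam y\<bar> \<le> \<kappa>1 * \<bar>x - y\<bar>) \<and>
     (\<forall>x\<in>\<Omega>. \<bar>lam x\<bar> \<le> \<kappa>0 * bdist x) \<and>
     (\<forall>x\<in>\<Omega>. \<bar>nth_deriv_on 1 \<Omega> lam x\<bar> \<le> \<kappa>1) \<and>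
     (\<forall>x\<in>\<Omega>. \<bar>nth_deriv_on 2 \<Omega> lam x\<bar> \<le> \<kappa>2 * inverse (bdist x)) \<and>
     (nth_deriv_on 1 \<Omega> lam \<longlongrightarrow> 1) (at_right 0) \<and>
     (nth_deriv_on 1 \<Omega> lam \<longlongrightarrow> - 1) (at_left 1)"

definition smooth_localization_pair ::
  "(real \<Rightarrow> real) \<Rightarrow> (real \<Rightarrow> real) \<Rightarrow> real \<Rightarrow> real \<Rightarrow> real \<Rightarrow> real \<Rightarrow> bool" where
  "smooth_localization_pair q lam Cq \<kappa>0 \<kappa>1 \<kappa>2 \<longleftrightarrow>
     localization_pair q lam Cq \<kappa>0 \<kappa>1 \<kappa>2 \<and> Ck_on 3 \<Omega> lam \<and>
     (\<exists>\<kappa>3>0. \<forall>x\<in>\<Omega>. \<bar>nth_deriv_on 3 \<Omega> lam x\<bar> \<le> \<kappa>3 * inverse ((bdist x)\<^sup>2))"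

definition delta_zero :: "real \<Rightarrow> real \<Rightarrow> real \<Rightarrow> real" where
  "delta_zero Cq \<kappa>0 \<kappa>1 = inverse (3 * Max {1, \<kappa>1, Cq * \<kappa>0 powr (log 2 Cq)})"

definition delta_zero_bar :: "real \<Rightarrow> real" where
  "delta_zero_bar \<kappa>1 =
     (LEAST \<delta>. 0 < \<delta> \<and> \<delta> * (1 + \<kappa>1 * \<delta>) / (1 - \<kappa>1 * \<delta>)\<^sup>2 = 1 / 3)"

definition delta_star :: "real \<Rightarrow> real \<Rightarrow> real \<Rightarrow> real" where
  "delta_star Cq \<kappa>0 \<kappa>1 = min (delta_zero Cq \<kappa>0 \<kappa>1) (delta_zero_bar \<kappa>1)"

subsection \<open>The nonlocal operator\<close>

definition eta :: "(real \<Rightarrow> real) \<Rightarrow> (real \<Rightarrow> real) \<Rightarrow> real \<Rightarrow> real" where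
  "eta q lam x = q (lam x)"

definition eta_delta :: "(real \<Rightarrow> real) \<Rightarrow> (real \<Rightarrow> real) \<Rightarrow> real \<Rightarrow> real \<Rightarrow> real" where
  "eta_delta q lam \<delta> x = \<delta> * eta q lam x"

definition w_delta ::
  "real \<Rightarrow> (real \<Rightarrow> real) \<Rightarrow> (real \<Rightarrow> real) \<Rightarrow> real \<Rightarrow> real \<Rightarrow> real" where
  "w_delta \<beta> q lam \<delta> x = (3 - \<beta>) / 2 * eta_delta q lam \<delta> x powr (- (3 - \<beta>))"

definition L_eps ::
  "real \<Rightarrow> (real \<Rightarrow> real) \<Rightarrow> (real \<Rightarrow> real) \<Rightarrow> real \<Rightarrow> real \<Rightarrow> (real \<Rightarrow> real) \<Rightarrow> real \<Rightarrow> real" where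
  "L_eps \<beta> q lam \<delta> \<epsilon> u x =
     indicator {x. eta q lam x > \<epsilon>} x *
     integral\<^sup>L (lebesgue_on \<Omega>) (\<lambda>y.
       (w_delta \<beta> q lam \<delta> x *
          indicator {y. \<epsilon> * eta_delta q lam \<delta> x < \<bar>x - y\<bar> \<and> \<bar>x - y\<bar> < eta_delta q lam \<delta> x} y +
        w_delta \<beta> q lam \<delta> y *
          indicator {y. \<epsilon> * eta_delta q lam \<delta> y < \<bar>x - y\<bar> \<and> \<bar>x - y\<bar> < eta_delta q lam \<delta> y} y) *
       ((u x - u y) / \<bar>x - y\<bar> powr \<beta>))"

definition is_L2_limit :: "real set \<Rightarrow> (real \<Rightarrow> real \<Rightarrow> real) \<Rightarrow> (real \<Rightarrow> real) \<Rightarrow> bool" where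
  "is_L2_limit S F f \<longleftrightarrow>
     f \<in> L2_space S \<and> (\<forall>\<^sub>F \<epsilon> in at_right 0. F \<epsilon> \<in> L2_space S) \<and>
     ((\<lambda>\<epsilon>. L2_norm S (\<lambda>x. F \<epsilon> x - f x)) \<longlongrightarrow> 0) (at_right 0)"

text \<open>A representative of the limit, which is unique up to null sets. Nothing is assumed about its
  existence: if there is no limit, the value is unspecified.\<close>

definition L_delta ::
  "real \<Rightarrow> (real \<Rightarrow> real) \<Rightarrow> (real \<Rightarrow> real) \<Rightarrow> real \<Rightarrow> (real \<Rightarrow> real) \<Rightarrow> real \<Rightarrow> real" where
  "L_delta \<beta> q lam \<delta> u = (SOME f. is_L2_limit \<Omega> (\<lambda>\<epsilon>. L_eps \<beta> q lam \<delta> \<epsilon> u) f)"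

end

theory Submission
  imports Defs
begin

text \<open>
  Substituting \<open>z = (y - x) / \<eta>\<^sub>\<delta>(y)\<close> turns the half of the operator whose horizon depends on the
  integration variable into an integral over \<open>(-1, 1)\<close> in terms of the solution \<open>Y(z)\<close> of the fixed
  point equation \<open>Y = x + z \<eta>\<^sub>\<delta>(Y)\<close>, with weight \<open>\<bar>z\<bar> powr (- \<beta>) * D / e\<^sup>2\<close>, where \<open>e = \<eta>\<^sub>\<delta>(Y)\<close> and
  \<open>D = 1 / (1 - z \<eta>\<^sub>\<delta>'(Y))\<close>, so that \<open>Y' = e D\<close>. The other half has the same form with constant \<open>e\<close>
  and \<open>D = 1\<close>. Pairing \<open>z\<close> with \<open>- z\<close> and expanding \<open>u\<close> at \<open>x\<close> to third order, the second order terms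
  produce \<open>- u''\<close>, and the others are of order \<open>\<delta>\<^sup>2\<close>. The delicate first order term is governed by
  \<open>(D / e)(z) - (D / e)(- z)\<close>, which is small because \<open>(D / e)' = z \<eta>\<^sub>\<delta>''(Y) D\<^sup>3\<close>; this is where the third
  derivative of \<open>\<lambda>\<close> enters. The Taylor remainder is bounded by the mass of \<open>\<bar>u''''\<bar>\<close> in a ball of radius
  of order \<open>\<delta>\<close>, whose \<open>L\<^sup>2\<close> norm is of order \<open>\<delta> \<parallel>u''''\<parallel>\<close>. All first to third order terms only need the
  \<open>L\<^sup>2\<close> norms of \<open>u'\<close>, \<open>u''\<close>, \<open>u'''\<close>, so the estimates hold pointwise and are integrated at the end.
\<close>

text \<open>The limit in \<open>L_delta\<close> and the weak derivatives are bare choices, so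
  existence and regularity have to be earned: the limit comes from pointwise convergence, a bound
  uniform in \<epsilon> and dominated convergence; a continuous representative of u comes from the
  fundamental lemma of the calculus of variations.

  The constant (3 - \<beta>) / 2 fits because z powr (2 - \<beta>) has integral 1 / (3 - \<beta>)
  over the unit interval: each half of the operator contributes - u'' / 2.

  The obstacle is the boundary, where \<eta> vanishes, \<open>D / e\<close> blows up and the third
  derivative of \<eta> may be unbounded. Two facts remove it: no negative power of \<open>e\<close>
  survives in the derivative of \<open>D / e\<close>, and the third derivative of \<eta>, of size at
  most 1 / \<eta>, is only integrated over distances comparable to \<delta> \<eta>. So the constants
  are uniform up to the boundary.

  Smallness of \<delta> gives \<open>3 * \<delta> * \<kappa>1 < 1\<close>, so \<delta> \<eta> is
  Lipschitz with constant 1/3. Factors such as 3/2 and 4/3 come from absorbing that third.\<close>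

lemma nth_deriv_on_0 [simp]: "nth_deriv_on 0 S f = f"
  by (simp add: nth_deriv_on_def)

lemma nth_deriv_on_Suc:
  "nth_deriv_on (Suc k) S f x = vector_derivative (nth_deriv_on k S f) (at x within S)"
  by (simp add: nth_deriv_on_def)

lemma nth_deriv_on_add: "nth_deriv_on j S (nth_deriv_on k S f) = nth_deriv_on (j + k) S f"
  by (simp add: nth_deriv_on_def funpow_add)

lemma Ck_on_nth_deriv:
  assumes "Ck_on k S f" "j < k" "x \<in> S"
  shows "(nth_deriv_on j S f has_real_derivative nth_deriv_on (Suc j) S f x) (at x within S)"
proof -
  have "nth_deriv_on j S f differentiable (at x within S)"
    using assms by (auto simp: Ck_on_def differentiable_on_def)
  then show ?thesis
    by (simp add: nth_deriv_on_Suc vector_derivative_works has_real_derivative_iff_has_vector_derivative)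
qed

section \<open>Smoothness through towers of derivatives\<close>

definition deriv_tower :: "real set \<Rightarrow> (nat \<Rightarrow> real \<Rightarrow> real) \<Rightarrow> bool" where
  "deriv_tower S G \<longleftrightarrow> (\<forall>k. \<forall>x\<in>S. (G k has_real_derivative G (Suc k) x) (at x))"

text \<open>\<open>nth_deriv_on\<close> rests on the choice made by
  \<open>vector_derivative\<close>, so smoothness is shown by exhibiting all derivatives at once.
  Openness of \<open>S\<close> turns agreement on \<open>S\<close> into agreement near the point,
  which is what differentiating once more requires.\<close>

lemma nth_deriv_on_tower:
  assumes S: "open S" and G: "deriv_tower S G" and x: "x \<in> S"
  shows "nth_deriv_on k S (G 0) x = G k x"
  using x
proof (induction k arbitrary: x)
  case (Suc k)
  have "(G k has_vector_derivative G (Suc k) x) (at x)"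
    using G Suc.prems by (simp add: deriv_tower_def has_real_derivative_iff_has_vector_derivative)
  then have "(nth_deriv_on k S (G 0) has_vector_derivative G (Suc k) x) (at x)"
    by (rule has_vector_derivative_transform_within_open[OF _ S Suc.prems]) (simp add: Suc.IH)
  then show ?case
    by (simp add: nth_deriv_on_Suc at_within_open[OF Suc.prems S] vector_derivative_at)
qed simp

lemma Ck_on_tower:
  assumes S: "open S" and G: "deriv_tower S G"
  shows "Ck_on k S (G 0)"
proof -
  have D: "(nth_deriv_on j S (G 0) has_real_derivative G (Suc j) x) (at x)" if "x \<in> S" for j x
  proof -
    have "(G j has_real_derivative G (Suc j) x) (at x)"
      using G that by (simp add: deriv_tower_def)
    then show ?thesis
      by (rule has_field_derivative_transform_within_open[OF _ S that])
        (simp add: nth_deriv_on_tower[OF S G])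
  qed
  have "nth_deriv_on j S (G 0) differentiable_on S" for j
    unfolding differentiable_on_def
    using D real_differentiable_def differentiable_at_withinI by blast
  then show ?thesis
    unfolding Ck_on_def using differentiable_imp_continuous_on by blast
qed

lemma tower_of_Ck:
  assumes "open S" "\<forall>k. Ck_on k S f"
  shows "deriv_tower S (\<lambda>k. nth_deriv_on k S f)"
  unfolding deriv_tower_def
proof (intro allI ballI)
  fix k x assume "x \<in> S"
  then show "(nth_deriv_on k S f has_real_derivative nth_deriv_on (Suc k) S f x) (at x)"
    using Ck_on_nth_deriv[of "Suc k" S f k x] assms at_within_open[of x S] by simp
qed

text \<open>Dependent choice: a class closed under differentiation yields all higher derivatives
  without a formula for the k-th one.\<close>

lemma tower_exists:
  assumes "P f" and "\<And>g. P g \<Longrightarrow> \<exists>g'. P g' \<and> (\<forall>x\<in>S. (g has_real_derivative g' x) (at x))"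
  obtains G where "deriv_tower S G" "G 0 = f"
proof -
  have "\<exists>G. \<forall>k. (P (G k) \<and> (k = 0 \<longrightarrow> G k = f)) \<and> (\<forall>x\<in>S. (G k has_real_derivative G (Suc k) x) (at x))"
    by (rule dependent_nat_choice) (use assms in auto)
  then obtain G where "\<And>k. k = 0 \<longrightarrow> G k = f"
      "\<And>k x. x \<in> S \<Longrightarrow> (G k has_real_derivative G (Suc k) x) (at x)"
    by blast
  then show ?thesis using that[of G] by (simp add: deriv_tower_def)
qed

lemma tower_mult: 
  assumes "deriv_tower S G" shows "deriv_tower S (\<lambda>k x. c * G k x)"
  using assms by (auto simp: deriv_tower_def intro!: derivative_eq_intros)

lemma tower_diff: 
  assumes "deriv_tower S G" "deriv_tower S H" shows "deriv_tower S (\<lambda>k x. G k x - H k x)"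
  using assms by (auto simp: deriv_tower_def intro!: derivative_eq_intros)

subsection \<open>Bump functions\<close>

text \<open>The factors \<open>(1 / t) ^ k\<close> are those produced by differentiating exp (- 1 /
  t); with them the derivative of each member is a linear combination of members.\<close>

definition flat_exp :: "nat \<Rightarrow> real \<Rightarrow> real" where
  "flat_exp k t = (if t > 0 then (1 / t) ^ k * exp (- (1 / t)) else 0)"

text \<open>This is the difference quotient at 0, the one delicate point for differentiability of
  \<open>flat_exp\<close>. With \<open>s = 1 / t\<close> it is the decay of
  \<open>s ^ Suc k / exp s\<close>.\<close>

lemma flat_exp_quotient_tendsto: "((\<lambda>t. flat_exp k t / t) \<longlongrightarrow> 0) (at 0)"
proof -
  have "((\<lambda>s::real. s ^ Suc k / exp s) \<longlongrightarrow> 0) at_top"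
    by (rule tendsto_power_div_exp_0)
  then have "((\<lambda>t::real. (1 / t) ^ Suc k / exp (1 / t)) \<longlongrightarrow> 0) (at_right 0)"
    by (simp add: filterlim_at_top_to_right inverse_eq_divide del: power_Suc)
  moreover have "\<forall>\<^sub>F t in at_right (0::real). (1 / t) ^ Suc k / exp (1 / t) = flat_exp k t / t"
    unfolding eventually_at_filter by (auto simp: flat_exp_def exp_minus field_simps)
  ultimately have "((\<lambda>t. flat_exp k t / t) \<longlongrightarrow> 0) (at_right 0)"
    by (rule Lim_transform_eventually)
  moreover have "((\<lambda>t. flat_exp k t / t) \<longlongrightarrow> 0) (at_left 0)"
    by (rule Lim_transform_eventually[OF tendsto_const])
      (auto simp: eventually_at_filter flat_exp_def)
  ultimately show ?thesis
    by (simp add: filterlim_at_split)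
qed

lemma flat_exp_deriv:
  "(flat_exp k has_real_derivative flat_exp (k + 2) t - real k * flat_exp (k + 1) t) (at t)"
proof -
  consider "t > 0" | "t < 0" | "t = 0" by linarith
  then show ?thesis
  proof cases
    case 1
    have "((\<lambda>t. (1 / t) ^ k * exp (- (1 / t))) has_real_derivative
        flat_exp (k + 2) t - real k * flat_exp (k + 1) t) (at t)"
    proof (cases k)
      case 0
      then show ?thesis
        using 1 by (auto intro!: derivative_eq_intros simp: flat_exp_def field_simps power2_eq_square)
    next
      case (Suc j)
      have "((\<lambda>t. (1 / t) ^ Suc j * exp (- (1 / t))) has_real_derivative
        (1 + real j) * (- (1 / t\<^sup>2) * (1 / t) ^ j) * exp (- (1 / t)) +
         exp (- (1 / t)) * (1 / t\<^sup>2) * (1 / t) ^ Suc j) (at t)"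
        by (rule derivative_eq_intros refl | use 1 in \<open>simp add: field_simps power2_eq_square\<close>)+
      also have "(1 + real j) * (- (1 / t\<^sup>2) * (1 / t) ^ j) * exp (- (1 / t)) +
         exp (- (1 / t)) * (1 / t\<^sup>2) * (1 / t) ^ Suc j = flat_exp (k + 2) t - real k * flat_exp (k + 1) t"
        using 1 Suc by (simp add: flat_exp_def algebra_simps power2_eq_square)
      finally show ?thesis by (simp add: Suc)
    qed
    then show ?thesis
      by (rule has_field_derivative_transform_within_open[where S="{0<..}"])
        (use 1 in \<open>auto simp: flat_exp_def\<close>)
  next
    case 2
    have "((\<lambda>t. 0) has_real_derivative flat_exp (k + 2) t - real k * flat_exp (k + 1) t) (at t)"
      using 2 by (auto intro!: derivative_eq_intros simp: flat_exp_def)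
    then show ?thesis
      by (rule has_field_derivative_transform_within_open[where S="{..<0}"])
        (use 2 in \<open>auto simp: flat_exp_def\<close>)
  next
    case 3
    have "flat_exp j 0 = 0" for j by (simp add: flat_exp_def)
    then show ?thesis
      using flat_exp_quotient_tendsto[of k] 3 by (simp add: has_field_derivative_iff)
  qed
qed

text \<open>For a polynomial \<open>H\<close> the chain rule only multiplies by polynomials and
  shifts \<open>k\<close>, so this class is closed under differentiation and feeds
  \<open>tower_exists\<close>.\<close>

inductive flat_family :: "(real \<Rightarrow> real) \<Rightarrow> (real \<Rightarrow> real) \<Rightarrow> bool" for H where
  base: "real_polynomial_function r \<Longrightarrow> flat_family H (\<lambda>x. r x * flat_exp k (H x))"
| add: "flat_family H f \<Longrightarrow> flat_family H g \<Longrightarrow> flat_family H (\<lambda>x. f x + g x)"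

lemma flat_family_deriv:
  assumes H: "real_polynomial_function H" and "flat_family H f"
  shows "\<exists>f'. flat_family H f' \<and> (\<forall>x\<in>UNIV. (f has_real_derivative f' x) (at x))"
  using assms(2)
proof induction
  case (base r k)
  obtain r' where r': "real_polynomial_function r'" "\<And>x. (r has_real_derivative r' x) (at x)"
    using has_real_derivative_polynomial_function[OF base] by auto
  obtain H' where H': "real_polynomial_function H'" "\<And>x. (H has_real_derivative H' x) (at x)"
    using has_real_derivative_polynomial_function[OF H] by auto
  define f' where "f' = (\<lambda>x. (r' x * flat_exp k (H x) + (r x * H' x) * flat_exp (k + 2) (H x))
      + (r x * (- real k * H' x)) * flat_exp (k + 1) (H x))"
  have "flat_family H f'"
    unfolding f'_def
    by (intro flat_family.intros r' H' base real_polynomial_function.intros)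
  moreover have "((\<lambda>x. r x * flat_exp k (H x)) has_real_derivative f' x) (at x)" for x
    unfolding f'_def
    by (rule derivative_eq_intros r' DERIV_chain2[OF flat_exp_deriv H'(2)] refl)+
       (simp add: algebra_simps)
  ultimately show ?case by blast
next
  case (add f g)
  then obtain f' g' where "flat_family H f'" "\<forall>x\<in>UNIV. (f has_real_derivative f' x) (at x)"
    "flat_family H g'" "\<forall>x\<in>UNIV. (g has_real_derivative g' x) (at x)" by blast
  then show ?case
    by (intro exI[of _ "\<lambda>x. f' x + g' x"]) (auto intro!: flat_family.add derivative_intros)
qed

text \<open>The factor \<open>Suc n\<close> drives the exponent to 0 inside the interval, so these
  smooth functions converge to the indicator of the open interval while staying between 0 and
  1.\<close>

definition bump :: "real \<Rightarrow> real \<Rightarrow> nat \<Rightarrow> real \<Rightarrow> real" where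
  "bump a b n x = flat_exp 0 (real (Suc n) * (x - a) * (b - x))"

lemma bump_tower: obtains G where "deriv_tower UNIV G" "G 0 = bump a b n"
proof -
  define H where "H x = real (Suc n) * (x - a) * (b - x)" for x
  have lin: "real_polynomial_function (\<lambda>x::real. x)"
    by (intro real_polynomial_function.intros bounded_linear_ident)
  have H: "real_polynomial_function H"
    unfolding H_def by (intro real_polynomial_function.intros real_polynomial_function_diff lin)
  have "flat_family H (\<lambda>x. 1 * flat_exp 0 (H x))"
    by (intro flat_family.base real_polynomial_function.intros)
  then have "flat_family H (bump a b n)"
    by (simp add: bump_def[abs_def] H_def)
  from tower_exists[where P="flat_family H" and S=UNIV, OF this] flat_family_deriv[OF H] that
  show ?thesis by blast
qed

lemma bump_pos: "a < x \<Longrightarrow> x < b \<Longrightarrow> bump a b n x > 0"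
  by (simp add: bump_def flat_exp_def)

lemma bump_bounds: "0 \<le> bump a b n x" "bump a b n x \<le> 1"
  by (auto simp: bump_def flat_exp_def)

lemma bump_outside: "a < b \<Longrightarrow> x \<notin> {a<..<b} \<Longrightarrow> bump a b n x = 0"
  by (auto simp: bump_def flat_exp_def zero_less_mult_iff mult_less_0_iff)

lemma bump_tendsto:
  assumes "a < b"
  shows "(\<lambda>n. bump a b n x) \<longlonglongrightarrow> indicator {a<..<b} x"
proof (cases "x \<in> {a<..<b}")
  case True
  define c where "c = 1 / ((x - a) * (b - x))"
  have "(\<lambda>n. exp (- (c * inverse (real (Suc n))))) \<longlonglongrightarrow> exp (- (c * 0))"
    by (intro tendsto_intros LIMSEQ_inverse_real_of_nat)
  moreover have "bump a b n x = exp (- (c * inverse (real (Suc n))))" for n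
    using True by (simp add: bump_def flat_exp_def c_def inverse_eq_divide mult.commute mult.left_commute)
  ultimately show ?thesis using True by simp
next
  case False
  then show ?thesis using bump_outside[OF assms] by simp
qed

lemma bump_continuous: "continuous_on S (bump a b n)"
proof -
  obtain G where G: "deriv_tower UNIV G" "G 0 = bump a b n" by (rule bump_tower)
  then have "isCont (bump a b n) x" for x
    unfolding deriv_tower_def by (metis DERIV_isCont UNIV_I)
  then show ?thesis by (rule continuous_at_imp_continuous_on[OF ballI])
qed

lemma test_function_tower:
  assumes "open S" "deriv_tower S G" "compact K" "K \<subseteq> S" "\<And>x. x \<in> S - K \<Longrightarrow> G 0 x = 0"
  shows "test_function S (G 0)"
  unfolding test_function_def using Ck_on_tower[OF assms(1,2)] assms(3-5) by blast

lemma test_function_bump: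
  assumes "0 < a" "a < b" "b < 1"
  shows "test_function \<Omega> (bump a b n)"
proof -
  obtain G where G: "deriv_tower UNIV G" "G 0 = bump a b n" by (rule bump_tower)
  then have "deriv_tower \<Omega> G" by (auto simp: deriv_tower_def)
  then have "test_function \<Omega> (G 0)"
    by (rule test_function_tower[where K="{a..b}", rotated])
       (use assms bump_outside[of a b] in \<open>auto simp: G\<close>)
  then show ?thesis using G by simp
qed

lemma test_function_deriv:
  assumes S: "open S" and "test_function S \<phi>"
  shows "test_function S (nth_deriv_on 1 S \<phi>)"
proof -
  obtain K where K: "compact K" "K \<subseteq> S" "\<And>x. x \<in> S - K \<Longrightarrow> \<phi> x = 0"
    using assms by (auto simp: test_function_def)
  have T: "deriv_tower S (\<lambda>k. nth_deriv_on k S \<phi>)"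
    using assms by (auto simp: test_function_def intro: tower_of_Ck)
  then have T': "deriv_tower S (\<lambda>k. nth_deriv_on (Suc k) S \<phi>)" by (simp add: deriv_tower_def)
  have "nth_deriv_on (Suc 0) S \<phi> x = 0" if x: "x \<in> S - K" for x
  proof -
    have "((\<lambda>x. 0) has_real_derivative 0) (at x)" by simp
    then have "(\<phi> has_real_derivative 0) (at x)"
      by (rule has_field_derivative_transform_within_open[where S="S - K"])
        (use S K x in \<open>auto intro: open_Diff compact_imp_closed\<close>)
    moreover have "(\<phi> has_real_derivative nth_deriv_on (Suc 0) S \<phi> x) (at x)"
      using T x unfolding deriv_tower_def by (metis DiffD1 nth_deriv_on_0)
    ultimately show ?thesis by (rule DERIV_unique[symmetric])
  qed
  from test_function_tower[OF S T' K(1,2)] this show ?thesis by simp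
qed

subsection \<open>Weak derivatives\<close>

text \<open>The positive and negative parts of \<open>h\<close> are densities of two measures that
  are finite and equal on every ray. Rays determine such measures, so the densities agree almost
  everywhere, and \<open>ennreal (h x) = ennreal (- h x)\<close> forces
  \<open>h x = 0\<close>.\<close>

lemma AE_eq_0_of_ray_integrals:
  fixes h :: "real \<Rightarrow> real"
  assumes h: "integrable lborel h"
    and zero: "\<And>a. (\<integral>x. indicator {a<..} x * h x \<partial>lborel) = 0"
  shows "AE x in lborel. h x = 0"
proof -
  have [measurable]: "h \<in> borel_measurable borel"
    using borel_measurable_integrable[OF h] by simp
  let ?P = "density lborel (\<lambda>x. ennreal (h x))" and ?N = "density lborel (\<lambda>x. ennreal (- h x))"
  have int: "integrable lborel (\<lambda>x. indicator {a<..} x * h x)" for a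
    using integrable_mult_indicator[OF _ h, of "{a<..}"] by simp
  have P: "emeasure ?P {a<..} = (\<integral>\<^sup>+x. ennreal (indicator {a<..} x * h x) \<partial>lborel)" for a
    by (subst emeasure_density) (auto intro!: nn_integral_cong split: split_indicator)
  have N: "emeasure ?N {a<..} = (\<integral>\<^sup>+x. ennreal (- (indicator {a<..} x * h x)) \<partial>lborel)" for a
    by (subst emeasure_density) (auto intro!: nn_integral_cong split: split_indicator)
  have fin: "emeasure ?P {a<..} < \<infinity>" "emeasure ?N {a<..} < \<infinity>" for a
    using int[of a] unfolding P N real_integrable_def by (auto simp: less_top)
  have eq: "emeasure ?P {a<..} = emeasure ?N {a<..}" for a
  proof -
    have "enn2real (emeasure ?P {a<..}) = enn2real (emeasure ?N {a<..})"
      using zero[of a] unfolding real_lebesgue_integral_def[OF int] P N by simp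
    then have "ennreal (enn2real (emeasure ?P {a<..})) = ennreal (enn2real (emeasure ?N {a<..}))"
      by (rule arg_cong)
    moreover have "ennreal (enn2real (emeasure ?P {a<..})) = emeasure ?P {a<..}"
      using fin(1)[of a] by (intro ennreal_enn2real) simp
    moreover have "ennreal (enn2real (emeasure ?N {a<..})) = emeasure ?N {a<..}"
      using fin(2)[of a] by (intro ennreal_enn2real) simp
    ultimately show ?thesis by (simp only:)
  qed
  have "?P = ?N"
    by (rule measure_eqI_lessThan) (use fin eq in auto)
  then have "AE x in lborel. ennreal (h x) = ennreal (- h x)"
    by (intro sigma_finite_measure.density_unique[OF sigma_finite_lborel]) auto
  then show ?thesis
  proof eventually_elim
    case (elim x)
    then show ?case by (cases "h x \<ge> 0") (auto simp: ennreal_neg)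
  qed
qed

text \<open>Uniqueness of measures is an argument on Borel sets; a Borel function that agrees with
  \<open>h\<close> almost everywhere carries it over to the completion.\<close>

lemma AE_eq_0_of_ray_integrals_lebesgue:
  fixes h :: "real \<Rightarrow> real"
  assumes h: "integrable lebesgue h"
    and zero: "\<And>a. (\<integral>x. indicator {a<..} x * h x \<partial>lebesgue) = 0"
  shows "AE x in lebesgue. h x = 0"
proof -
  have hm: "h \<in> borel_measurable lebesgue"
    using h by (rule borel_measurable_integrable)
  obtain h' where h'[measurable]: "h' \<in> borel_measurable lborel" and eq: "AE x in lborel. h x = h' x"
    using completion_ex_borel_measurable_real[OF hm] by blast
  have h'': "h' \<in> borel_measurable lebesgue" by (rule measurable_completion) simp
  have eq': "AE x in lebesgue. h x = h' x"
    using eq by (rule AE_completion)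
  have "integrable lebesgue h'"
    using h by (rule integrable_cong_AE_imp) (use eq' h'' in \<open>auto\<close>)
  then have "integrable lborel h'"
    using integrable_completion[of h' lborel] by simp
  moreover have "(\<integral>x. indicator {a<..} x * h' x \<partial>lborel) = 0" for a
  proof -
    have "(\<integral>x. indicator {a<..} x * h' x \<partial>lborel) = (\<integral>x. indicator {a<..} x * h' x \<partial>lebesgue)"
      by (rule integral_completion[symmetric]) simp
    also have "\<dots> = (\<integral>x. indicator {a<..} x * h x \<partial>lebesgue)"
    proof (rule integral_cong_AE)
      show "AE x in lebesgue. indicator {a<..} x * h' x = indicator {a<..} x * h x"
        using eq' by eventually_elim simp
    qed (intro borel_measurable_times borel_measurable_indicator hm h''; simp)+
    finally show ?thesis using zero by simp
  qed
  ultimately have "AE x in lborel. h' x = 0"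
    by (rule AE_eq_0_of_ray_integrals)
  with eq have "AE x in lborel. h x = 0" by eventually_elim simp
  then show ?thesis by (rule AE_completion)
qed

lemma Ioo_lebesgue [simp]: "{a<..<b::real} \<in> sets lebesgue" "{a..b::real} \<in> sets lebesgue"
  by auto

lemma finite_measure_Omega: "finite_measure (lebesgue_on \<Omega>)"
  by (rule finite_measure_lebesgue_on) simp

text \<open>The fundamental lemma of the calculus of variations. Bumps tend boundedly to indicators,
  so \<open>h\<close> integrates to 0 over every interval compactly contained in \<Omega>, and such
  intervals exhaust \<Omega>.\<close>

lemma AE_eq_0_of_bump_integrals:
  assumes loc: "locally_integrable \<Omega> h"
    and zero: "\<And>a b n. 0 < a \<Longrightarrow> a < b \<Longrightarrow> b < 1 \<Longrightarrow>
      (\<integral>x. h x * bump a b n x \<partial>lebesgue_on \<Omega>) = 0"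
  shows "AE x in lebesgue_on \<Omega>. h x = 0"
proof -
  \<comment> \<open>\<open>h\<close> is only locally integrable, so testing with rays makes sense
    only after cutting it to a compact interval.\<close>
  define hK where "hK a b x = (if x \<in> {a..b} then h x else 0)" for a b x :: real
  have int: "integrable lebesgue (hK a b)" if "0 < a" "b < 1" for a b
  proof -
    have "integrable (lebesgue_on {a..b}) h"
    proof -
      have "{a..b} \<subseteq> \<Omega>" using that by auto
      then show ?thesis
        using loc compact_Icc[of a b] unfolding locally_integrable_def by blast
    qed
    then show ?thesis
      unfolding hK_def by (subst Lebesgue_Measure.integrable_restrict_UNIV) auto
  qed
  have interval: "(\<integral>x. indicator {a<..<b} x * hK a b x \<partial>lebesgue) = 0" if ab: "0 < a" "a < b" "b < 1" for a b
  proof -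
    have "(\<lambda>n. \<integral>x. bump a b n x * hK a b x \<partial>lebesgue) \<longlonglongrightarrow> (\<integral>x. indicator {a<..<b} x * hK a b x \<partial>lebesgue)"
    proof (rule integral_dominated_convergence[where w="\<lambda>x. norm (hK a b x)"])
      have hK: "hK a b \<in> borel_measurable lebesgue"
        using int[of a b] ab by (intro borel_measurable_integrable) auto
      have ind: "indicator {a<..<b} \<in> borel_measurable lebesgue"
        by (rule borel_measurable_indicator) simp
      show "(\<lambda>x. indicator {a<..<b} x * hK a b x) \<in> borel_measurable lebesgue"
        using ind hK by (rule borel_measurable_times)
      have "bump a b n \<in> borel_measurable lebesgue" for n
        by (rule measurable_completion) (simp add: borel_measurable_continuous_onI bump_continuous)
      then show "(\<lambda>x. bump a b n x * hK a b x) \<in> borel_measurable lebesgue" for n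
        using hK by (rule borel_measurable_times)
      show "integrable lebesgue (\<lambda>x. norm (hK a b x))" using int[of a b] ab by auto
      show "AE x in lebesgue. (\<lambda>n. bump a b n x * hK a b x) \<longlonglongrightarrow> indicator {a<..<b} x * hK a b x"
        using bump_tendsto[OF ab(2)] by (intro AE_I2 tendsto_intros) auto
      show "AE x in lebesgue. norm (bump a b n x * hK a b x) \<le> norm (hK a b x)" for n
        using bump_bounds[of a b n] by (intro AE_I2) (auto simp: abs_mult intro!: mult_left_le_one_le)
    qed
    moreover have "(\<integral>x. bump a b n x * hK a b x \<partial>lebesgue) = 0" for n
    proof -
      have "(\<integral>x. bump a b n x * hK a b x \<partial>lebesgue) = (\<integral>x. (if x \<in> \<Omega> then h x * bump a b n x else 0) \<partial>lebesgue)"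
        using ab bump_outside[OF ab(2), of _ n] by (intro Bochner_Integration.integral_cong refl) (auto simp: hK_def)
      also have "\<dots> = 0"
        using zero[OF ab] by (subst Lebesgue_Measure.integral_restrict_UNIV) auto
      finally show ?thesis .
    qed
    ultimately show ?thesis by (simp add: LIMSEQ_const_iff)
  qed
  have compact: "AE x in lebesgue. hK a b x = 0" if ab: "0 < a" "a < b" "b < 1" for a b
  proof (rule AE_eq_0_of_ray_integrals_lebesgue)
    show "integrable lebesgue (hK a b)" using int ab by auto
    fix c
    show "(\<integral>x. indicator {c<..} x * hK a b x \<partial>lebesgue) = 0"
    proof (cases "c < b")
      case True
      \<comment> \<open>On the support of \<open>hK a b\<close> the ray from \<open>c\<close> is the
        interval from \<open>max a c\<close> to \<open>b\<close>, up to endpoints, which form a null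
        set.\<close>
      define a' where "a' = max a c"
      have a': "0 < a'" "a' < b" using True ab by (auto simp: a'_def)
      have "AE x in lebesgue. x \<noteq> y" for y :: real
        by (rule AE_completion) (rule AE_lborel_singleton)
      from this[of a] this[of b] have "AE x in lebesgue. indicator {c<..} x * hK a b x = indicator {a'<..<b} x * hK a' b x"
        by eventually_elim (auto simp: hK_def a'_def indicator_def)
      then have "(\<integral>x. indicator {c<..} x * hK a b x \<partial>lebesgue) = (\<integral>x. indicator {a'<..<b} x * hK a' b x \<partial>lebesgue)"
        using int[of a b] int[of a' b] ab a'
        by (intro integral_cong_AE borel_measurable_times borel_measurable_indicator) auto
      then show ?thesis using interval[of a' b] a' ab by simp
    next
      case False
      then have "(\<lambda>x. indicator {c<..} x * hK a b x) = (\<lambda>x. 0)" by (auto simp: hK_def)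
      then show ?thesis by simp
    qed
  qed
  \<comment> \<open>The shift by 3 keeps the left endpoint at most 1/3, so no interval of the
    exhaustion is empty.\<close>
  have "AE x in lebesgue. \<forall>n. hK (1 / real (n + 3)) (1 - 1 / real (n + 3)) x = 0"
    unfolding AE_all_countable
  proof (intro allI compact)
    fix n
    have "1 / real (n + 3) \<le> 1 / 3" by (rule divide_left_mono) auto
    then show "0 < 1 / real (n + 3)" "1 / real (n + 3) < 1 - 1 / real (n + 3)" "1 - 1 / real (n + 3) < 1"
      by auto
  qed
  then have "AE x in lebesgue. x \<in> \<Omega> \<longrightarrow> h x = 0"
  proof eventually_elim
    case (elim x)
    show ?case
    proof
      assume x: "x \<in> \<Omega>"
      then obtain n where "inverse (of_nat (Suc n)) < min x (1 - x)"
        using reals_Archimedean[of "min x (1 - x)"] by auto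
      moreover have "1 / real (n + 3) \<le> inverse (of_nat (Suc n))"
        by (auto simp: field_simps)
      ultimately have "x \<in> {1 / real (n + 3) .. 1 - 1 / real (n + 3)}" by auto
      with elim show "h x = 0" unfolding hK_def by metis
    qed
  qed
  then show ?thesis by (subst AE_restrict_space_iff) auto
qed

section \<open>Local integrability and test functions\<close>

lemma locally_integrable_measurable:
  assumes "locally_integrable \<Omega> f"
  shows "f \<in> borel_measurable (lebesgue_on \<Omega>)"
proof (rule borel_measurable_LIMSEQ_real)
  define K where "K n = {1 / real (n + 3) .. 1 - 1 / real (n + 3)}" for n
  have KS: "K n \<subseteq> \<Omega>" for n
  proof
    fix x assume "x \<in> K n"
    then have "1 / real (n + 3) \<le> x" "x \<le> 1 - 1 / real (n + 3)" unfolding K_def by auto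
    moreover have "0 < 1 / real (n + 3)" by simp
    ultimately show "x \<in> \<Omega>" unfolding greaterThanLessThan_iff by linarith
  qed
  show "(\<lambda>x. if x \<in> K n then f x else 0) \<in> borel_measurable (lebesgue_on \<Omega>)" for n
  proof -
    have "integrable (lebesgue_on (K n)) f"
      using assms KS[of n] compact_Icc unfolding locally_integrable_def K_def by blast
    then show ?thesis
      using KS[of n] borel_measurable_if_lebesgue_on[of "K n" \<Omega> f]
      by (simp add: K_def borel_measurable_integrable)
  qed
  fix x assume "x \<in> space (lebesgue_on \<Omega>)"
  then have "0 < min x (1 - x)" by auto
  then obtain n where n: "inverse (of_nat (Suc n)) < min x (1 - x)"
    using reals_Archimedean by blast
  have "x \<in> K m" if "m \<ge> n" for m
  proof -
    have "1 / real (m + 3) \<le> inverse (of_nat (Suc n))"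
      using that by (auto simp: field_simps)
    with n show ?thesis by (auto simp: K_def)
  qed
  then have "\<forall>\<^sub>F m in sequentially. (if x \<in> K m then f x else 0) = f x"
    by (auto simp: eventually_sequentially)
  then show "(\<lambda>n. if x \<in> K n then f x else 0) \<longlonglongrightarrow> f x"
    by (rule tendsto_eventually)
qed

lemma locally_integrable_of_integrable:
  assumes "integrable (lebesgue_on S) f" "S \<in> sets lebesgue"
  shows "locally_integrable S f"
  unfolding locally_integrable_def
proof (intro allI impI)
  fix K assume K: "compact K \<and> K \<subseteq> S"
  then have Km: "K \<in> sets lebesgue"
    using lmeasurable_compact fmeasurableD by blast
  have "integrable lebesgue (\<lambda>x. if x \<in> S then f x else 0)"
    using assms by (subst Lebesgue_Measure.integrable_restrict_UNIV) auto
  then have "integrable lebesgue (\<lambda>x. indicator K x *\<^sub>R (if x \<in> S then f x else 0))"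
    by (rule integrable_mult_indicator[OF Km])
  moreover have "indicator K x *\<^sub>R (if x \<in> S then f x else 0) = (if x \<in> K then f x else 0)" for x
    using K by (auto simp: indicator_def)
  ultimately show "integrable (lebesgue_on K) f"
    using Km Lebesgue_Measure.integrable_restrict_UNIV[of K f] by simp
qed

lemma L2_space_integrable:
  assumes "f \<in> L2_space \<Omega>"
  shows "integrable (lebesgue_on \<Omega>) f"
proof -
  interpret finite_measure "lebesgue_on \<Omega>" by (rule finite_measure_Omega)
  have f: "f \<in> borel_measurable (lebesgue_on \<Omega>)" "integrable (lebesgue_on \<Omega>) (\<lambda>x. (f x)\<^sup>2)"
    using assms by (auto simp: L2_space_def)
  have "integrable (lebesgue_on \<Omega>) (\<lambda>x. 1 + (f x)\<^sup>2)" using f by auto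
  then show ?thesis
  proof (rule Bochner_Integration.integrable_bound)
    have "\<bar>t\<bar> \<le> \<bar>1 + t\<^sup>2\<bar>" for t :: real
      using sum_squares_bound[of "\<bar>t\<bar>" 1] by (simp add: power2_eq_square)
    then show "AE x in lebesgue_on \<Omega>. norm (f x) \<le> norm (1 + (f x)\<^sup>2)" by simp
  qed (use f in auto)
qed

lemma test_function_bounded:
  assumes "test_function \<Omega> \<phi>"
  obtains C where "\<And>x. x \<in> \<Omega> \<Longrightarrow> \<bar>\<phi> x\<bar> \<le> C" 
    and "\<phi> \<in> borel_measurable (lebesgue_on \<Omega>)"
proof -
  obtain K where K: "compact K" "K \<subseteq> \<Omega>" "\<And>x. x \<in> \<Omega> - K \<Longrightarrow> \<phi> x = 0"
    using assms by (auto simp: test_function_def)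
  have cont: "continuous_on \<Omega> \<phi>"
    using assms by (auto simp: test_function_def Ck_on_def dest: spec[of _ 0])
  then have "compact (\<phi> ` K)"
    using K by (meson compact_continuous_image continuous_on_subset)
  then obtain C where C: "\<And>x. x \<in> K \<Longrightarrow> \<bar>\<phi> x\<bar> \<le> C"
    using compact_imp_bounded bounded_iff by (metis imageI real_norm_def)
  have "\<bar>\<phi> x\<bar> \<le> max C 0" if "x \<in> \<Omega>" for x
    using C[of x] K(3)[of x] that by (cases "x \<in> K") auto
  moreover have "\<phi> \<in> borel_measurable (lebesgue_on \<Omega>)"
    by (rule continuous_imp_measurable_on_sets_lebesgue[OF cont]) simp
  ultimately show ?thesis using that by blast
qed

lemma integrable_times_test_function:
  assumes f: "locally_integrable \<Omega> f" and \<phi>: "test_function \<Omega> \<phi>"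
  shows "integrable (lebesgue_on \<Omega>) (\<lambda>x. f x * \<phi> x)"
proof -
  obtain K where K: "compact K" "K \<subseteq> \<Omega>" "\<And>x. x \<in> \<Omega> - K \<Longrightarrow> \<phi> x = 0"
    using \<phi> by (auto simp: test_function_def)
  have Km: "K \<in> sets lebesgue"
    using K lmeasurable_compact fmeasurableD by blast
  obtain C where C: "\<And>x. x \<in> \<Omega> \<Longrightarrow> \<bar>\<phi> x\<bar> \<le> C" and \<phi>m: "\<phi> \<in> borel_measurable (lebesgue_on \<Omega>)"
    using test_function_bounded[OF \<phi>] by blast
  let ?f = "\<lambda>x. if x \<in> K then f x else 0"
  have "integrable (lebesgue_on K) f"
    using f K by (auto simp: locally_integrable_def)
  then have "integrable lebesgue ?f"
    using Lebesgue_Measure.integrable_restrict_UNIV[OF Km, of f] by simp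
  then have int: "integrable (lebesgue_on \<Omega>) ?f"
    by (rule integrable_mult_indicator[where A=\<Omega>, THEN integrable_restrict_space[THEN iffD2, rotated], rotated]) auto
  have "integrable (lebesgue_on \<Omega>) (\<lambda>x. C * ?f x)" using int by simp
  then show ?thesis
  proof (rule Bochner_Integration.integrable_bound)
    show "(\<lambda>x. f x * \<phi> x) \<in> borel_measurable (lebesgue_on \<Omega>)"
      using locally_integrable_measurable[OF f] \<phi>m by (rule borel_measurable_times)
    have "norm (f x * \<phi> x) \<le> norm (C * ?f x)" if "x \<in> \<Omega>" for x
    proof (cases "x \<in> K")
      case True
      have "\<bar>\<phi> x\<bar> \<le> \<bar>C\<bar>" using C[OF that] by linarith
      then show ?thesis using True mult_right_mono[of "\<bar>\<phi> x\<bar>" "\<bar>C\<bar>" "\<bar>f x\<bar>"]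
        by (simp add: abs_mult mult.commute)
    qed (use K(3) that in simp)
    then show "AE x in lebesgue_on \<Omega>. norm (f x * \<phi> x) \<le> norm (C * ?f x)" by (intro AE_I2) simp
  qed
qed

lemma locally_integrable_diff:
  "locally_integrable S f \<Longrightarrow> locally_integrable S g \<Longrightarrow> locally_integrable S (\<lambda>x. f x - g x)"
  by (auto simp: locally_integrable_def)

lemma weak_deriv_unique:
  assumes "has_weak_deriv k \<Omega> u v" "has_weak_deriv k \<Omega> u w"
  shows "AE x in lebesgue_on \<Omega>. v x = w x"
proof -
  have loc: "locally_integrable \<Omega> v" "locally_integrable \<Omega> w"
    using assms by (auto simp: has_weak_deriv_def)
  have "AE x in lebesgue_on \<Omega>. v x - w x = 0"
  proof (rule AE_eq_0_of_bump_integrals)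
    show "locally_integrable \<Omega> (\<lambda>x. v x - w x)" using loc by (rule locally_integrable_diff)
    fix a b :: real and n assume "0 < a" "a < b" "b < 1"
    then have t: "test_function \<Omega> (bump a b n)" by (rule test_function_bump)
    have "(\<integral>x. u x * nth_deriv_on k \<Omega> (bump a b n) x \<partial>lebesgue_on \<Omega>)
          = (- 1) ^ k * (\<integral>x. y x * bump a b n x \<partial>lebesgue_on \<Omega>)" if "has_weak_deriv k \<Omega> u y" for y
      using that t by (simp add: has_weak_deriv_def)
    from this[OF assms(1)] this[OF assms(2)] have "(\<integral>x. v x * bump a b n x \<partial>lebesgue_on \<Omega>) = (\<integral>x. w x * bump a b n x \<partial>lebesgue_on \<Omega>)"
      by simp
    then show "(\<integral>x. (v x - w x) * bump a b n x \<partial>lebesgue_on \<Omega>) = 0"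
      using integrable_times_test_function[OF loc(1) t] integrable_times_test_function[OF loc(2) t]
      by (simp add: left_diff_distrib)
  qed
  then show ?thesis by simp
qed

section \<open>Fubini on the unit square and weak derivatives of primitives\<close>

lemma measurable_ident_lebesgue_on: "(\<lambda>x::real. x) \<in> borel_measurable (lebesgue_on S)"
  using id_borel_measurable_lebesgue_on[of S] by (simp add: id_def)

lemma measurable_fst_snd_lebesgue_on:
  "(\<lambda>z. fst z :: real) \<in> borel_measurable (lebesgue_on S \<Otimes>\<^sub>M N)"
  "(\<lambda>z. snd z :: real) \<in> borel_measurable (N \<Otimes>\<^sub>M lebesgue_on S)"
  by (rule measurable_compose[OF measurable_fst measurable_ident_lebesgue_on],
      rule measurable_compose[OF measurable_snd measurable_ident_lebesgue_on])

text \<open>\<open>C * g t\<close> dominates the integrand and is integrable on the product because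
  \<Omega> has finite measure. \<open>E\<close> is left free because two relations occur:
  \<open>t \<le> x\<close> for integration by parts and \<open>\<bar>t - x\<bar> \<le> r\<close> for
  averages over balls.\<close>

lemma lebesgue_on_Omega_Fubini:
  fixes g p :: "real \<Rightarrow> real"
  assumes g: "integrable (lebesgue_on \<Omega>) g"
    and p: "p \<in> borel_measurable (lebesgue_on \<Omega>)" "\<And>x. x \<in> \<Omega> \<Longrightarrow> \<bar>p x\<bar> \<le> C"
    and E: "Measurable.pred (lebesgue_on \<Omega> \<Otimes>\<^sub>M lebesgue_on \<Omega>) (\<lambda>(x, t). E x t)"
  shows "(\<integral>x. (\<integral>t. of_bool (E x t) * g t \<partial>lebesgue_on \<Omega>) * p x \<partial>lebesgue_on \<Omega>) =
         (\<integral>t. g t * (\<integral>x. of_bool (E x t) * p x \<partial>lebesgue_on \<Omega>) \<partial>lebesgue_on \<Omega>)"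
    and "integrable (lebesgue_on \<Omega>) (\<lambda>x. (\<integral>t. of_bool (E x t) * g t \<partial>lebesgue_on \<Omega>) * p x)"
proof -
  interpret M: finite_measure "lebesgue_on \<Omega>" by (rule finite_measure_Omega)
  interpret P: pair_sigma_finite "lebesgue_on \<Omega>" "lebesgue_on \<Omega>" ..
  note [measurable] = borel_measurable_integrable[OF g] p(1) E
  have int: "integrable (lebesgue_on \<Omega> \<Otimes>\<^sub>M lebesgue_on \<Omega>) (\<lambda>z. C * g (snd z))"
  proof (rule P.Fubini_integrable)
    show "(\<lambda>z. C * g (snd z)) \<in> borel_measurable (lebesgue_on \<Omega> \<Otimes>\<^sub>M lebesgue_on \<Omega>)"
      by measurable
    have "integrable (lebesgue_on \<Omega>) (\<lambda>x. \<integral>y. norm (C * g y) \<partial>lebesgue_on \<Omega>)"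
      by (rule M.integrable_const)
    then show "integrable (lebesgue_on \<Omega>) (\<lambda>x. \<integral>y. norm (C * g (snd (x, y))) \<partial>lebesgue_on \<Omega>)"
      by (simp only: snd_conv)
    have "integrable (lebesgue_on \<Omega>) (\<lambda>y. C * g y)" by (rule integrable_mult_right) (rule g)
    then show "AE x in lebesgue_on \<Omega>. integrable (lebesgue_on \<Omega>) (\<lambda>y. C * g (snd (x, y)))"
      by (simp only: snd_conv) simp
  qed
  have int2: "integrable (lebesgue_on \<Omega> \<Otimes>\<^sub>M lebesgue_on \<Omega>) (\<lambda>(x, t). of_bool (E x t) * g t * p x)"
  proof (rule Bochner_Integration.integrable_bound[OF int])
    show "(\<lambda>(x, t). of_bool (E x t) * g t * p x) \<in> borel_measurable (lebesgue_on \<Omega> \<Otimes>\<^sub>M lebesgue_on \<Omega>)"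
      by measurable
    have "norm (of_bool (E x t) * g t * p x) \<le> norm (C * g t)" if "x \<in> \<Omega>" for x t
    proof -
      have "\<bar>p x\<bar> \<le> \<bar>C\<bar>" using p(2)[OF that] by linarith
      then show ?thesis using mult_right_mono[of "\<bar>p x\<bar>" "\<bar>C\<bar>" "\<bar>g t\<bar>"]
        by (simp add: abs_mult mult.commute)
    qed
    then show "AE z in lebesgue_on \<Omega> \<Otimes>\<^sub>M lebesgue_on \<Omega>. norm (case z of (x, t) \<Rightarrow> of_bool (E x t) * g t * p x) \<le> norm (C * g (snd z))"
      by (intro AE_I2) (auto simp: space_pair_measure)
  qed
  have "(\<integral>x. (\<integral>t. of_bool (E x t) * g t * p x \<partial>lebesgue_on \<Omega>) \<partial>lebesgue_on \<Omega>) =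
      (\<integral>t. (\<integral>x. of_bool (E x t) * g t * p x \<partial>lebesgue_on \<Omega>) \<partial>lebesgue_on \<Omega>)"
    using P.Fubini_integral[OF int2] by simp
  moreover have "(\<integral>x. of_bool (E x t) * g t * p x \<partial>lebesgue_on \<Omega>) = g t * (\<integral>x. of_bool (E x t) * p x \<partial>lebesgue_on \<Omega>)" for t
    by (subst Bochner_Integration.integral_mult_right_zero[symmetric]) (simp add: ac_simps)
  ultimately show "(\<integral>x. (\<integral>t. of_bool (E x t) * g t \<partial>lebesgue_on \<Omega>) * p x \<partial>lebesgue_on \<Omega>) =
         (\<integral>t. g t * (\<integral>x. of_bool (E x t) * p x \<partial>lebesgue_on \<Omega>) \<partial>lebesgue_on \<Omega>)"
    by simp
  have "integrable (lebesgue_on \<Omega>) (\<lambda>x. \<integral>t. of_bool (E x t) * g t * p x \<partial>lebesgue_on \<Omega>)"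
    using P.integrable_fst[OF int2] by simp
  then show "integrable (lebesgue_on \<Omega>) (\<lambda>x. (\<integral>t. of_bool (E x t) * g t \<partial>lebesgue_on \<Omega>) * p x)"
    by simp
qed

lemma integral_Omega_of_bool_le:
  fixes g :: "real \<Rightarrow> real"
  assumes "integrable (lebesgue_on \<Omega>) g" "x \<in> \<Omega>"
  shows "(\<integral>t. of_bool (t \<le> x) * g t \<partial>lebesgue_on \<Omega>) = integral {0..x} g"
proof -
  have int: "integrable (lebesgue_on \<Omega>) (\<lambda>t. of_bool (t \<le> x) * g t)"
  proof (rule Bochner_Integration.integrable_bound[OF assms(1)])
    have [measurable]: "g \<in> borel_measurable (lebesgue_on \<Omega>)" using assms(1) by (rule borel_measurable_integrable)
    show "(\<lambda>t. of_bool (t \<le> x) * g t) \<in> borel_measurable (lebesgue_on \<Omega>)"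
      using measurable_ident_lebesgue_on[of \<Omega>] by measurable
  qed auto
  have "(\<integral>t. of_bool (t \<le> x) * g t \<partial>lebesgue_on \<Omega>) = integral \<Omega> (\<lambda>t. if t \<in> {..x} then g t else 0)"
    by (subst lebesgue_integral_eq_integral[OF int]) (auto intro!: integral_cong)
  also have "\<dots> = integral ({..x} \<inter> \<Omega>) g" by (rule Henstock_Kurzweil_Integration.integral_restrict_Int)
  also have "{..x} \<inter> \<Omega> = {0<..x}" using assms by auto
  also have "integral {0<..x} g = integral {0..x} g"
  proof (rule integral_spike_set)
    have "{y \<in> {0<..x} - {0..x}. g y \<noteq> 0} \<subseteq> {0}" "{y \<in> {0..x} - {0<..x}. g y \<noteq> 0} \<subseteq> {0}" by auto
    then show "negligible {y \<in> {0<..x} - {0..x}. g y \<noteq> 0}" "negligible {y \<in> {0..x} - {0<..x}. g y \<noteq> 0}"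
      using negligible_subset[OF negligible_sing] by blast+
  qed
  finally show ?thesis .
qed

lemma integrable_Omega_subinterval:
  fixes g :: "real \<Rightarrow> real"
  assumes "integrable (lebesgue_on \<Omega>) g" "0 \<le> a" "b \<le> 1"
  shows "g integrable_on {a..b}"
proof -
  have "g integrable_on {0..1}"
    using integrable_on_lebesgue_on[OF assms(1)] by (simp add: integrable_on_Icc_iff_Ioo)
  then show ?thesis
    by (rule integrable_on_subinterval) (use assms in auto)
qed

lemma integrable_Omega_continuous:
  assumes "continuous_on {0..1} f"
  shows "integrable (lebesgue_on \<Omega>) (f :: real \<Rightarrow> real)"
proof -
  have "f absolutely_integrable_on {0..1}"
    using assms by (rule absolutely_integrable_continuous_real)
  then have "f absolutely_integrable_on \<Omega>"
    by (rule set_integrable_subset) auto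
  then show ?thesis by (rule absolutely_integrable_imp_integrable) simp
qed

text \<open>\<open>g\<close> is merely integrable, so its primitive need not satisfy a pointwise
  product rule. Instead the primitive is written as an integral over \<open>t \<le> x\<close> and
  the order of integration is exchanged; by compact support the inner integral of the derivative of
  \<phi> over \<open>t \<le> x\<close> is \<open>- \<phi> t\<close>.\<close>

lemma integral_Omega_times_deriv:
  assumes g: "integrable (lebesgue_on \<Omega>) g" and \<phi>: "test_function \<Omega> \<phi>"
  shows "(\<integral>x. integral {0..x} g * nth_deriv_on 1 \<Omega> \<phi> x \<partial>lebesgue_on \<Omega>) = - (\<integral>x. g x * \<phi> x \<partial>lebesgue_on \<Omega>)"
proof -
  let ?d = "nth_deriv_on 1 \<Omega> \<phi>"
  have \<phi>': "test_function \<Omega> ?d" using \<phi> by (intro test_function_deriv) auto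
  obtain C where C: "\<And>x. x \<in> \<Omega> \<Longrightarrow> \<bar>?d x\<bar> \<le> C" and dm: "?d \<in> borel_measurable (lebesgue_on \<Omega>)"
    using test_function_bounded[OF \<phi>'] by blast
  obtain K where K: "compact K" "K \<subseteq> \<Omega>" "\<And>x. x \<in> \<Omega> - K \<Longrightarrow> \<phi> x = 0"
    using \<phi> by (auto simp: test_function_def)
  obtain K' where K': "compact K'" "K' \<subseteq> \<Omega>" "\<And>x. x \<in> \<Omega> - K' \<Longrightarrow> ?d x = 0"
    using \<phi>' unfolding test_function_def by blast
  \<comment> \<open>\<open>b\<close> bounds both supports on the right. Beyond it \<phi> and its
    derivative vanish, so any point of \<Omega> past \<open>t\<close> and \<open>b\<close> can serve
    as upper limit of integration.\<close>
  obtain b where b: "b < 1" "\<And>x. x \<in> K \<union> K' \<Longrightarrow> x \<le> b"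
  proof (cases "K \<union> K' = {}")
    case True
    then show ?thesis using that[of 0] by auto
  next
    case False
    then obtain s where "s \<in> K \<union> K'" "\<And>t. t \<in> K \<union> K' \<Longrightarrow> t \<le> s"
      using compact_attains_sup[of "K \<union> K'"] K(1) K'(1) by (meson compact_Un)
    then show ?thesis using that[of s] K(2) K'(2) by fastforce
  qed
  have deriv: "(\<phi> has_real_derivative ?d x) (at x)" if "x \<in> \<Omega>" for x
    using Ck_on_nth_deriv[of 1 \<Omega> \<phi> 0 x] \<phi> that at_within_open[of x \<Omega>] by (auto simp: test_function_def)
  have inner: "(\<integral>x. of_bool (t \<le> x) * ?d x \<partial>lebesgue_on \<Omega>) = - \<phi> t" if t: "t \<in> \<Omega>" for t
  proof -
    define c where "c = (max t b + 1) / 2"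
    have c: "t < c" "c < 1" "b < c" using t b by (auto simp: c_def)
    have "integrable (lebesgue_on \<Omega>) (\<lambda>x. 1 * ?d x)"
    proof (rule integrable_times_test_function[OF _ \<phi>'])
      interpret finite_measure "lebesgue_on \<Omega>" by (rule finite_measure_Omega)
      show "locally_integrable \<Omega> (\<lambda>x. 1)"
        by (rule locally_integrable_of_integrable) auto
    qed
    then have "integrable (lebesgue_on \<Omega>) ?d" by simp
    then have int: "integrable (lebesgue_on \<Omega>) (\<lambda>x. of_bool (t \<le> x) * ?d x)"
    proof (rule Bochner_Integration.integrable_bound)
      show "(\<lambda>x. of_bool (t \<le> x) * ?d x) \<in> borel_measurable (lebesgue_on \<Omega>)"
        using dm measurable_ident_lebesgue_on[of \<Omega>] by measurable
    qed auto
    have "(\<integral>x. of_bool (t \<le> x) * ?d x \<partial>lebesgue_on \<Omega>) = integral \<Omega> (\<lambda>x. if x \<in> {t..c} then ?d x else 0)"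
    proof (subst lebesgue_integral_eq_integral[OF int])
      have "?d x = 0" if "x \<in> \<Omega>" "c < x" for x
        using K'(3)[of x] b(2)[of x] c(3) that by (cases "x \<in> K'") auto
      then show "integral \<Omega> (\<lambda>x. of_bool (t \<le> x) * ?d x) = integral \<Omega> (\<lambda>x. if x \<in> {t..c} then ?d x else 0)"
        by (intro integral_cong) auto
    qed simp
    also have "\<dots> = integral ({t..c} \<inter> \<Omega>) ?d" by (rule Henstock_Kurzweil_Integration.integral_restrict_Int)
    also have "{t..c} \<inter> \<Omega> = {t..c}" using t c by auto
    also have "integral {t..c} ?d = \<phi> c - \<phi> t"
    proof (intro integral_unique fundamental_theorem_of_calculus)
      fix x assume "x \<in> {t..c}"
      then have "(\<phi> has_real_derivative ?d x) (at x)" using t c by (intro deriv) auto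
      then show "(\<phi> has_vector_derivative ?d x) (at x within {t..c})"
        unfolding has_real_derivative_iff_has_vector_derivative by (rule has_vector_derivative_at_within)
    qed (use c in simp)
    also have "\<phi> c = 0"
    proof (rule K(3))
      have "c \<notin> K" using b(2)[of c] c by auto
      then show "c \<in> \<Omega> - K" using c t by auto
    qed
    finally show ?thesis by simp
  qed
  have "(\<integral>x. integral {0..x} g * ?d x \<partial>lebesgue_on \<Omega>) =
      (\<integral>x. (\<integral>t. of_bool (t \<le> x) * g t \<partial>lebesgue_on \<Omega>) * ?d x \<partial>lebesgue_on \<Omega>)"
    using integral_Omega_of_bool_le[OF g] by (intro Bochner_Integration.integral_cong refl) auto
  also have "\<dots> = (\<integral>t. g t * (\<integral>x. of_bool (t \<le> x) * ?d x \<partial>lebesgue_on \<Omega>) \<partial>lebesgue_on \<Omega>)"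
  proof (rule lebesgue_on_Omega_Fubini(1)[OF g dm C])
    show "Measurable.pred (lebesgue_on \<Omega> \<Otimes>\<^sub>M lebesgue_on \<Omega>) (\<lambda>(x, t). t \<le> x)"
      unfolding case_prod_beta not_less[symmetric]
      by (intro pred_intros_logic borel_measurable_pred_less measurable_fst_snd_lebesgue_on)
  qed
  also have "\<dots> = (\<integral>t. - (g t * \<phi> t) \<partial>lebesgue_on \<Omega>)"
    by (intro Bochner_Integration.integral_cong refl) (simp only: space_lebesgue_on inner mult_minus_right)
  finally show ?thesis by simp
qed

text \<open>The du Bois-Reymond lemma. A test function with integral 0 is the derivative of a test
  function. Subtracting a suitable multiple of one fixed bump from any other bump achieves integral
  0, so \<open>h\<close> acts on all bumps like a constant.\<close>

lemma AE_const_of_deriv_integrals: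
  assumes h: "integrable (lebesgue_on \<Omega>) h"
    and zero: "\<And>\<phi>. test_function \<Omega> \<phi> \<Longrightarrow> (\<integral>x. h x * nth_deriv_on 1 \<Omega> \<phi> x \<partial>lebesgue_on \<Omega>) = 0"
  shows "\<exists>c. AE x in lebesgue_on \<Omega>. h x = c"
proof -
  interpret finite_measure "lebesgue_on \<Omega>" by (rule finite_measure_Omega)
  have loc: "locally_integrable \<Omega> h" by (rule locally_integrable_of_integrable[OF h]) simp
  let ?I = "\<lambda>f. \<integral>x. f x \<partial>lebesgue_on \<Omega>"
  let ?\<psi> = "bump (1/4) (3/4) 0"
  have int_bump: "integrable (lebesgue_on \<Omega>) (bump a b n)" for a b n
    by (rule integrable_Omega_continuous[OF bump_continuous])
  have t\<psi>: "test_function \<Omega> ?\<psi>" by (rule test_function_bump) auto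
  have I\<psi>: "?I ?\<psi> \<noteq> 0"
  proof
    assume "?I ?\<psi> = 0"
    then have "AE x in lebesgue_on \<Omega>. ?\<psi> x = 0"
      using int_bump by (subst (asm) integral_nonneg_eq_0_iff_AE) (auto simp: bump_bounds)
    then have "AE x in lebesgue. x \<in> \<Omega> \<longrightarrow> ?\<psi> x = 0"
      by (subst (asm) AE_restrict_space_iff) auto
    then have "AE x in lebesgue. x \<notin> {1/4<..<3/4::real}"
    proof eventually_elim
      case (elim x)
      show ?case
      proof
        assume "x \<in> {1/4<..<3/4}"
        then show False using bump_pos[of "1/4" x "3/4" 0] elim by simp
      qed
    qed
    then have "{1/4<..<3/4::real} \<in> null_sets lebesgue"
      by (subst (asm) AE_iff_null_sets[symmetric]) (rule Ioo_lebesgue)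
    then have "negligible {1/4<..<3/4::real}" by (simp add: negligible_iff_null_sets)
    then show False using open_not_negligible[of "{1/4<..<3/4::real}"] by auto
  qed
  define c where "c = ?I (\<lambda>x. h x * ?\<psi> x) / ?I ?\<psi>"
  have orth: "?I (\<lambda>x. h x * bump a b n x) = c * ?I (bump a b n)" if ab: "0 < a" "a < b" "b < 1" for a b n
  proof -
    \<comment> \<open>With this multiple \<open>\<kappa>\<close> has integral 0, so its primitive
      vanishes again to the right of the support.\<close>
    define m where "m = ?I (bump a b n) / ?I ?\<psi>"
    define \<kappa> where "\<kappa> x = bump a b n x - m * ?\<psi> x" for x
    obtain G1 where G1: "deriv_tower UNIV G1" "G1 0 = bump a b n" by (rule bump_tower)
    obtain G2 where G2: "deriv_tower UNIV G2" "G2 0 = ?\<psi>" by (rule bump_tower)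
    define G where "G k x = G1 k x - m * G2 k x" for k x
    have G: "deriv_tower UNIV G"
      unfolding G_def using tower_diff[OF G1(1) tower_mult[OF G2(1), of m]] by (simp add: G_def)
    have G0: "G 0 = \<kappa>" by (auto simp: G_def \<kappa>_def G1 G2)
    have cont: "continuous_on S \<kappa>" for S
      unfolding \<kappa>_def by (intro continuous_intros bump_continuous)
    have \<kappa>I: "?I \<kappa> = 0"
      unfolding \<kappa>_def using int_bump I\<psi> by (simp add: m_def)
    then have \<kappa>01: "integral {0..1} \<kappa> = 0"
      using lebesgue_integral_eq_integral[OF integrable_Omega_continuous[OF cont]]
      by (simp add: integral_open_interval_real)
    define \<phi> where "\<phi> x = integral {0..x} \<kappa>" for x
    have d\<phi>: "(\<phi> has_real_derivative \<kappa> x) (at x)" if "x \<in> \<Omega>" for x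
    proof -
      have "(\<phi> has_real_derivative \<kappa> x) (at x within {0..1})"
        unfolding \<phi>_def using that by (intro integral_has_real_derivative cont) auto
      then show ?thesis using that at_within_Icc_at[of 0 x 1] by simp
    qed
    define lo where "lo = min a (1/4)"
    define hi where "hi = max b (3/4)"
    have lohi: "0 < lo" "hi < 1" using ab by (auto simp: lo_def hi_def)
    have \<kappa>0: "\<kappa> x = 0" if "x \<notin> {lo..hi}" for x
    proof -
      have "x \<notin> {a<..<b}" "x \<notin> {1/4<..<3/4}" using that by (auto simp: lo_def hi_def)
      then show ?thesis
        using bump_outside[OF ab(2)] bump_outside[of "1/4" "3/4" x 0] by (simp add: \<kappa>_def)
    qed
    have \<phi>0: "\<phi> x = 0" if "x \<in> \<Omega> - {lo..hi}" for x
    proof (cases "x < lo")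
      case True
      then have "integral {0..x} \<kappa> = integral {0..x} (\<lambda>x. 0)"
        by (intro integral_cong \<kappa>0) auto
      then show ?thesis by (simp add: \<phi>_def)
    next
      case False
      have "integral {0..x} \<kappa> + integral {x..1} \<kappa> = integral {0..1} \<kappa>"
        using that by (intro Henstock_Kurzweil_Integration.integral_combine integrable_continuous_real cont) auto
      moreover have "integral {x..1} \<kappa> = integral {x..1} (\<lambda>x. 0)"
        using False that by (intro integral_cong \<kappa>0) auto
      ultimately show ?thesis by (simp add: \<phi>_def \<kappa>01)
    qed
    \<comment> \<open>The tower of \<phi> is that of its derivative \<open>\<kappa>\<close> with
      \<phi> placed in front.\<close>
    have T: "deriv_tower \<Omega> (\<lambda>k. case k of 0 \<Rightarrow> \<phi> | Suc j \<Rightarrow> G j)"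
      using G d\<phi> G0 by (auto simp: deriv_tower_def split: nat.split)
    have "test_function \<Omega> \<phi>"
      using test_function_tower[OF _ T, of "{lo..hi}"] lohi \<phi>0 by (auto simp: subset_eq)
    then have "?I (\<lambda>x. h x * nth_deriv_on 1 \<Omega> \<phi> x) = 0" by (rule zero)
    moreover have "nth_deriv_on 1 \<Omega> \<phi> x = \<kappa> x" if "x \<in> \<Omega>" for x
      using nth_deriv_on_tower[OF _ T that, of 1] G0 by simp
    ultimately have "?I (\<lambda>x. h x * \<kappa> x) = 0"
      by (subst Bochner_Integration.integral_cong[OF refl, where g="\<lambda>x. h x * nth_deriv_on 1 \<Omega> \<phi> x"]) auto
    then have "?I (\<lambda>x. h x * bump a b n x - m * (h x * ?\<psi> x)) = 0"
      by (simp add: \<kappa>_def algebra_simps)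
    then have "?I (\<lambda>x. h x * bump a b n x) = m * ?I (\<lambda>x. h x * ?\<psi> x)"
      using integrable_times_test_function[OF loc t\<psi>]
        integrable_times_test_function[OF loc test_function_bump[OF ab, of n]] by simp
    then show ?thesis by (simp add: m_def c_def)
  qed
  have "AE x in lebesgue_on \<Omega>. h x - c = 0"
  proof (rule AE_eq_0_of_bump_integrals)
    show "locally_integrable \<Omega> (\<lambda>x. h x - c)"
      by (rule locally_integrable_of_integrable) (use h in auto)
    fix a b :: real and n assume ab: "0 < a" "a < b" "b < 1"
    show "?I (\<lambda>x. (h x - c) * bump a b n x) = 0"
      using orth[OF ab, of n] integrable_times_test_function[OF loc test_function_bump[OF ab, of n]]
        int_bump[of a b n] by (simp add: left_diff_distrib)
  qed
  then show ?thesis by auto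
qed

text \<open>The primitive of \<open>g\<close> also has weak derivative \<open>g\<close>, so its
  difference from \<open>f\<close> annihilates all derivatives of test functions and is
  constant.\<close>

lemma weak_deriv_1_AE_primitive:
  assumes f: "integrable (lebesgue_on \<Omega>) f" and g: "integrable (lebesgue_on \<Omega>) g"
    and w: "has_weak_deriv 1 \<Omega> f g"
  shows "\<exists>c. AE x in lebesgue_on \<Omega>. f x = c + integral {0..x} g"
proof -
  have G: "integrable (lebesgue_on \<Omega>) (\<lambda>x. integral {0..x} g)"
    using integrable_Omega_subinterval[OF g, of 0 1]
    by (intro integrable_Omega_continuous indefinite_integral_continuous_1) auto
  have loc: "locally_integrable \<Omega> f" "locally_integrable \<Omega> (\<lambda>x. integral {0..x} g)"
    by (auto intro!: locally_integrable_of_integrable f G)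
  have "\<exists>c. AE x in lebesgue_on \<Omega>. f x - integral {0..x} g = c"
  proof (rule AE_const_of_deriv_integrals)
    show "integrable (lebesgue_on \<Omega>) (\<lambda>x. f x - integral {0..x} g)" using f G by auto
    fix \<phi> assume \<phi>: "test_function \<Omega> \<phi>"
    then have \<phi>': "test_function \<Omega> (nth_deriv_on 1 \<Omega> \<phi>)" by (intro test_function_deriv) auto
    have "(\<integral>x. f x * nth_deriv_on 1 \<Omega> \<phi> x \<partial>lebesgue_on \<Omega>) = - (\<integral>x. g x * \<phi> x \<partial>lebesgue_on \<Omega>)"
      using w \<phi> by (simp add: has_weak_deriv_def)
    then show "(\<integral>x. (f x - integral {0..x} g) * nth_deriv_on 1 \<Omega> \<phi> x \<partial>lebesgue_on \<Omega>) = 0"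
      using integral_Omega_times_deriv[OF g \<phi>]
        integrable_times_test_function[OF loc(1) \<phi>'] integrable_times_test_function[OF loc(2) \<phi>']
      by (simp add: left_diff_distrib)
  qed
  then obtain c where "AE x in lebesgue_on \<Omega>. f x - integral {0..x} g = c" by blast
  then have "AE x in lebesgue_on \<Omega>. f x = c + integral {0..x} g"
    by eventually_elim simp
  then show ?thesis by blast
qed

section \<open>Higher weak derivatives and continuous representatives\<close>

lemma has_weak_deriv_step:
  assumes "has_weak_deriv k \<Omega> u v" "has_weak_deriv (Suc k) \<Omega> u w"
  shows "has_weak_deriv 1 \<Omega> v w"
  unfolding has_weak_deriv_def
proof (intro conjI allI impI)
  show "locally_integrable \<Omega> v" "locally_integrable \<Omega> w"
    using assms by (auto simp: has_weak_deriv_def)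
  fix \<phi> assume \<phi>: "test_function \<Omega> \<phi>"
  \<comment> \<open>The derivative of a test function is again one. Testing order \<open>k\<close>
    with it and order \<open>Suc k\<close> with \<phi> evaluates the same integral in two
    ways.\<close>
  then have \<phi>': "test_function \<Omega> (nth_deriv_on 1 \<Omega> \<phi>)" by (intro test_function_deriv) auto
  have "(- 1) ^ k * (\<integral>x. v x * nth_deriv_on 1 \<Omega> \<phi> x \<partial>lebesgue_on \<Omega>)
      = (\<integral>x. u x * nth_deriv_on k \<Omega> (nth_deriv_on 1 \<Omega> \<phi>) x \<partial>lebesgue_on \<Omega>)"
    using assms(1) \<phi>' by (simp add: has_weak_deriv_def)
  also have "\<dots> = (- 1) ^ Suc k * (\<integral>x. w x * \<phi> x \<partial>lebesgue_on \<Omega>)"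
    using assms(2) \<phi> by (simp add: has_weak_deriv_def nth_deriv_on_add del: power_Suc)
  also have "\<dots> = (- 1) ^ k * ((- 1) ^ 1 * (\<integral>x. w x * \<phi> x \<partial>lebesgue_on \<Omega>))"
    by simp
  finally show "(\<integral>x. v x * nth_deriv_on 1 \<Omega> \<phi> x \<partial>lebesgue_on \<Omega>) = (- 1) ^ 1 * (\<integral>x. w x * \<phi> x \<partial>lebesgue_on \<Omega>)"
    unfolding mult_cancel_left by simp
qed

lemma weak_deriv_AE:
  assumes "has_weak_deriv k \<Omega> u v"
  shows "AE x in lebesgue_on \<Omega>. weak_deriv k \<Omega> u x = v x"
    and "weak_deriv k \<Omega> u \<in> borel_measurable (lebesgue_on \<Omega>)"
proof -
  have w: "has_weak_deriv k \<Omega> u (weak_deriv k \<Omega> u)"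
    unfolding weak_deriv_def using someI[of "has_weak_deriv k \<Omega> u", OF assms] .
  show "AE x in lebesgue_on \<Omega>. weak_deriv k \<Omega> u x = v x"
    using weak_deriv_unique[OF w assms] .
  show "weak_deriv k \<Omega> u \<in> borel_measurable (lebesgue_on \<Omega>)"
    using w by (auto simp: has_weak_deriv_def intro: locally_integrable_measurable)
qed

lemma L2_norm_cong_AE:
  assumes "AE x in lebesgue_on S. f x = g x"
    "f \<in> borel_measurable (lebesgue_on S)" "g \<in> borel_measurable (lebesgue_on S)"
  shows "L2_norm S f = L2_norm S g"
proof -
  have "(\<integral>x. (f x)\<^sup>2 \<partial>lebesgue_on S) = (\<integral>x. (g x)\<^sup>2 \<partial>lebesgue_on S)"
    using assms by (intro integral_cong_AE) (auto elim: eventually_mono)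
  then show ?thesis by (simp add: L2_norm_def)
qed

lemma L2_norm_weak_deriv_le_H_norm:
  assumes "j \<le> k"
  shows "L2_norm S (weak_deriv j S u) \<le> H_norm k S u"
proof -
  have "(L2_norm S (weak_deriv j S u))\<^sup>2 \<le> (\<Sum>j\<le>k. (L2_norm S (weak_deriv j S u))\<^sup>2)"
    using assms by (intro member_le_sum) auto
  then show ?thesis unfolding H_norm_def by (rule real_le_rsqrt)
qed

text \<open>\<open>U0\<close>, \<open>U1\<close>, \<open>U2\<close>, \<open>U3\<close> are continuous representatives of the weak derivatives of orders 0 to 3 of
  \<open>u\<close>, and \<open>g\<close> is its fourth weak derivative.\<close>

locale H4_representative =
  fixes u U0 U1 U2 U3 g :: "real \<Rightarrow> real"
  assumes U_cont: "continuous_on {0..1} U0" "continuous_on {0..1} U1"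
      "continuous_on {0..1} U2" "continuous_on {0..1} U3"
    and U_deriv: "\<And>x. x \<in> \<Omega> \<Longrightarrow> (U0 has_real_derivative U1 x) (at x)"
      "\<And>x. x \<in> \<Omega> \<Longrightarrow> (U1 has_real_derivative U2 x) (at x)"
      "\<And>x. x \<in> \<Omega> \<Longrightarrow> (U2 has_real_derivative U3 x) (at x)"
    and g_L2: "g \<in> L2_space \<Omega>"
    and U3_diff: "\<And>a b. 0 \<le> a \<Longrightarrow> a \<le> b \<Longrightarrow> b \<le> 1 \<Longrightarrow> U3 b - U3 a = integral {a..b} g"
    and U0_AE: "AE x in lebesgue_on \<Omega>. u x = U0 x"
    and U_weak: "AE x in lebesgue_on \<Omega>. weak_deriv 2 \<Omega> u x = U2 x"
      "weak_deriv 2 \<Omega> u \<in> borel_measurable (lebesgue_on \<Omega>)"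
    and U_norm: "L2_norm \<Omega> U1 \<le> H_norm 4 \<Omega> u" "L2_norm \<Omega> U2 \<le> H_norm 4 \<Omega> u"
      "L2_norm \<Omega> U3 \<le> H_norm 4 \<Omega> u" "L2_norm \<Omega> g \<le> H_norm 4 \<Omega> u"

text \<open>The construction descends from order 4: each function is a constant plus the primitive
  of the one above. Integrability of \<open>g\<close> makes \<open>U3\<close> continuous, and from
  there on the primitives are classically differentiable.\<close>

lemma H4_representative_exists:
  assumes "u \<in> H_space 4 \<Omega>"
  shows "\<exists>U0 U1 U2 U3 g. H4_representative u U0 U1 U2 U3 g"
proof -
  obtain v where v: "\<And>j. j \<le> 4 \<Longrightarrow> v j \<in> L2_space \<Omega> \<and> has_weak_deriv j \<Omega> u (v j)"
    using assms unfolding H_space_def by (auto simp: Bex_def dest!: choice_iff'[THEN iffD1])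
  have uL2: "u \<in> L2_space \<Omega>" using assms by (auto simp: H_space_def)
  have wu: "has_weak_deriv 0 \<Omega> u u"
    using locally_integrable_of_integrable[OF L2_space_integrable[OF uL2]] by (simp add: has_weak_deriv_def)
  \<comment> \<open>The witness supplied for order 0 need not be \<open>u\<close>; putting
    \<open>u\<close> there makes the last primitive a representative of \<open>u\<close>
    itself.\<close>
  define w where "w j = (if j = 0 then u else v j)" for j :: nat
  have w: "w j \<in> L2_space \<Omega>" "has_weak_deriv j \<Omega> u (w j)" if "j \<le> 4" for j
    using v[OF that] uL2 wu by (auto simp: w_def)
  have step: "\<exists>c. AE x in lebesgue_on \<Omega>. w j x = c + integral {0..x} V"
    if "j < 4" and V: "AE x in lebesgue_on \<Omega>. w (Suc j) x = V x" "integrable (lebesgue_on \<Omega>) V" for j V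
  proof -
    have "has_weak_deriv 1 \<Omega> (w j) (w (Suc j))"
      using w(2)[of j] w(2)[of "Suc j"] that by (intro has_weak_deriv_step[of j u]) auto
    \<comment> \<open>A weak derivative may be altered on a null set, so the next primitive can be
      taken of the representative \<open>V\<close> already found.\<close>
    then have "has_weak_deriv 1 \<Omega> (w j) V"
    proof -
      have "(\<integral>x. w (Suc j) x * \<phi> x \<partial>lebesgue_on \<Omega>) = (\<integral>x. V x * \<phi> x \<partial>lebesgue_on \<Omega>)" if "test_function \<Omega> \<phi>" for \<phi>
      proof (rule integral_cong_AE)
        have "\<phi> \<in> borel_measurable (lebesgue_on \<Omega>)" using test_function_bounded[OF that] by blast
        then show "(\<lambda>x. w (Suc j) x * \<phi> x) \<in> borel_measurable (lebesgue_on \<Omega>)" "(\<lambda>x. V x * \<phi> x) \<in> borel_measurable (lebesgue_on \<Omega>)"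
          using V(2) w(1)[of "Suc j"] \<open>j < 4\<close> by (auto simp: L2_space_def)
        show "AE x in lebesgue_on \<Omega>. w (Suc j) x * \<phi> x = V x * \<phi> x"
          using V(1) by eventually_elim simp
      qed
      then show ?thesis
        using \<open>has_weak_deriv 1 \<Omega> (w j) (w (Suc j))\<close> locally_integrable_of_integrable[OF V(2)]
        by (simp add: has_weak_deriv_def)
    qed
    then show ?thesis
      using w(1)[of j] \<open>j < 4\<close> by (intro weak_deriv_1_AE_primitive V L2_space_integrable) auto
  qed
  define g where "g = w 4"
  have g: "g \<in> L2_space \<Omega>" "integrable (lebesgue_on \<Omega>) g"
    using w(1)[of 4] by (auto simp: g_def intro: L2_space_integrable)
  obtain c3 where c3: "AE x in lebesgue_on \<Omega>. w 3 x = c3 + integral {0..x} g"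
    using step[of 3 g] g(2) by (auto simp: g_def)
  define U3 where "U3 x = c3 + integral {0..x} g" for x
  have cU3: "continuous_on {0..1} U3"
    unfolding U3_def using integrable_Omega_subinterval[OF g(2), of 0 1]
    by (intro continuous_intros indefinite_integral_continuous_1) auto
  have cont: "continuous_on {0..1} (\<lambda>x. c + integral {0..x} V)"
    and deriv: "\<And>x. x \<in> \<Omega> \<Longrightarrow> ((\<lambda>x. c + integral {0..x} V) has_real_derivative V x) (at x)"
    if "continuous_on {0..1} V" for c and V :: "real \<Rightarrow> real"
  proof -
    show "continuous_on {0..1} (\<lambda>x. c + integral {0..x} V)"
      by (intro continuous_intros indefinite_integral_continuous_1 integrable_continuous_real that)
    fix x assume x: "x \<in> \<Omega>"
    have "((\<lambda>x. integral {0..x} V) has_real_derivative V x) (at x within {0..1})"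
      using x by (intro integral_has_real_derivative that) auto
    then have "((\<lambda>x. integral {0..x} V) has_real_derivative V x) (at x)"
      using x at_within_Icc_at[of 0 x 1] by simp
    then show "((\<lambda>x. c + integral {0..x} V) has_real_derivative V x) (at x)"
      by (auto intro!: derivative_eq_intros)
  qed
  obtain c2 where c2: "AE x in lebesgue_on \<Omega>. w 2 x = c2 + integral {0..x} U3"
    using step[of 2 U3] c3 integrable_Omega_continuous[OF cU3] by (auto simp: U3_def numeral_3_eq_3)
  define U2 where "U2 x = c2 + integral {0..x} U3" for x
  have cU2: "continuous_on {0..1} U2" unfolding U2_def by (rule cont[OF cU3])
  obtain c1 where c1: "AE x in lebesgue_on \<Omega>. w 1 x = c1 + integral {0..x} U2"
    using step[of 1 U2] c2 integrable_Omega_continuous[OF cU2] by (auto simp: U2_def numeral_2_eq_2)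
  define U1 where "U1 x = c1 + integral {0..x} U2" for x
  have cU1: "continuous_on {0..1} U1" unfolding U1_def by (rule cont[OF cU2])
  obtain c0 where c0: "AE x in lebesgue_on \<Omega>. w 0 x = c0 + integral {0..x} U1"
    using step[of 0 U1] c1 integrable_Omega_continuous[OF cU1] by (auto simp: U1_def)
  define U0 where "U0 x = c0 + integral {0..x} U1" for x
  have cU0: "continuous_on {0..1} U0" unfolding U0_def by (rule cont[OF cU1])
  have norm: "L2_norm \<Omega> V \<le> H_norm 4 \<Omega> u"
    if "j \<le> 4" "AE x in lebesgue_on \<Omega>. w j x = V x" "integrable (lebesgue_on \<Omega>) V" for j V
  proof -
    have "AE x in lebesgue_on \<Omega>. weak_deriv j \<Omega> u x = V x"
      using weak_deriv_AE(1)[OF w(2)[OF that(1)]] that(2) by eventually_elim simp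
    then have "L2_norm \<Omega> V = L2_norm \<Omega> (weak_deriv j \<Omega> u)"
      using weak_deriv_AE(2)[OF w(2)[OF that(1)]] that(3)
      by (intro L2_norm_cong_AE[symmetric]) auto
    then show ?thesis using L2_norm_weak_deriv_le_H_norm[OF that(1)] by simp
  qed
  have "H4_representative u U0 U1 U2 U3 g"
  proof
    show "U3 b - U3 a = integral {a..b} g" if "0 \<le> a" "a \<le> b" "b \<le> 1" for a b
      using Henstock_Kurzweil_Integration.integral_combine[of 0 a b g]
        integrable_Omega_subinterval[OF g(2), of 0 b] that by (simp add: U3_def)
    show "AE x in lebesgue_on \<Omega>. u x = U0 x" using c0 by (simp add: w_def U0_def)
    show "AE x in lebesgue_on \<Omega>. weak_deriv 2 \<Omega> u x = U2 x"
      using weak_deriv_AE(1)[OF w(2)[of 2], simplified] c2 unfolding U2_def by eventually_elim simp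
    show "weak_deriv 2 \<Omega> u \<in> borel_measurable (lebesgue_on \<Omega>)"
      using weak_deriv_AE(2)[OF w(2)[of 2]] by simp
    show "L2_norm \<Omega> U1 \<le> H_norm 4 \<Omega> u"
      by (rule norm[of 1]) (use c1 integrable_Omega_continuous[OF cU1] in \<open>auto simp: U1_def\<close>)
    show "L2_norm \<Omega> U2 \<le> H_norm 4 \<Omega> u"
      by (rule norm[of 2]) (use c2 integrable_Omega_continuous[OF cU2] in \<open>auto simp: U2_def\<close>)
    show "L2_norm \<Omega> U3 \<le> H_norm 4 \<Omega> u"
      by (rule norm[of 3]) (use c3 integrable_Omega_continuous[OF cU3] in \<open>auto simp: U3_def\<close>)
    show "L2_norm \<Omega> g \<le> H_norm 4 \<Omega> u"
      by (rule norm[of 4]) (use g in \<open>auto simp: g_def\<close>)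
    show "(U0 has_real_derivative U1 x) (at x)" if "x \<in> \<Omega>" for x
      unfolding U0_def by (rule deriv[OF cU1 that])
    show "(U1 has_real_derivative U2 x) (at x)" if "x \<in> \<Omega>" for x
      unfolding U1_def by (rule deriv[OF cU2 that])
    show "(U2 has_real_derivative U3 x) (at x)" if "x \<in> \<Omega>" for x
      unfolding U2_def by (rule deriv[OF cU3 that])
  qed (fact cU0 cU1 cU2 cU3 g)+
  then show ?thesis by blast
qed

section \<open>Integrals against a power of z\<close>

lemma powr_integral_bound:
  fixes N :: "real \<Rightarrow> real"
  assumes s: "s > -1" and N: "continuous_on {0<..<1} N"
    and b: "\<And>z. z \<in> {0<..<1} \<Longrightarrow> \<bar>N z\<bar> \<le> b * z powr s" and "0 \<le> a" "a \<le> 1"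
  shows "N absolutely_integrable_on {a<..<1}" and "\<bar>integral {a<..<1} N\<bar> \<le> \<bar>b\<bar> / (s + 1)"
proof -
  have P: "((\<lambda>z. \<bar>b\<bar> * z powr s) has_integral \<bar>b\<bar> / (s + 1)) {0..1}"
    using has_integral_mult_right[OF has_integral_powr_from_0[of s 1], of "\<bar>b\<bar>"] s by simp
  then have "(\<lambda>z. \<bar>b\<bar> * z powr s) integrable_on {0..1}" by (rule has_integral_integrable)
  then have int: "(\<lambda>z. \<bar>b\<bar> * z powr s) integrable_on {a..1}"
    by (rule integrable_on_subinterval) (use assms in auto)
  then have int': "(\<lambda>z. \<bar>b\<bar> * z powr s) integrable_on {a<..<1}"
    by (simp add: integrable_on_Icc_iff_Ioo)
  have le: "norm (N z) \<le> \<bar>b\<bar> * z powr s" if "z \<in> {a<..<1}" for z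
  proof -
    have "\<bar>N z\<bar> \<le> b * z powr s" using that assms by (intro b) auto
    also have "\<dots> \<le> \<bar>b\<bar> * z powr s" by (intro mult_right_mono) auto
    finally show ?thesis by simp
  qed
  show *: "N absolutely_integrable_on {a<..<1}"
  proof (rule measurable_bounded_by_integrable_imp_absolutely_integrable[OF _ _ int' le])
    show "N \<in> borel_measurable (lebesgue_on {a<..<1})"
      by (rule continuous_imp_measurable_on_sets_lebesgue[OF continuous_on_subset[OF N]]) (use assms in auto)
  qed auto
  have "norm (integral {a<..<1} N) \<le> integral {a<..<1} (\<lambda>z. \<bar>b\<bar> * z powr s)"
    using * int' le unfolding absolutely_integrable_on_def
    by (intro Henstock_Kurzweil_Integration.integral_norm_bound_integral) auto
  also have "\<dots> = integral {a..1} (\<lambda>z. \<bar>b\<bar> * z powr s)" by (rule integral_open_interval_real[symmetric])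
  also have "\<dots> \<le> integral {0..1} (\<lambda>z. \<bar>b\<bar> * z powr s)"
    by (rule integral_subset_le) (use int P assms in auto)
  also have "\<dots> = \<bar>b\<bar> / (s + 1)" using P by (rule integral_unique)
  finally show "\<bar>integral {a<..<1} N\<bar> \<le> \<bar>b\<bar> / (s + 1)" by simp
qed

text \<open>\<open>(s + 1) * z powr s\<close> has integral 1 over the unit interval, so a comparison
  of integrands becomes a comparison of the integral with \<open>- a\<close>. The use is
  \<open>s = 2 - \<beta>\<close> with \<open>a\<close> the value of u'' at the point; the other two
  conclusions prepare the removal of the truncation.\<close>

lemma powr_integral_asymptotics:
  fixes N :: "real \<Rightarrow> real"
  assumes s: "s > -1" and N: "continuous_on {0<..<1} N"
    and b: "\<And>z. z \<in> {0<..<1} \<Longrightarrow> \<bar>N z + (s + 1) * a * z powr s\<bar> \<le> (s + 1) * b * z powr s"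
  shows "\<bar>integral {0<..<1} N + a\<bar> \<le> b"
    and "\<And>\<epsilon>. 0 \<le> \<epsilon> \<Longrightarrow> \<epsilon> \<le> 1 \<Longrightarrow> \<bar>integral {\<epsilon><..<1} N\<bar> \<le> \<bar>a\<bar> + b"
    and "((\<lambda>\<epsilon>. integral {\<epsilon><..<1} N) \<longlongrightarrow> integral {0<..<1} N) (at_right 0)"
proof -
  have b0: "0 \<le> b"
  proof -
    have "0 \<le> (s + 1) * b * (1/2) powr s" using b[of "1/2"] by fastforce
    then show ?thesis using s by (simp add: zero_le_mult_iff)
  qed
  have c: "continuous_on {0<..<1} (\<lambda>z. (s + 1) * a * z powr s)"
    by (intro continuous_intros) auto
  have cN: "continuous_on {0<..<1} (\<lambda>z. N z + (s + 1) * a * z powr s)"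
    using N c by (rule continuous_on_add)
  have le: "\<bar>N z\<bar> \<le> (s + 1) * (\<bar>a\<bar> + b) * z powr s" if "z \<in> {0<..<1}" for z
  proof -
    have "\<bar>N z\<bar> \<le> \<bar>N z + (s + 1) * a * z powr s\<bar> + \<bar>(s + 1) * a * z powr s\<bar>" by linarith
    also have "\<bar>(s + 1) * a * z powr s\<bar> = (s + 1) * \<bar>a\<bar> * z powr s" using s by (simp add: abs_mult)
    finally show ?thesis using b[OF that] by (simp add: algebra_simps)
  qed
  have absb: "\<bar>(s + 1) * (\<bar>a\<bar> + b)\<bar> / (s + 1) = \<bar>a\<bar> + b" "\<bar>(s + 1) * b\<bar> / (s + 1) = b"
    using b0 s by (auto simp: abs_mult)
  show "\<bar>integral {\<epsilon><..<1} N\<bar> \<le> \<bar>a\<bar> + b" if "0 \<le> \<epsilon>" "\<epsilon> \<le> 1" for \<epsilon>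
    using powr_integral_bound(2)[OF s N le that] absb(1) by simp
  have Nint: "N integrable_on {0<..<1}"
    using powr_integral_bound(1)[OF s N le, of 0] by (simp add: absolutely_integrable_on_def)
  have P: "((\<lambda>z. (s + 1) * a * z powr s) has_integral a) {0..1}"
    using has_integral_mult_right[OF has_integral_powr_from_0[of s 1], of "(s + 1) * a"] s by simp
  then have P': "((\<lambda>z. (s + 1) * a * z powr s) has_integral a) {0<..<1}"
    by (simp add: has_integral_Icc_iff_Ioo)
  have "integral {0<..<1} (\<lambda>z. N z + (s + 1) * a * z powr s) = integral {0<..<1} N + a"
    using integral_add[OF Nint has_integral_integrable[OF P']] integral_unique[OF P'] by simp
  then show "\<bar>integral {0<..<1} N + a\<bar> \<le> b"
    using powr_integral_bound(2)[OF s cN b, of 0] absb(2) by simp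
  have Nint': "N integrable_on {0..1}" using Nint by (simp add: integrable_on_Icc_iff_Ioo)
  have "continuous_on {0..1} (\<lambda>\<epsilon>. integral {\<epsilon>..1} N)"
    using Nint' by (rule indefinite_integral_continuous_1')
  then have "((\<lambda>\<epsilon>. integral {\<epsilon>..1} N) \<longlongrightarrow> integral {0..1} N) (at 0 within {0..1})"
    unfolding continuous_on_def by (metis atLeastAtMost_iff order_refl zero_le_one)
  then have "((\<lambda>\<epsilon>. integral {\<epsilon>..1} N) \<longlongrightarrow> integral {0..1} N) (at_right 0)"
    by (simp add: at_within_Icc_at_right)
  then show "((\<lambda>\<epsilon>. integral {\<epsilon><..<1} N) \<longlongrightarrow> integral {0<..<1} N) (at_right 0)"
    by (simp add: integral_open_interval_real)
qed

subsection \<open>One piece of the nonlocal operator\<close>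

text \<open>The expressions in \<open>odd1\<close>, \<open>even\<close> and \<open>odd2\<close> are, up to powers of \<open>z\<close>, the coefficients of \<open>u'\<close>, \<open>u''\<close>
  and \<open>u'''\<close> that remain after pairing \<open>z\<close> with \<open>- z\<close> and subtracting the leading term.\<close>

locale kernel_piece =
  fixes x \<delta> k C e0 :: real and Y e D :: "real \<Rightarrow> real"
  assumes x: "x \<in> \<Omega>" and \<delta>: "0 < \<delta>" and k: "0 < k" and C: "0 \<le> C" and e0: "0 < e0"
    and Y_deriv: "\<And>z. \<bar>z\<bar> < 1 \<Longrightarrow> (Y has_real_derivative e z * D z) (at z)"
    and Y_mem: "\<And>z. \<bar>z\<bar> < 1 \<Longrightarrow> Y z \<in> \<Omega>"
    and Y_eq: "\<And>z. \<bar>z\<bar> < 1 \<Longrightarrow> Y z = x + z * e z"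
    and e_bounds: "\<And>z. \<bar>z\<bar> < 1 \<Longrightarrow> e0 \<le> e z" "\<And>z. \<bar>z\<bar> < 1 \<Longrightarrow> e z \<le> \<delta> * k"
    and D_bounds: "\<And>z. \<bar>z\<bar> < 1 \<Longrightarrow> 0 < D z" "\<And>z. \<bar>z\<bar> < 1 \<Longrightarrow> D z \<le> 3 / 2"
    and e_cont: "continuous_on {-1<..<1} e" and D_cont: "continuous_on {-1<..<1} D"
    and odd1: "\<And>z. 0 < z \<Longrightarrow> z < 1 \<Longrightarrow> \<bar>D z / e z - D (- z) / e (- z)\<bar> \<le> C * \<delta>\<^sup>2 * z"
    and even: "\<And>z. 0 < z \<Longrightarrow> z < 1 \<Longrightarrow> \<bar>D z + D (- z) - 2\<bar> \<le> C * \<delta>\<^sup>2"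
    and odd2: "\<And>z. 0 < z \<Longrightarrow> z < 1 \<Longrightarrow> \<bar>D z * e z - D (- z) * e (- z)\<bar> \<le> C * \<delta>\<^sup>2"
begin

lemma e_pos: "\<bar>z\<bar> < 1 \<Longrightarrow> 0 < e z"
  using e0 e_bounds(1)[of z] by linarith

lemma Y_inj: "inj_on Y {-1<..<1}"
proof (rule strict_mono_on_imp_inj_on, rule strict_mono_onI)
  fix r s :: real assume rs: "r \<in> {-1<..<1}" "s \<in> {-1<..<1}" "r < s"
  show "Y r < Y s"
  proof (rule DERIV_pos_imp_increasing[OF rs(3)])
    fix z assume "r \<le> z" "z \<le> s"
    then have z: "\<bar>z\<bar> < 1" using rs by auto
    show "\<exists>y. (Y has_real_derivative y) (at z) \<and> 0 < y"
      using Y_deriv[OF z] e_pos[OF z] D_bounds(1)[OF z] by (intro exI[of _ "e z * D z"]) auto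
  qed
qed

text \<open>The integrand after the substitution y = Y z, up to a constant: the weight
  \<open>e powr (- (3 - \<beta>))\<close>, the kernel
  \<open>(\<bar>z\<bar> * e) powr (- \<beta>)\<close> and the Jacobian \<open>e * D\<close> combine
  so that \<beta> leaves the exponent of \<open>e\<close>.\<close>

definition kern :: "real \<Rightarrow> (real \<Rightarrow> real) \<Rightarrow> real \<Rightarrow> real" where
  "kern \<beta> u z = \<bar>z\<bar> powr (- \<beta>) * (D z / (e z)\<^sup>2 * (u x - u (Y z)))"

lemma kern_cont:
  assumes u: "continuous_on {0..1} u"
  shows "continuous_on ({-1<..<1} - {0}) (kern \<beta> u)"
proof -
  have cY: "continuous_on ({-1<..<1} - {0}) Y"
  proof (intro continuous_at_imp_continuous_on ballI)
    fix z :: real assume "z \<in> {-1<..<1} - {0}"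
    then have "\<bar>z\<bar> < 1" by auto
    then show "isCont Y z" by (intro DERIV_isCont[OF Y_deriv])
  qed
  have ce: "continuous_on ({-1<..<1} - {0}) e" "continuous_on ({-1<..<1} - {0}) D"
    using e_cont D_cont by (auto intro: continuous_on_subset)
  have cu: "continuous_on ({-1<..<1} - {0}) (\<lambda>z. u (Y z))"
    by (rule continuous_on_compose2[OF u cY]) (use Y_mem in \<open>force simp: abs_less_iff\<close>)
  have ne: "\<forall>z\<in>{-1<..<1} - {0}. (e z)\<^sup>2 \<noteq> 0" using e_pos by (force simp: abs_less_iff)
  show ?thesis
    unfolding kern_def
    by (intro continuous_on_mult continuous_on_divide continuous_on_diff continuous_on_const cu ce ne
        continuous_on_power continuous_on_powr continuous_on_rabs continuous_on_id) auto
qed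

text \<open>Since \<open>\<bar>x - Y z\<bar> = \<bar>z\<bar> * e z\<close>, the substitution by the
  injective \<open>Y\<close> turns the truncated region into a fixed symmetric set of z. Reflecting
  its negative half produces the symmetric sum in which odd terms cancel.\<close>

lemma kern_integral:
  assumes u: "continuous_on {0..1} u" and \<epsilon>: "0 < \<epsilon>" "\<epsilon> < 1"
    and W: "\<And>z. \<bar>z\<bar> < 1 \<Longrightarrow> W (Y z) = c * e z powr (- (3 - \<beta>))"
  defines "S \<equiv> Y ` {z. \<epsilon> < \<bar>z\<bar> \<and> \<bar>z\<bar> < 1}"
  shows "(\<lambda>y. W y * ((u x - u y) / \<bar>x - y\<bar> powr \<beta>)) absolutely_integrable_on S"
    and "integral S (\<lambda>y. W y * ((u x - u y) / \<bar>x - y\<bar> powr \<beta>)) =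
         integral {\<epsilon><..<1} (\<lambda>z. c * (kern \<beta> u z + kern \<beta> u (- z)))"
proof -
  define T where "T = {z. \<epsilon> < \<bar>z\<bar> \<and> \<bar>z\<bar> < 1}"
  let ?f = "\<lambda>y. W y * ((u x - u y) / \<bar>x - y\<bar> powr \<beta>)"
  have T: "T = {-1<..<-\<epsilon>} \<union> {\<epsilon><..<1}" using \<epsilon> by (auto simp: T_def)
  have Tm: "T \<in> sets lebesgue" unfolding T by auto
  have TI: "\<bar>z\<bar> < 1" "z \<noteq> 0" "\<epsilon> < \<bar>z\<bar>" if "z \<in> T" for z using that \<epsilon> by (auto simp: T_def)
  have cont: "continuous_on T (kern \<beta> u)"
    by (rule continuous_on_subset[OF kern_cont[OF u]]) (use \<epsilon> in \<open>auto simp: T\<close>)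
  have "compact (u ` {0..1})" using u by (intro compact_continuous_image) auto
  then obtain B where B: "\<And>y. y \<in> {0..1} \<Longrightarrow> \<bar>u y\<bar> \<le> B"
    using compact_imp_bounded bounded_iff by (metis imageI real_norm_def)
  \<comment> \<open>A crude bound that serves integrability alone; it is finite because z stays away
    from 0. The maximum covers both signs of the exponent.\<close>
  define K where "K = max 1 (\<epsilon> powr (-\<beta>)) * (3 / 2 / e0\<^sup>2 * (B + B))"
  have bound: "norm (kern \<beta> u z) \<le> K" if "z \<in> T" for z
  proof -
    note z = TI[OF that]
    have 1: "\<bar>z\<bar> powr (-\<beta>) \<le> max 1 (\<epsilon> powr (-\<beta>))"
    proof (cases "\<beta> \<ge> 0")
      case True
      then have "\<bar>z\<bar> powr (-\<beta>) \<le> \<epsilon> powr (-\<beta>)" using z \<epsilon> by (intro powr_mono2') auto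
      then show ?thesis by simp
    next
      case False
      then have "\<bar>z\<bar> powr (-\<beta>) \<le> 1 powr (-\<beta>)" using z by (intro powr_mono2) auto
      then show ?thesis by simp
    qed
    have 2: "\<bar>D z / (e z)\<^sup>2\<bar> \<le> 3 / 2 / e0\<^sup>2"
    proof -
      have "e0\<^sup>2 \<le> (e z)\<^sup>2" using e0 e_bounds(1)[OF z(1)] by (intro power_mono) auto
      then have "D z / (e z)\<^sup>2 \<le> 3 / 2 / e0\<^sup>2"
        using D_bounds[OF z(1)] e0 by (intro frac_le) auto
      then show ?thesis using D_bounds(1)[OF z(1)] by (simp add: abs_of_pos)
    qed
    have 3: "\<bar>u x - u (Y z)\<bar> \<le> B + B"
      using B[of x] B[of "Y z"] x Y_mem[OF z(1)] by auto
    have "norm (kern \<beta> u z) = \<bar>z\<bar> powr (-\<beta>) * (\<bar>D z / (e z)\<^sup>2\<bar> * \<bar>u x - u (Y z)\<bar>)"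
      by (simp add: kern_def abs_mult)
    also have "\<dots> \<le> K"
      unfolding K_def using 1 2 3 by (intro mult_mono mult_nonneg_nonneg) auto
    finally show ?thesis .
  qed
  have "kern \<beta> u absolutely_integrable_on T"
  proof (rule measurable_bounded_by_integrable_imp_absolutely_integrable[OF _ Tm _ bound])
    show "kern \<beta> u \<in> borel_measurable (lebesgue_on T)"
      by (rule continuous_imp_measurable_on_sets_lebesgue[OF cont Tm])
    have "(\<lambda>x. K) integrable_on {-1<..<-\<epsilon>}" "(\<lambda>x. K) integrable_on {\<epsilon><..<1}"
      by (auto simp: integrable_on_Icc_iff_Ioo[symmetric])
    then show "(\<lambda>x. K) integrable_on T"
      unfolding T by (rule integrable_Un[rotated]) (use \<epsilon> in auto)
  qed
  then have ai: "(\<lambda>z. c * kern \<beta> u z) absolutely_integrable_on T"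
    by (rule set_integrable_mult_right)
  have eq: "\<bar>e z * D z\<bar> * ?f (Y z) = c * kern \<beta> u z" if "z \<in> T" for z
  proof -
    note z = TI[OF that]
    have p: "0 < e z" "0 < D z" "0 < \<bar>z\<bar>" using e_pos[OF z(1)] D_bounds(1)[OF z(1)] z by auto
    have "\<bar>x - Y z\<bar> = \<bar>z\<bar> * e z" using Y_eq[OF z(1)] p by (simp add: abs_mult)
    then have "?f (Y z) = c * e z powr (- (3 - \<beta>)) * ((u x - u (Y z)) / (\<bar>z\<bar> powr \<beta> * e z powr \<beta>))"
      using p W[OF z(1)] by (simp add: powr_mult)
    also have "\<dots> = c * (u x - u (Y z)) * \<bar>z\<bar> powr (-\<beta>) * (e z powr (- (3 - \<beta>)) * e z powr (- \<beta>))"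
      by (simp add: powr_minus field_simps)
    also have "e z powr (- (3 - \<beta>)) * e z powr (- \<beta>) = e z powr (- 3)"
      by (simp add: powr_add[symmetric])
    also have "e z powr (- 3) = 1 / (e z)^3"
      using p by (simp add: powr_minus powr_numeral field_simps)
    finally have "?f (Y z) = c * (u x - u (Y z)) * \<bar>z\<bar> powr (-\<beta>) * (1 / (e z)^3)" .
    then have "\<bar>e z * D z\<bar> * ?f (Y z) = e z * D z * (c * (u x - u (Y z)) * \<bar>z\<bar> powr (-\<beta>) * (1 / (e z)^3))"
      using p by simp
    also have "\<dots> = c * kern \<beta> u z" using p
      by (simp add: kern_def power2_eq_square power3_eq_cube)
    finally show ?thesis .
  qed
  have ai': "(\<lambda>z. \<bar>e z * D z\<bar> * ?f (Y z)) absolutely_integrable_on T"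
    by (rule absolutely_integrable_spike[OF ai, of "{}"]) (use eq in auto)
  have "?f absolutely_integrable_on (Y ` T) \<and> integral (Y ` T) ?f = integral T (\<lambda>z. \<bar>e z * D z\<bar> * ?f (Y z))"
  proof (subst has_absolute_integral_change_of_variables_1'[symmetric, OF Tm])
    show "(Y has_real_derivative e z * D z) (at z within T)" if "z \<in> T" for z
      using Y_deriv[OF TI(1)[OF that]] by (rule has_field_derivative_at_within)
    show "inj_on Y T" by (rule inj_on_subset[OF Y_inj]) (use \<epsilon> in \<open>auto simp: T\<close>)
  qed (use ai' in auto)
  then have res: "?f absolutely_integrable_on S" "integral S ?f = integral T (\<lambda>z. \<bar>e z * D z\<bar> * ?f (Y z))"
    by (auto simp: S_def T_def)
  show "?f absolutely_integrable_on S" by (rule res(1))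
  have aiL: "(\<lambda>z. c * kern \<beta> u z) absolutely_integrable_on {-1<..<-\<epsilon>}" 
   and aiR: "(\<lambda>z. c * kern \<beta> u z) absolutely_integrable_on {\<epsilon><..<1}"
    using ai unfolding T by (auto elim!: set_integrable_subset)
  have "(\<lambda>z. c * kern \<beta> u (- z)) absolutely_integrable_on {\<epsilon><..<1} \<and>
     integral {\<epsilon><..<1} (\<lambda>z. c * kern \<beta> u (- z)) = integral {-1<..<-\<epsilon>} (\<lambda>z. c * kern \<beta> u z)"
    by (rule iffD2[OF has_absolute_integral_reflect_real]) (use aiL in auto)
  note refl = this
  have "integral T (\<lambda>z. \<bar>e z * D z\<bar> * ?f (Y z)) = integral T (\<lambda>z. c * kern \<beta> u z)"
    by (rule integral_cong) (rule eq)
  also have "\<dots> = integral {-1<..<-\<epsilon>} (\<lambda>z. c * kern \<beta> u z) + integral {\<epsilon><..<1} (\<lambda>z. c * kern \<beta> u z)"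
    unfolding T using aiL aiR \<epsilon>
    by (intro integral_Un) (auto simp: absolutely_integrable_on_def)
  also have "\<dots> = integral {\<epsilon><..<1} (\<lambda>z. c * kern \<beta> u z + c * kern \<beta> u (- z))"
    using refl aiR by (subst integral_add) (auto simp: absolutely_integrable_on_def)
  finally show "integral S ?f = integral {\<epsilon><..<1} (\<lambda>z. c * (kern \<beta> u z + kern \<beta> u (- z)))"
    using res(2) by (simp add: distrib_left)
qed

text \<open>Every term is of size z^2, each for its own reason: the first order term has one z and
  gets the second from \<open>odd1\<close>, the second order term has z^2, the third order term uses
  \<open>z ^ 3 \<le> z\<^sup>2\<close>. The remainder gains only one \<delta>, from
  \<open>e\<close>; the other has to come from \<open>A\<close>.\<close>

lemma kern_expansion:
  assumes taylor: "\<And>z. \<bar>z\<bar> < 1 \<Longrightarrow>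
      \<bar>u (Y z) - u x - u1 * (z * e z) - u2 / 2 * (z * e z)\<^sup>2 - u3 / 6 * (z * e z) ^ 3\<bar> \<le> A / 6 * \<bar>z * e z\<bar> ^ 3"
    and z: "0 < z" "z < 1"
  shows "\<bar>kern \<beta> u z + kern \<beta> u (- z) + u2 * z powr (2 - \<beta>)\<bar>
    \<le> \<delta> * (C * \<delta> * (\<bar>u1\<bar> + \<bar>u2\<bar> + \<bar>u3\<bar>) + k * A) * z powr (2 - \<beta>)"
proof -
  have A: "0 \<le> A"
  proof -
    have "0 \<le> A / 6 * \<bar>1/2 * e (1/2)\<bar> ^ 3" by (rule order_trans[OF abs_ge_zero taylor]) simp
    moreover have "0 < \<bar>1/2 * e (1/2)\<bar> ^ 3" using e_pos[of "1/2"] by simp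
    ultimately show ?thesis by (simp add: zero_le_mult_iff)
  qed
  define R where "R z = u (Y z) - u x - u1 * (z * e z) - u2 / 2 * (z * e z)\<^sup>2 - u3 / 6 * (z * e z) ^ 3" for z
  have expand: "D z / (e z)\<^sup>2 * (u x - u (Y z)) =
      - (u1 * z * (D z / e z) + u2 / 2 * z\<^sup>2 * D z + u3 / 6 * z ^ 3 * (D z * e z) + R z * D z / (e z)\<^sup>2)"
    if "\<bar>z\<bar> < 1" for z
    using e_pos[OF that] by (simp add: R_def field_simps power2_eq_square power3_eq_cube)
  have Rb: "\<bar>R z * D z / (e z)\<^sup>2\<bar> \<le> \<bar>z\<bar> ^ 3 * (\<delta> * k * A / 4)" if "\<bar>z\<bar> < 1" for z
  proof -
    have "\<bar>R z * D z / (e z)\<^sup>2\<bar> = \<bar>R z\<bar> * D z / (e z)\<^sup>2" using D_bounds(1)[OF that] by (simp add: abs_mult)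
    also have "\<dots> \<le> (A / 6 * \<bar>z * e z\<bar> ^ 3) * D z / (e z)\<^sup>2"
      using taylor[OF that] D_bounds(1)[OF that] unfolding R_def by (intro divide_right_mono mult_right_mono) auto
    also have "\<dots> = A / 6 * \<bar>z\<bar> ^ 3 * (e z * D z)"
      using e_pos[OF that] by (simp add: abs_mult power_mult_distrib field_simps power2_eq_square power3_eq_cube)
    also have "\<dots> \<le> A / 6 * \<bar>z\<bar> ^ 3 * (\<delta> * k * (3 / 2))"
      using A e_bounds(2)[OF that] e_pos[OF that] D_bounds[OF that] \<delta> k
      by (intro mult_left_mono mult_mono) auto
    finally show ?thesis by (simp add: algebra_simps)
  qed
  have z': "\<bar>z\<bar> < 1" "\<bar>- z\<bar> < 1" using z by auto
  let ?Q = "D z / (e z)\<^sup>2 * (u x - u (Y z)) + D (-z) / (e (-z))\<^sup>2 * (u x - u (Y (-z))) + u2 * z\<^sup>2"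
  have Q: "?Q = - (u1 * z * (D z / e z - D (-z) / e (-z)) + u2 / 2 * z\<^sup>2 * (D z + D (-z) - 2)
      + u3 / 6 * z ^ 3 * (D z * e z - D (-z) * e (-z)) + R z * D z / (e z)\<^sup>2 + R (-z) * D (-z) / (e (-z))\<^sup>2)"
    unfolding expand[OF z'(1)] expand[OF z'(2)] by (simp add: algebra_simps add_divide_distrib diff_divide_distrib)
  have zp: "z ^ 3 \<le> z\<^sup>2" using z power_decreasing[of 2 3 z] by simp
  let ?c = "C * \<delta>\<^sup>2"
  have c0: "0 \<le> ?c" using C by simp
  have b1: "\<bar>u1 * z * (D z / e z - D (-z) / e (-z))\<bar> \<le> z\<^sup>2 * (?c * \<bar>u1\<bar>)"
  proof -
    have "\<bar>u1 * z * (D z / e z - D (-z) / e (-z))\<bar> = \<bar>u1\<bar> * z * \<bar>D z / e z - D (-z) / e (-z)\<bar>"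
      using z by (simp add: abs_mult)
    also have "\<dots> \<le> \<bar>u1\<bar> * z * (?c * z)" using odd1[OF z] z by (intro mult_left_mono) auto
    finally show ?thesis by (simp add: power2_eq_square algebra_simps)
  qed
  have b2: "\<bar>u2 / 2 * z\<^sup>2 * (D z + D (-z) - 2)\<bar> \<le> z\<^sup>2 * (?c * \<bar>u2\<bar>)"
  proof -
    have "\<bar>u2 / 2 * z\<^sup>2 * (D z + D (-z) - 2)\<bar> = \<bar>u2\<bar> / 2 * z\<^sup>2 * \<bar>D z + D (-z) - 2\<bar>"
      by (simp add: abs_mult)
    also have "\<dots> \<le> \<bar>u2\<bar> * z\<^sup>2 * ?c" using even[OF z] by (intro mult_mono) auto
    finally show ?thesis by (simp add: algebra_simps)
  qed
  have b3: "\<bar>u3 / 6 * z ^ 3 * (D z * e z - D (-z) * e (-z))\<bar> \<le> z\<^sup>2 * (?c * \<bar>u3\<bar>)"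
  proof -
    have "\<bar>u3 / 6 * z ^ 3 * (D z * e z - D (-z) * e (-z))\<bar> = \<bar>u3\<bar> / 6 * z ^ 3 * \<bar>D z * e z - D (-z) * e (-z)\<bar>"
      using z by (simp add: abs_mult)
    also have "\<dots> \<le> \<bar>u3\<bar> * z\<^sup>2 * ?c" using odd2[OF z] zp z by (intro mult_mono) auto
    finally show ?thesis by (simp add: algebra_simps)
  qed
  have b4: "\<bar>R z * D z / (e z)\<^sup>2\<bar> \<le> z\<^sup>2 * (\<delta> * k * A / 4)" "\<bar>R (-z) * D (-z) / (e (-z))\<^sup>2\<bar> \<le> z\<^sup>2 * (\<delta> * k * A / 4)"
  proof -
    have "\<bar>z\<bar> ^ 3 * (\<delta> * k * A / 4) \<le> z\<^sup>2 * (\<delta> * k * A / 4)"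
      using zp z A \<delta> k by (intro mult_right_mono) auto
    then show "\<bar>R z * D z / (e z)\<^sup>2\<bar> \<le> z\<^sup>2 * (\<delta> * k * A / 4)" "\<bar>R (-z) * D (-z) / (e (-z))\<^sup>2\<bar> \<le> z\<^sup>2 * (\<delta> * k * A / 4)"
      using Rb[OF z'(1)] Rb[OF z'(2)] by auto
  qed
  have tri: "\<bar>- (a1 + a2 + a3 + a4 + a5)\<bar> \<le> c1 + c2 + c3 + c4 + c5"
    if "\<bar>a1\<bar> \<le> c1" "\<bar>a2\<bar> \<le> c2" "\<bar>a3\<bar> \<le> c3" "\<bar>a4\<bar> \<le> c4" "\<bar>a5\<bar> \<le> c5"
    for a1 a2 a3 a4 a5 c1 c2 c3 c4 c5 :: real using that by linarith
  have "\<bar>?Q\<bar> \<le> z\<^sup>2 * (?c * \<bar>u1\<bar>) + z\<^sup>2 * (?c * \<bar>u2\<bar>) + z\<^sup>2 * (?c * \<bar>u3\<bar>) + z\<^sup>2 * (\<delta> * k * A / 4) + z\<^sup>2 * (\<delta> * k * A / 4)"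
    unfolding Q by (rule tri[OF b1 b2 b3 b4])
  also have "\<dots> = z\<^sup>2 * (?c * (\<bar>u1\<bar> + \<bar>u2\<bar> + \<bar>u3\<bar>) + \<delta> * k * A / 2)"
    by (simp add: algebra_simps)
  also have "\<dots> \<le> z\<^sup>2 * (\<delta> * (C * \<delta> * (\<bar>u1\<bar> + \<bar>u2\<bar> + \<bar>u3\<bar>) + k * A))"
  proof (rule mult_left_mono)
    have "0 \<le> \<delta> * k * A" using \<delta> k A by simp
    then show "?c * (\<bar>u1\<bar> + \<bar>u2\<bar> + \<bar>u3\<bar>) + \<delta> * k * A / 2 \<le> \<delta> * (C * \<delta> * (\<bar>u1\<bar> + \<bar>u2\<bar> + \<bar>u3\<bar>) + k * A)"
      by (simp add: algebra_simps power2_eq_square)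
  qed simp
  finally have main: "\<bar>?Q\<bar> \<le> z\<^sup>2 * (\<delta> * (C * \<delta> * (\<bar>u1\<bar> + \<bar>u2\<bar> + \<bar>u3\<bar>) + k * A))" .
  have pw: "z powr (2 - \<beta>) = z powr (- \<beta>) * z\<^sup>2"
    using z powr_add[of z "-\<beta>" 2] by (simp add: powr_numeral)
  have "kern \<beta> u z + kern \<beta> u (- z) + u2 * z powr (2 - \<beta>) = z powr (- \<beta>) * ?Q"
    using z by (simp add: kern_def pw algebra_simps)
  then have "\<bar>kern \<beta> u z + kern \<beta> u (- z) + u2 * z powr (2 - \<beta>)\<bar> = z powr (- \<beta>) * \<bar>?Q\<bar>"
    by (simp add: abs_mult)
  also have "\<dots> \<le> z powr (- \<beta>) * (z\<^sup>2 * (\<delta> * (C * \<delta> * (\<bar>u1\<bar> + \<bar>u2\<bar> + \<bar>u3\<bar>) + k * A)))"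
    using main by (intro mult_left_mono) auto
  finally show ?thesis by (simp add: pw ac_simps)
qed

end

subsection \<open>The variable horizon\<close>

text \<open>The derivative is bounded only between the two points because the bound on the third
  derivative of \<eta> will hold only near x.\<close>

lemma mean_value_bound:
  assumes f: "\<And>y. y \<in> \<Omega> \<Longrightarrow> (f has_real_derivative f' y) (at y)"
    and ab: "a \<in> \<Omega>" "b \<in> \<Omega>" and B: "\<And>y. y \<in> \<Omega> \<Longrightarrow> min a b \<le> y \<Longrightarrow> y \<le> max a b \<Longrightarrow> \<bar>f' y\<bar> \<le> B"
  shows "\<bar>f b - f a\<bar> \<le> B * \<bar>b - a\<bar>"
proof -
  have "\<bar>f b - f a\<bar> \<le> B * \<bar>b - a\<bar>" if "a \<in> \<Omega>" "b \<in> \<Omega>" "a < b" "\<And>y. y \<in> \<Omega> \<Longrightarrow> a \<le> y \<Longrightarrow> y \<le> b \<Longrightarrow> \<bar>f' y\<bar> \<le> B" for a b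
  proof -
    have "(f has_real_derivative f' y) (at y)" if "a \<le> y" "y \<le> b" for y
      using \<open>a \<in> \<Omega>\<close> \<open>b \<in> \<Omega>\<close> that by (intro f) auto
    then obtain y where y: "a < y" "y < b" "f b - f a = (b - a) * f' y"
      using MVT2[OF \<open>a < b\<close>] by blast
    have "\<bar>f' y\<bar> \<le> B" using y that by (intro that(4)) auto
    then have "(b - a) * \<bar>f' y\<bar> \<le> (b - a) * B" using \<open>a < b\<close> by (intro mult_left_mono) auto
    then show ?thesis using y \<open>a < b\<close> by (simp add: abs_mult ac_simps)
  qed
  note * = this
  consider "a < b" | "a = b" | "b < a" by linarith
  then show ?thesis
    using *[OF ab] *[OF ab(2,1)] B by cases (auto simp: abs_minus_commute)
qed

lemma cube_diff:
  fixes a b :: real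
  assumes "0 < a" "a \<le> 3 / 2" "0 < b" "b \<le> 3 / 2"
  shows "\<bar>a ^ 3 - b ^ 3\<bar> \<le> 27 / 4 * \<bar>a - b\<bar>" "a ^ 3 \<le> 27 / 8"
proof -
  have "c * d \<le> 3/2 * (3/2)" if "0 < c" "c \<le> 3/2" "0 < d" "d \<le> 3/2" for c d :: real
    using that by (intro mult_mono) auto
  from this[of a a] this[of a b] this[of b b] assms have "a * a + a * b + b * b \<le> 27 / 4" by simp
  moreover have "a ^ 3 - b ^ 3 = (a - b) * (a * a + a * b + b * b)"
    by (simp add: power3_eq_cube algebra_simps)
  moreover have "0 < a * a + a * b + b * b" using assms by (simp add: add_pos_pos)
  ultimately show "\<bar>a ^ 3 - b ^ 3\<bar> \<le> 27 / 4 * \<bar>a - b\<bar>"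
    using mult_left_mono[of "a * a + a * b + b * b" "27 / 4" "\<bar>a - b\<bar>"] by (simp add: abs_mult mult.commute)
  have "a ^ 3 \<le> (3 / 2) ^ 3" using assms by (intro power_mono) auto
  then show "a ^ 3 \<le> 27 / 8" by (simp add: power3_eq_cube)
qed

text \<open>The third derivative is controlled only after multiplication with \<eta>, since for a
  localization pair it may grow like the inverse distance to the boundary.\<close>

locale variable_horizon =
  fixes \<eta> \<eta>1 \<eta>2 \<eta>3 :: "real \<Rightarrow> real" and k M :: real
  assumes k: "0 < k" and M: "0 \<le> M"
    and \<eta>_cont: "continuous_on {0..1} \<eta>" and \<eta>_0: "\<eta> 0 = 0" and \<eta>_1: "\<eta> 1 = 0"
    and \<eta>_pos: "\<And>x. x \<in> \<Omega> \<Longrightarrow> 0 < \<eta> x"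
    and \<eta>_deriv: "\<And>x. x \<in> \<Omega> \<Longrightarrow> (\<eta> has_real_derivative \<eta>1 x) (at x)"
      "\<And>x. x \<in> \<Omega> \<Longrightarrow> (\<eta>1 has_real_derivative \<eta>2 x) (at x)"
      "\<And>x. x \<in> \<Omega> \<Longrightarrow> (\<eta>2 has_real_derivative \<eta>3 x) (at x)"
    and \<eta>1_bound: "\<And>x. x \<in> \<Omega> \<Longrightarrow> \<bar>\<eta>1 x\<bar> \<le> k"
    and \<eta>2_bound: "\<And>x. x \<in> \<Omega> \<Longrightarrow> \<bar>\<eta>2 x\<bar> \<le> M"
    and \<eta>3_bound: "\<And>x. x \<in> \<Omega> \<Longrightarrow> \<bar>\<eta>3 x\<bar> * \<eta> x \<le> M"
begin

lemma \<eta>_lipschitz_less: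
  assumes "0 \<le> x" "x < y" "y \<le> 1"
  shows "\<bar>\<eta> y - \<eta> x\<bar> \<le> k * (y - x)"
proof -
  have "\<exists>l z. x < z \<and> z < y \<and> (\<eta> has_real_derivative l) (at z) \<and> \<eta> y - \<eta> x = (y - x) * l"
  proof (rule MVT[OF \<open>x < y\<close>])
    show "continuous_on {x..y} \<eta>"
      by (rule continuous_on_subset[OF \<eta>_cont]) (use assms in auto)
    fix t assume "x < t" "t < y"
    then have "(\<eta> has_real_derivative \<eta>1 t) (at t)" using assms by (intro \<eta>_deriv(1)) auto
    then show "\<eta> differentiable (at t)" using real_differentiable_def by blast
  qed
  then obtain l z where z: "x < z" "z < y" "(\<eta> has_real_derivative l) (at z)" "\<eta> y - \<eta> x = (y - x) * l"
    by blast
  have "z \<in> \<Omega>" using z assms by auto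
  then have "l = \<eta>1 z" using \<eta>_deriv(1) z(3) DERIV_unique by blast
  then have "\<bar>l\<bar> \<le> k" using \<eta>1_bound \<open>z \<in> \<Omega>\<close> by simp
  then have "(y - x) * \<bar>l\<bar> \<le> (y - x) * k" using assms by (intro mult_left_mono) auto
  then show ?thesis using z(4) assms by (simp add: abs_mult ac_simps)
qed

lemma \<eta>_lipschitz:
  assumes "x \<in> {0..1}" "y \<in> {0..1}"
  shows "\<bar>\<eta> y - \<eta> x\<bar> \<le> k * \<bar>y - x\<bar>"
proof -
  consider "x < y" | "x = y" | "y < x" by linarith
  then show ?thesis
    using \<eta>_lipschitz_less[of x y] \<eta>_lipschitz_less[of y x] assms by cases auto
qed

end

locale scaled_horizon = variable_horizon +
  fixes \<delta> :: real
  assumes \<delta>: "0 < \<delta>" and \<delta>k: "3 * \<delta> * k < 1"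
begin

definition h :: "real \<Rightarrow> real" where "h y = \<delta> * \<eta> y"

lemma h_pos: "x \<in> \<Omega> \<Longrightarrow> 0 < h x"
  using \<delta> \<eta>_pos by (simp add: h_def)

lemma h_lipschitz':
  assumes "x \<in> {0..1}" "y \<in> {0..1}"
  shows "\<bar>h y - h x\<bar> \<le> \<delta> * k * \<bar>y - x\<bar>"
proof -
  have "\<bar>h y - h x\<bar> = \<delta> * \<bar>\<eta> y - \<eta> x\<bar>"
    using \<delta> by (simp add: h_def abs_mult flip: right_diff_distrib)
  also have "\<dots> \<le> \<delta> * (k * \<bar>y - x\<bar>)" using \<eta>_lipschitz[OF assms] \<delta> by (intro mult_left_mono) auto
  finally show ?thesis by (simp add: ac_simps)
qed

lemma h_lipschitz:
  assumes "x \<in> {0..1}" "y \<in> {0..1}"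
  shows "\<bar>h y - h x\<bar> \<le> \<bar>y - x\<bar> / 3"
proof -
  have "\<delta> * k * \<bar>y - x\<bar> \<le> 1 / 3 * \<bar>y - x\<bar>" using \<delta>k by (intro mult_right_mono) auto
  then show ?thesis using h_lipschitz'[OF assms] by simp
qed

text \<open>\<open>h\<close> vanishes at both endpoints and is Lipschitz with constant 1/3, so it
  stays below a third of the distance to the boundary. Hence the horizon around x remains inside
  \<Omega>.\<close>

lemma h_le:
  assumes "x \<in> \<Omega>"
  shows "h x \<le> x / 3" "h x \<le> (1 - x) / 3" "h x \<le> \<delta> * k"
proof -
  have "h 0 = 0" "h 1 = 0" by (auto simp: h_def \<eta>_0 \<eta>_1)
  then show "h x \<le> x / 3" "h x \<le> (1 - x) / 3"
    using h_lipschitz[of 0 x] h_lipschitz[of 1 x] assms by (auto simp: abs_if split: if_splits)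
  have "\<delta> * k * x \<le> \<delta> * k * 1" using \<delta> k assms by (intro mult_left_mono) auto
  then show "h x \<le> \<delta> * k"
    using h_lipschitz'[of 0 x] \<open>h 0 = 0\<close> assms by (auto simp: abs_if split: if_splits)
qed

lemma fixed_point_unique:
  assumes "y \<in> \<Omega>" "y' \<in> \<Omega>" "\<bar>z\<bar> \<le> 1" "y = x + z * h y" "y' = x + z * h y'"
  shows "y = y'"
proof -
  have "\<bar>y - y'\<bar> = \<bar>z\<bar> * \<bar>h y - h y'\<bar>"
    using assms(4,5) by (metis abs_mult add_diff_cancel_left right_diff_distrib)
  also have "\<dots> \<le> 1 * (\<bar>y - y'\<bar> / 3)" using h_lipschitz[of y' y] assms by (intro mult_mono) auto
  finally show ?thesis by simp
qed

text \<open>\<open>y - z * h y\<close> fixes 0 and 1 because \<open>h\<close> vanishes there, so the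
  intermediate value theorem reaches x. An endpoint cannot be the solution, because x is
  interior.\<close>

lemma fixed_point_exists:
  assumes x: "x \<in> \<Omega>" and z: "\<bar>z\<bar> \<le> 1"
  shows "\<exists>y. y \<in> \<Omega> \<and> y = x + z * h y"
proof -
  have "continuous_on {0..1} (\<lambda>y. y - z * h y)"
    unfolding h_def by (intro continuous_intros \<eta>_cont)
  then obtain y where y: "0 \<le> y" "y \<le> 1" "y - z * h y = x"
    using IVT'[of "\<lambda>y. y - z * h y" 0 x 1] x by (auto simp: h_def \<eta>_0 \<eta>_1)
  have "y \<noteq> 0" "y \<noteq> 1" using y(3) x by (auto simp: h_def \<eta>_0 \<eta>_1)
  then show ?thesis using y by (intro exI[of _ y]) auto
qed

definition Y :: "real \<Rightarrow> real \<Rightarrow> real" where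
  "Y x z = (THE y. y \<in> \<Omega> \<and> y = x + z * h y)"

lemma Y_props:
  assumes "x \<in> \<Omega>" "\<bar>z\<bar> \<le> 1"
  shows "Y x z \<in> \<Omega>" "Y x z = x + z * h (Y x z)"
proof -
  have "\<exists>!y. y \<in> \<Omega> \<and> y = x + z * h y"
    using fixed_point_exists[OF assms] fixed_point_unique[OF _ _ assms(2)] by blast
  from theI'[OF this] show "Y x z \<in> \<Omega>" "Y x z = x + z * h (Y x z)"
    unfolding Y_def by auto
qed

lemma Y_eqI:
  assumes "x \<in> \<Omega>" "\<bar>z\<bar> \<le> 1" "y \<in> \<Omega>" "y = x + z * h y"
  shows "Y x z = y"
  using fixed_point_unique[of "Y x z" y z x] Y_props[OF assms(1,2)] assms by blast

text \<open>Subtracting the two fixed point equations leaves \<open>(w - z) * h (Y x z)\<close> and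
  a term of at most a third of the difference itself; absorbing that term gives 3/2.\<close>

lemma Y_diff:
  assumes "x \<in> \<Omega>" "\<bar>z\<bar> \<le> 1" "\<bar>w\<bar> \<le> 1"
  shows "\<bar>Y x w - Y x z\<bar> \<le> 3 / 2 * h (Y x z) * \<bar>w - z\<bar>"
proof -
  note Yz = Y_props[OF assms(1,2)] and Yw = Y_props[OF assms(1,3)]
  have "Y x w - Y x z = (w - z) * h (Y x z) + w * (h (Y x w) - h (Y x z))"
    using Yz(2) Yw(2) by (simp add: algebra_simps)
  then have "\<bar>Y x w - Y x z\<bar> \<le> \<bar>w - z\<bar> * \<bar>h (Y x z)\<bar> + \<bar>w\<bar> * \<bar>h (Y x w) - h (Y x z)\<bar>"
    by (metis abs_mult abs_triangle_ineq)
  also have "\<dots> \<le> \<bar>w - z\<bar> * h (Y x z) + 1 * (\<bar>Y x w - Y x z\<bar> / 3)"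
    using h_lipschitz[of "Y x z" "Y x w"] Yz(1) Yw(1) assms(3) h_pos[OF Yz(1)]
    by (intro add_mono mult_mono) auto
  finally show ?thesis by (simp add: ac_simps)
qed

text \<open>\<open>Y x z\<close> lies within \<open>h (Y x z)\<close> of x, so between the two
  points \<open>h\<close> changes by at most a third of \<open>h (Y x z)\<close>.\<close>

lemma h_Y_bounds:
  assumes "x \<in> \<Omega>" "\<bar>z\<bar> \<le> 1"
  shows "2 / 3 * h (Y x z) \<le> h x" "h x \<le> 4 / 3 * h (Y x z)"
proof -
  note Yz = Y_props[OF assms]
  have p: "0 < h (Y x z)" using h_pos[OF Yz(1)] .
  have "\<bar>Y x z - x\<bar> = \<bar>z\<bar> * h (Y x z)"
    using Yz(2) p by (metis abs_mult abs_of_pos add_diff_cancel_left')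
  also have "\<dots> \<le> 1 * h (Y x z)" using assms(2) p by (intro mult_right_mono) auto
  finally have "\<bar>h (Y x z) - h x\<bar> \<le> h (Y x z) / 3"
    using h_lipschitz[of x "Y x z"] Yz(1) assms(1) by auto
  then show "2 / 3 * h (Y x z) \<le> h x" "h x \<le> 4 / 3 * h (Y x z)"
    by (auto simp: abs_if split: if_splits)
qed

lemma Y_near:
  assumes "x \<in> \<Omega>" "\<bar>z\<bar> \<le> 1"
  shows "\<bar>Y x z - x\<bar> \<le> 3 / 2 * h x"
proof -
  have p: "0 < h (Y x z)" using h_pos[OF Y_props(1)[OF assms]] .
  have "\<bar>Y x z - x\<bar> = \<bar>z\<bar> * h (Y x z)"
    using Y_props(2)[OF assms] p by (metis abs_mult abs_of_pos add_diff_cancel_left')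
  also have "\<dots> \<le> 1 * h (Y x z)" using assms(2) p by (intro mult_right_mono) auto
  finally show ?thesis using h_Y_bounds(1)[OF assms] by linarith
qed

lemma Y_isCont:
  assumes "x \<in> \<Omega>" "\<bar>z\<bar> < 1"
  shows "isCont (Y x) z"
proof -
  have "((\<lambda>w. 3 / 2 * h (Y x z) * \<bar>w - z\<bar>) \<longlongrightarrow> 3 / 2 * h (Y x z) * \<bar>z - z\<bar>) (at z)"
    by (intro tendsto_intros)
  then have lim: "((\<lambda>w. 3 / 2 * h (Y x z) * \<bar>w - z\<bar>) \<longlongrightarrow> 0) (at z)" by simp
  have "\<forall>\<^sub>F w in at z. w \<in> {-1<..<1}"
    using assms(2) by (intro eventually_at_in_open') auto
  then have "\<forall>\<^sub>F w in at z. norm (Y x w - Y x z) \<le> 3 / 2 * h (Y x z) * \<bar>w - z\<bar>"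
  proof eventually_elim
    case (elim w)
    then show ?case using Y_diff[of x z w] assms by auto
  qed
  then have "((\<lambda>w. Y x w - Y x z) \<longlongrightarrow> 0) (at z)"
    using lim by (rule Lim_null_comparison)
  then show ?thesis unfolding isCont_def by (simp add: LIM_zero_iff)
qed

definition D :: "real \<Rightarrow> real \<Rightarrow> real" where
  "D x z = 1 / (1 - z * (\<delta> * \<eta>1 (Y x z)))"

lemma h1_bound:
  assumes "y \<in> \<Omega>" "\<bar>z\<bar> \<le> 1"
  shows "\<bar>z * (\<delta> * \<eta>1 y)\<bar> \<le> \<delta> * k" "\<bar>z * (\<delta> * \<eta>1 y)\<bar> < 1 / 3"
proof -
  have "\<bar>z * (\<delta> * \<eta>1 y)\<bar> = \<bar>z\<bar> * (\<delta> * \<bar>\<eta>1 y\<bar>)" using \<delta> by (simp add: abs_mult)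
  also have "\<dots> \<le> 1 * (\<delta> * k)" using assms \<eta>1_bound[OF assms(1)] \<delta> by (intro mult_mono) auto
  finally show "\<bar>z * (\<delta> * \<eta>1 y)\<bar> \<le> \<delta> * k" by simp
  then show "\<bar>z * (\<delta> * \<eta>1 y)\<bar> < 1 / 3" using \<delta>k by linarith
qed

lemma D_bounds:
  assumes "x \<in> \<Omega>" "\<bar>z\<bar> \<le> 1"
  shows "0 < 1 - z * (\<delta> * \<eta>1 (Y x z))" "0 < D x z" "D x z \<le> 3 / 2"
proof -
  have "2 / 3 < 1 - z * (\<delta> * \<eta>1 (Y x z))"
    using h1_bound(2)[OF Y_props(1)[OF assms] assms(2)] by linarith
  then show "0 < 1 - z * (\<delta> * \<eta>1 (Y x z))" "0 < D x z" "D x z \<le> 3 / 2"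
    by (auto simp: D_def field_simps)
qed

text \<open>Implicit differentiation with the Caratheodory slope \<open>g\<close> of
  \<open>h\<close> at \<open>Y x z\<close>. The fixed point equation becomes the exact identity
  \<open>(Y x w - Y x z) * (1 - w * g (Y x w)) = (w - z) * h (Y x z)\<close>, and continuity of
  \<open>Y\<close> and \<open>g\<close> takes the quotient to its limit.\<close>

lemma Y_deriv:
  assumes x: "x \<in> \<Omega>" and z: "\<bar>z\<bar> < 1"
  shows "(Y x has_real_derivative h (Y x z) * D x z) (at z)"
proof -
  note Yz = Y_props[OF x less_imp_le[OF z]]
  have "(h has_real_derivative \<delta> * \<eta>1 (Y x z)) (at (Y x z))"
    unfolding h_def using \<eta>_deriv(1)[OF Yz(1)] by (auto intro!: derivative_eq_intros)
  then obtain g where g: "\<And>y. h y - h (Y x z) = g y * (y - Y x z)" "isCont g (Y x z)"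
      "g (Y x z) = \<delta> * \<eta>1 (Y x z)"
    unfolding CARAT_DERIV by blast
  have "((\<lambda>w. g (Y x w)) \<longlongrightarrow> g (Y x z)) (at z)"
    using isCont_tendsto_compose[OF g(2)] Y_isCont[OF x z] by (simp add: isCont_def)
  then have "((\<lambda>w. h (Y x z) / (1 - w * g (Y x w))) \<longlongrightarrow> h (Y x z) / (1 - z * g (Y x z))) (at z)"
    using D_bounds(1)[OF x less_imp_le[OF z]] g(3) by (intro tendsto_intros) auto
  moreover have "\<forall>\<^sub>F w in at z. h (Y x z) / (1 - w * g (Y x w)) = (Y x w - Y x z) / (w - z)"
  proof -
    have "\<forall>\<^sub>F w in at z. w \<in> {-1<..<1}" using z by (intro eventually_at_in_open') auto
    moreover have "\<forall>\<^sub>F w in at z. w \<noteq> z" by (simp add: eventually_at_filter)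
    ultimately show ?thesis
    proof eventually_elim
      case (elim w)
      have Yw: "Y x w = x + w * h (Y x w)" by (rule Y_props(2)[OF x]) (use elim in auto)
      have "Y x w - Y x z = (w - z) * h (Y x z) + w * (h (Y x w) - h (Y x z))"
        using Yz(2) Yw by (simp add: algebra_simps)
      then have *: "(Y x w - Y x z) * (1 - w * g (Y x w)) = (w - z) * h (Y x z)"
        unfolding g(1) by (simp add: algebra_simps)
      \<comment> \<open>The product is nonzero, hence so are its factors; this replaces a bound on
        \<open>g\<close> away from \<open>Y x z\<close>.\<close>
      moreover have "(w - z) * h (Y x z) \<noteq> 0" using elim h_pos[OF Yz(1)] by simp
      ultimately have "1 - w * g (Y x w) \<noteq> 0" by force
      then show ?case using * elim by (simp add: field_simps)
    qed
  qed
  ultimately have "((\<lambda>w. (Y x w - Y x z) / (w - z)) \<longlongrightarrow> h (Y x z) / (1 - z * g (Y x z))) (at z)"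
    by (rule Lim_transform_eventually)
  then show ?thesis
    unfolding has_field_derivative_iff using g(3) by (simp add: D_def)
qed

text \<open>The inverse map is \<open>z = (y - x) / h y\<close>, so the points y whose own horizon
  reaches x, truncated near x, correspond to a set of z that does not depend on x.\<close>

lemma Y_image:
  assumes x: "x \<in> \<Omega>" and "0 < \<epsilon>"
  shows "Y x ` {z. \<epsilon> < \<bar>z\<bar> \<and> \<bar>z\<bar> < 1} = {y \<in> \<Omega>. \<epsilon> * h y < \<bar>x - y\<bar> \<and> \<bar>x - y\<bar> < h y}"
proof (intro equalityI subsetI)
  fix y assume "y \<in> Y x ` {z. \<epsilon> < \<bar>z\<bar> \<and> \<bar>z\<bar> < 1}"
  then obtain z where z: "\<epsilon> < \<bar>z\<bar>" "\<bar>z\<bar> < 1" "y = Y x z" by auto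
  have y: "y \<in> \<Omega>" "y = x + z * h y" using Y_props[OF x less_imp_le[OF z(2)]] z(3) by auto
  then have "\<bar>x - y\<bar> = \<bar>z\<bar> * h y"
    using h_pos[OF y(1)] by (metis abs_minus_commute abs_mult abs_of_pos add_diff_cancel_left')
  then show "y \<in> {y \<in> \<Omega>. \<epsilon> * h y < \<bar>x - y\<bar> \<and> \<bar>x - y\<bar> < h y}"
    using y(1) z h_pos[OF y(1)] by simp
next
  fix y assume "y \<in> {y \<in> \<Omega>. \<epsilon> * h y < \<bar>x - y\<bar> \<and> \<bar>x - y\<bar> < h y}"
  then have y: "y \<in> \<Omega>" "\<epsilon> * h y < \<bar>x - y\<bar>" "\<bar>x - y\<bar> < h y" by auto
  define z where "z = (y - x) / h y"
  have p: "0 < h y" using h_pos[OF y(1)] .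
  have az: "\<bar>z\<bar> = \<bar>x - y\<bar> / h y" using p by (simp add: z_def abs_minus_commute)
  then have z: "\<epsilon> < \<bar>z\<bar>" "\<bar>z\<bar> < 1"
    unfolding az using y p by (simp_all add: pos_less_divide_eq pos_divide_less_eq)
  have "Y x z = y"
    by (rule Y_eqI) (use x z y p in \<open>auto simp: z_def\<close>)
  then show "y \<in> Y x ` {z. \<epsilon> < \<bar>z\<bar> \<and> \<bar>z\<bar> < 1}" using z by blast
qed

text \<open>A common bound, free of \<delta>, for the three symmetry estimates, which call for
  \<open>2 * M * k + 3 * k\<^sup>2\<close>, \<open>5 * k\<^sup>2\<close> and
  \<open>81 / 4 * M + 81 / 4 * M * k\<close>.\<close>

definition C :: real where "C = 24 * M + 24 * M * k + 9 * k\<^sup>2"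

lemma C_nonneg: "0 \<le> C"
  using M k by (simp add: C_def)

lemma D_near_1:
  assumes "x \<in> \<Omega>" "\<bar>z\<bar> \<le> 1"
  shows "D x z - 1 = z * (\<delta> * \<eta>1 (Y x z)) * D x z" "\<bar>D x z - 1\<bar> \<le> 3 / 2 * (\<delta> * k)"
proof -
  show *: "D x z - 1 = z * (\<delta> * \<eta>1 (Y x z)) * D x z"
    using D_bounds(1)[OF assms] by (simp add: D_def field_simps)
  have "\<bar>D x z - 1\<bar> = \<bar>z * (\<delta> * \<eta>1 (Y x z))\<bar> * D x z"
    unfolding * using D_bounds(2)[OF assms] by (simp add: abs_mult)
  also have "\<dots> \<le> (\<delta> * k) * (3 / 2)"
    using h1_bound(1)[OF Y_props(1)[OF assms] assms(2)] D_bounds[OF assms] \<delta> k by (intro mult_mono) auto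
  finally show "\<bar>D x z - 1\<bar> \<le> 3 / 2 * (\<delta> * k)" by simp
qed

text \<open>Two bounds for two purposes: the one proportional to \<open>h x\<close> offsets the
  growth of \<open>\<eta>3\<close> at the boundary, the other is of order \<delta> uniformly in
  x.\<close>

lemma Y_sym_diff:
  assumes "x \<in> \<Omega>" "0 \<le> z" "z \<le> 1"
  shows "\<bar>Y x z - Y x (- z)\<bar> \<le> 3 * h x" "\<bar>Y x z - Y x (- z)\<bar> \<le> 2 * (\<delta> * k)"
proof -
  have z: "\<bar>z\<bar> \<le> 1" "\<bar>- z\<bar> \<le> 1" using assms by auto
  show "\<bar>Y x z - Y x (- z)\<bar> \<le> 3 * h x"
    using Y_near[OF assms(1) z(1)] Y_near[OF assms(1) z(2)] by linarith
  have "Y x z - Y x (- z) = z * (h (Y x z) + h (Y x (- z)))"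
    using Y_props(2)[OF assms(1) z(1)] Y_props(2)[OF assms(1) z(2)] by (simp add: algebra_simps)
  also have "\<bar>\<dots>\<bar> \<le> 1 * (\<delta> * k + \<delta> * k)"
    using assms h_pos[OF Y_props(1)[OF assms(1) z(1)]] h_pos[OF Y_props(1)[OF assms(1) z(2)]]
      h_le(3)[OF Y_props(1)[OF assms(1) z(1)]] h_le(3)[OF Y_props(1)[OF assms(1) z(2)]]
    unfolding abs_mult by (intro mult_mono) auto
  finally show "\<bar>Y x z - Y x (- z)\<bar> \<le> 2 * (\<delta> * k)" by simp
qed

text \<open>\<open>D = 1 / (1 - a)\<close> equals \<open>1 + a + a\<^sup>2 * D\<close> with
  \<open>a\<close> of order \<delta>. The linear parts at z and - z have opposite prefactors and
  compare \<open>\<eta>1\<close> at points of distance O(\<delta>), so their sum is of order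
  \<delta>^2 as well.\<close>

lemma even_bound:
  assumes x: "x \<in> \<Omega>" and z: "0 < z" "z < 1"
  shows "\<bar>D x z + D x (- z) - 2\<bar> \<le> C * \<delta>\<^sup>2"
proof -
  have z': "\<bar>z\<bar> \<le> 1" "\<bar>- z\<bar> \<le> 1" using z by auto
  define a where "a = z * (\<delta> * \<eta>1 (Y x z))"
  define b where "b = - z * (\<delta> * \<eta>1 (Y x (- z)))"
  have D1: "D x z = 1 + a * D x z" "D x (- z) = 1 + b * D x (- z)"
    using D_near_1(1)[OF x z'(1)] D_near_1(1)[OF x z'(2)] by (auto simp: a_def b_def)
  then have "D x z + D x (- z) - 2 = (a + b) + a\<^sup>2 * D x z + b\<^sup>2 * D x (- z)"
    by (simp add: power2_eq_square) algebra
  moreover have "\<bar>a + b\<bar> \<le> 2 * M * k * \<delta>\<^sup>2"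
  proof -
    have "\<bar>\<eta>1 (Y x z) - \<eta>1 (Y x (- z))\<bar> \<le> M * \<bar>Y x z - Y x (- z)\<bar>"
      using \<eta>2_bound by (intro mean_value_bound[OF \<eta>_deriv(2)] Y_props(1)[OF x] z') auto
    also have "\<dots> \<le> M * (2 * (\<delta> * k))" using Y_sym_diff(2)[OF x] z M by (intro mult_left_mono) auto
    finally have 1: "\<bar>\<eta>1 (Y x z) - \<eta>1 (Y x (- z))\<bar> \<le> M * (2 * (\<delta> * k))" .
    have "\<bar>a + b\<bar> = z * \<delta> * \<bar>\<eta>1 (Y x z) - \<eta>1 (Y x (- z))\<bar>"
      using z \<delta> by (simp add: a_def b_def abs_mult flip: right_diff_distrib)
    also have "\<dots> \<le> 1 * \<delta> * (M * (2 * (\<delta> * k)))" using 1 z \<delta> by (intro mult_mono) auto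
    finally show ?thesis by (simp add: power2_eq_square algebra_simps)
  qed
  moreover have "\<bar>a\<^sup>2 * D x z\<bar> \<le> 3 / 2 * k\<^sup>2 * \<delta>\<^sup>2"
  proof -
    have "a\<^sup>2 \<le> (\<delta> * k)\<^sup>2"
      using h1_bound(1)[OF Y_props(1)[OF x z'(1)] z'(1)] unfolding a_def[symmetric] by (intro abs_le_square_iff[THEN iffD1]) auto
    then have "a\<^sup>2 * D x z \<le> (\<delta> * k)\<^sup>2 * (3 / 2)" using D_bounds[OF x z'(1)] by (intro mult_mono) auto
    then show ?thesis using D_bounds(2)[OF x z'(1)] by (simp add: abs_mult power_mult_distrib algebra_simps)
  qed
  moreover have "\<bar>b\<^sup>2 * D x (- z)\<bar> \<le> 3 / 2 * k\<^sup>2 * \<delta>\<^sup>2"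
  proof -
    have "b\<^sup>2 \<le> (\<delta> * k)\<^sup>2"
      using h1_bound(1)[OF Y_props(1)[OF x z'(2)] z'(2)] unfolding b_def[symmetric] by (intro abs_le_square_iff[THEN iffD1]) auto
    then have "b\<^sup>2 * D x (- z) \<le> (\<delta> * k)\<^sup>2 * (3 / 2)" using D_bounds[OF x z'(2)] by (intro mult_mono) auto
    then show ?thesis using D_bounds(2)[OF x z'(2)] by (simp add: abs_mult power_mult_distrib algebra_simps)
  qed
  ultimately have "\<bar>D x z + D x (- z) - 2\<bar> \<le> 2 * M * k * \<delta>\<^sup>2 + 3 / 2 * k\<^sup>2 * \<delta>\<^sup>2 + 3 / 2 * k\<^sup>2 * \<delta>\<^sup>2"
    by linarith
  also have "\<dots> = (2 * M * k + 3 * k\<^sup>2) * \<delta>\<^sup>2" by (simp add: algebra_simps)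
  also have "\<dots> \<le> C * \<delta>\<^sup>2"
  proof (rule mult_right_mono)
    have "0 \<le> M * k" "0 \<le> k\<^sup>2" using M k by auto
    then show "2 * M * k + 3 * k\<^sup>2 \<le> C" unfolding C_def using M by linarith
  qed simp
  finally show ?thesis .
qed

text \<open>\<open>D - 1\<close> and \<open>h\<close> are both of order \<delta>, so
  \<open>D\<close> may be replaced by 1. What remains is \<open>h\<close> at two points of distance
  O(\<delta>), and \<open>h\<close> has Lipschitz constant \<open>\<delta> * k\<close>.\<close>

lemma odd2_bound:
  assumes x: "x \<in> \<Omega>" and z: "0 < z" "z < 1"
  shows "\<bar>D x z * h (Y x z) - D x (- z) * h (Y x (- z))\<bar> \<le> C * \<delta>\<^sup>2"
proof -
  have z': "\<bar>z\<bar> \<le> 1" "\<bar>- z\<bar> \<le> 1" using z by auto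
  have 1: "\<bar>(D x w - 1) * h (Y x w)\<bar> \<le> 3 / 2 * (\<delta> * k) * (\<delta> * k)" if "\<bar>w\<bar> \<le> 1" for w
    using D_near_1(2)[OF x that] h_le(3)[OF Y_props(1)[OF x that]] h_pos[OF Y_props(1)[OF x that]] \<delta> k
    unfolding abs_mult by (intro mult_mono) auto
  have "\<bar>h (Y x z) - h (Y x (- z))\<bar> \<le> \<delta> * k * \<bar>Y x z - Y x (- z)\<bar>"
    using Y_props(1)[OF x z'(1)] Y_props(1)[OF x z'(2)] by (intro h_lipschitz') auto
  also have "\<dots> \<le> \<delta> * k * (2 * (\<delta> * k))" using Y_sym_diff(2)[OF x] z \<delta> k by (intro mult_left_mono) auto
  finally have 2: "\<bar>h (Y x z) - h (Y x (- z))\<bar> \<le> \<delta> * k * (2 * (\<delta> * k))" .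
  have "D x z * h (Y x z) - D x (- z) * h (Y x (- z)) =
     (D x z - 1) * h (Y x z) - (D x (- z) - 1) * h (Y x (- z)) + (h (Y x z) - h (Y x (- z)))"
    by (simp add: algebra_simps)
  then have "\<bar>D x z * h (Y x z) - D x (- z) * h (Y x (- z))\<bar> \<le>
      3 / 2 * (\<delta> * k) * (\<delta> * k) + 3 / 2 * (\<delta> * k) * (\<delta> * k) + \<delta> * k * (2 * (\<delta> * k))"
    using 1[OF z'(1)] 1[OF z'(2)] 2 by linarith
  also have "\<dots> = 5 * k\<^sup>2 * \<delta>\<^sup>2" by (simp add: power2_eq_square algebra_simps)
  also have "\<dots> \<le> C * \<delta>\<^sup>2"
  proof (rule mult_right_mono)
    have "0 \<le> M * k" "0 \<le> k\<^sup>2" using M k by auto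
    then show "5 * k\<^sup>2 \<le> C" unfolding C_def using M by linarith
  qed simp
  finally show ?thesis .
qed

text \<open>In the derivative of the reciprocal \<open>h / D\<close> the terms with
  \<open>\<eta>1\<close> alone cancel because \<open>D * (1 - z * (\<delta> * \<eta>1)) = 1\<close>.
  What is left carries \<open>h\<close> squared, so inverting removes \<open>h\<close> altogether:
  the derivative stays bounded where \<open>D / h\<close> blows up.\<close>

lemma quotient_deriv:
  assumes x: "x \<in> \<Omega>" and z: "\<bar>z\<bar> < 1"
  shows "((\<lambda>z. D x z / h (Y x z)) has_real_derivative z * (\<delta> * \<eta>2 (Y x z) * D x z ^ 3)) (at z)"
proof -
  note z' = less_imp_le[OF z]
  have Yd: "(Y x has_real_derivative h (Y x z) * D x z) (at z)" by (rule Y_deriv[OF x z])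
  have hd: "((\<lambda>z. \<delta> * \<eta> (Y x z)) has_real_derivative \<delta> * (\<eta>1 (Y x z) * (h (Y x z) * D x z))) (at z)"
    by (intro DERIV_cmult DERIV_chain2[OF _ Yd] \<eta>_deriv Y_props[OF x z'])
  have h1d: "((\<lambda>z. \<eta>1 (Y x z)) has_real_derivative \<eta>2 (Y x z) * (h (Y x z) * D x z)) (at z)"
    by (intro DERIV_chain2[OF _ Yd] \<eta>_deriv Y_props[OF x z'])
  let ?P = "\<lambda>z. (1 - z * (\<delta> * \<eta>1 (Y x z))) * (\<delta> * \<eta> (Y x z))"
  define c where "c = 1 - z * (\<delta> * \<eta>1 (Y x z))"
  define t where "t = h (Y x z)"
  have c: "0 < c" "D x z = 1 / c" using D_bounds(1)[OF x z'] by (auto simp: c_def D_def)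
  have t: "0 < t" "\<delta> * \<eta> (Y x z) = t" using h_pos[OF Y_props(1)[OF x z']] by (auto simp: t_def h_def)
  have "(?P has_real_derivative
      (0 - (1 * (\<delta> * \<eta>1 (Y x z)) + (\<delta> * (\<eta>2 (Y x z) * (h (Y x z) * D x z))) * z)) * (\<delta> * \<eta> (Y x z)) +
      (\<delta> * (\<eta>1 (Y x z) * (h (Y x z) * D x z))) * (1 - z * (\<delta> * \<eta>1 (Y x z)))) (at z)"
    by (intro DERIV_mult DERIV_diff DERIV_const DERIV_ident DERIV_cmult hd h1d)
  also have "(0 - (1 * (\<delta> * \<eta>1 (Y x z)) + (\<delta> * (\<eta>2 (Y x z) * (h (Y x z) * D x z))) * z)) * (\<delta> * \<eta> (Y x z)) +
      (\<delta> * (\<eta>1 (Y x z) * (h (Y x z) * D x z))) * (1 - z * (\<delta> * \<eta>1 (Y x z))) =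
      - (z * \<delta> * \<eta>2 (Y x z) * t\<^sup>2 / c)"
    unfolding c_def[symmetric] t_def[symmetric] c(2) t(2) using c(1)
    by (simp add: power2_eq_square algebra_simps)
  finally have Pd: "(?P has_real_derivative - (z * \<delta> * \<eta>2 (Y x z) * t\<^sup>2 / c)) (at z)" .
  have Pz: "?P z = c * t" using t by (simp add: c_def)
  have "((\<lambda>z. inverse (?P z)) has_real_derivative
      - (inverse (?P z) * - (z * \<delta> * \<eta>2 (Y x z) * t\<^sup>2 / c) * inverse (?P z))) (at z)"
    by (rule DERIV_inverse'[OF Pd]) (unfold Pz, use c(1) t(1) in simp)
  moreover have "- (inverse (?P z) * - (z * \<delta> * \<eta>2 (Y x z) * t\<^sup>2 / c) * inverse (?P z)) =
      z * (\<delta> * \<eta>2 (Y x z) * D x z ^ 3)"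
    unfolding Pz c(2) using c(1) t(1) by (simp add: field_simps power2_eq_square power3_eq_cube)
  moreover have "(\<lambda>z. inverse (?P z)) = (\<lambda>z. D x z / h (Y x z))"
    by (rule ext) (simp add: D_def h_def inverse_eq_divide)
  ultimately show ?thesis by simp
qed

text \<open>The difference \<open>P\<close> vanishes at 0 and has derivative
  \<open>t * (E t - E (- t))\<close>. The mean value theorem supplies the factor z; \<open>E\<close>
  carries one \<delta>, and its symmetric difference yields the second.\<close>

lemma odd1_bound:
  assumes x: "x \<in> \<Omega>" and z: "0 < z" "z < 1"
  shows "\<bar>D x z / h (Y x z) - D x (- z) / h (Y x (- z))\<bar> \<le> C * \<delta>\<^sup>2 * z"
proof -
  define E where "E t = \<delta> * \<eta>2 (Y x t) * D x t ^ 3" for t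
  define P where "P t = D x t / h (Y x t) - D x (- t) / h (Y x (- t))" for t
  have Pd: "(P has_real_derivative t * (E t - E (- t))) (at t)" if t: "0 \<le> t" "t < 1" for t
  proof -
    have "((\<lambda>t. D x (- t) / h (Y x (- t))) has_real_derivative (- t * E (- t)) * (- 1)) (at t)"
      unfolding E_def
      by (rule DERIV_chain2[OF quotient_deriv[OF x]]) (use t in \<open>auto intro!: derivative_eq_intros\<close>)
    then show ?thesis
      unfolding P_def E_def
      by (rule DERIV_diff[OF quotient_deriv[OF x], THEN DERIV_cong, rotated]) (use t in \<open>auto simp: algebra_simps\<close>)
  qed
  have Eb: "\<bar>E t - E (- t)\<bar> \<le> C * \<delta>\<^sup>2" if t: "0 \<le> t" "t < 1" for t
  proof -
    have t': "\<bar>t\<bar> \<le> 1" "\<bar>- t\<bar> \<le> 1" using t by auto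
    note Yt = Y_props(1)[OF x t'(1)] Y_props(1)[OF x t'(2)]
    have hx: "0 < h x" by (rule h_pos[OF x])
    have "\<bar>\<eta>2 (Y x t) - \<eta>2 (Y x (- t))\<bar> \<le> (2 * M * \<delta> / h x) * \<bar>Y x t - Y x (- t)\<bar>"
    proof (rule mean_value_bound[OF \<eta>_deriv(3)])
      fix y assume y: "y \<in> \<Omega>" "min (Y x (- t)) (Y x t) \<le> y" "y \<le> max (Y x (- t)) (Y x t)"
      then have "\<bar>y - x\<bar> \<le> 3 / 2 * h x"
        using Y_near[OF x t'(1)] Y_near[OF x t'(2)] by linarith
      \<comment> \<open>Between the two points \<open>h\<close> is at least half of
        \<open>h x\<close>, so \<open>\<eta>3\<close> is at most of order \<delta> /
        \<open>h x\<close> there. The distance of the points, at most \<open>3 * h x\<close>,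
        cancels the denominator.\<close>
      then have "\<bar>h y - h x\<bar> \<le> h x / 2"
        using h_lipschitz[of x y] x y(1) by auto
      then have "h x \<le> 2 * h y" by linarith
      then have "\<bar>\<eta>3 y\<bar> * h x \<le> \<bar>\<eta>3 y\<bar> * (2 * h y)" by (intro mult_left_mono) auto
      also have "\<dots> = 2 * \<delta> * (\<bar>\<eta>3 y\<bar> * \<eta> y)" by (simp add: h_def)
      also have "\<dots> \<le> 2 * \<delta> * M" using \<eta>3_bound[OF y(1)] \<delta> by (intro mult_left_mono) auto
      finally show "\<bar>\<eta>3 y\<bar> \<le> 2 * M * \<delta> / h x" using hx by (simp add: field_simps)
    qed (use Yt in auto)
    also have "\<dots> \<le> (2 * M * \<delta> / h x) * (3 * h x)"
      using Y_sym_diff(1)[OF x] t M \<delta> hx by (intro mult_left_mono) auto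
    finally have 1: "\<bar>\<eta>2 (Y x t) - \<eta>2 (Y x (- t))\<bar> \<le> 6 * M * \<delta>" using hx by simp
    note Db = D_bounds(2,3)[OF x t'(1)] D_bounds(2,3)[OF x t'(2)]
    have 2: "\<bar>D x t ^ 3 - D x (- t) ^ 3\<bar> \<le> 81 / 4 * (\<delta> * k)"
    proof -
      have "\<bar>D x t - D x (- t)\<bar> \<le> 3 * (\<delta> * k)"
        using D_near_1(2)[OF x t'(1)] D_near_1(2)[OF x t'(2)] by linarith
      then have "27 / 4 * \<bar>D x t - D x (- t)\<bar> \<le> 27 / 4 * (3 * (\<delta> * k))" by (intro mult_left_mono) auto
      then show ?thesis using cube_diff(1)[OF Db] by simp
    qed
    have "E t - E (- t) = \<delta> * ((\<eta>2 (Y x t) - \<eta>2 (Y x (- t))) * D x t ^ 3 + \<eta>2 (Y x (- t)) * (D x t ^ 3 - D x (- t) ^ 3))"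
      by (simp add: E_def algebra_simps)
    then have "\<bar>E t - E (- t)\<bar> = \<delta> * \<bar>(\<eta>2 (Y x t) - \<eta>2 (Y x (- t))) * D x t ^ 3 + \<eta>2 (Y x (- t)) * (D x t ^ 3 - D x (- t) ^ 3)\<bar>"
      using \<delta> by (simp add: abs_mult)
    also have "\<dots> \<le> \<delta> * (\<bar>\<eta>2 (Y x t) - \<eta>2 (Y x (- t))\<bar> * D x t ^ 3 + \<bar>\<eta>2 (Y x (- t))\<bar> * \<bar>D x t ^ 3 - D x (- t) ^ 3\<bar>)"
      using \<delta> Db by (intro mult_left_mono order_trans[OF abs_triangle_ineq]) (auto simp: abs_mult)
    also have "\<dots> \<le> \<delta> * (6 * M * \<delta> * (27 / 8) + M * (81 / 4 * (\<delta> * k)))"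
      using \<delta> M k 1 2 cube_diff(2)[OF Db] \<eta>2_bound[OF Yt(2)] Db
      by (intro mult_left_mono add_mono mult_mono) auto
    also have "\<dots> = (81 / 4 * M + 81 / 4 * M * k) * \<delta>\<^sup>2" by (simp add: power2_eq_square algebra_simps)
    also have "\<dots> \<le> C * \<delta>\<^sup>2"
    proof (rule mult_right_mono)
      have "0 \<le> M * k" "0 \<le> k\<^sup>2" using M k by auto
      then show "81 / 4 * M + 81 / 4 * M * k \<le> C" unfolding C_def using M by linarith
    qed simp
    finally show ?thesis .
  qed
  obtain t where t: "0 < t" "t < z" "P z - P 0 = (z - 0) * (t * (E t - E (- t)))"
    using MVT2[of 0 z P "\<lambda>t. t * (E t - E (- t))"] Pd z by auto
  have "\<bar>P z\<bar> = z * (t * \<bar>E t - E (- t)\<bar>)" using t z by (simp add: P_def abs_mult)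
  also have "\<dots> \<le> z * (1 * (C * \<delta>\<^sup>2))" using t z Eb[of t] by (intro mult_left_mono mult_mono) auto
  finally show ?thesis by (simp add: P_def ac_simps)
qed

lemma variable_piece:
  assumes x: "x \<in> \<Omega>"
  shows "kernel_piece x \<delta> k C (3 / 4 * h x) (Y x) (\<lambda>z. h (Y x z)) (D x)"
proof
  have cY: "continuous_on {-1<..<1} (Y x)"
    using Y_isCont[OF x] by (intro continuous_at_imp_continuous_on) auto
  have ch: "continuous_on \<Omega> h"
    unfolding h_def using \<eta>_cont by (intro continuous_intros) (auto intro: continuous_on_subset)
  show "continuous_on {-1<..<1} (\<lambda>z. h (Y x z))"
    by (rule continuous_on_compose2[OF ch cY]) (use Y_props(1)[OF x] in auto)
  have "continuous_on \<Omega> \<eta>1"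
  proof (intro continuous_at_imp_continuous_on ballI)
    fix y assume "y \<in> \<Omega>" then show "isCont \<eta>1 y" by (intro DERIV_isCont[OF \<eta>_deriv(2)])
  qed
  then have "continuous_on {-1<..<1} (\<lambda>z. \<eta>1 (Y x z))"
    by (rule continuous_on_compose2[OF _ cY]) (use Y_props(1)[OF x] in auto)
  moreover have "\<forall>z\<in>{-1<..<1}. 1 - z * (\<delta> * \<eta>1 (Y x z)) \<noteq> 0"
  proof
    fix z :: real assume "z \<in> {-1<..<1}"
    then have "\<bar>z\<bar> \<le> 1" by auto
    from D_bounds(1)[OF x this] show "1 - z * (\<delta> * \<eta>1 (Y x z)) \<noteq> 0" by simp
  qed
  ultimately show "continuous_on {-1<..<1} (D x)"
    unfolding D_def by (intro continuous_intros) auto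
  fix z :: real
  assume z: "\<bar>z\<bar> < 1"
  then have z': "\<bar>z\<bar> \<le> 1" by simp
  show "(Y x has_real_derivative h (Y x z) * D x z) (at z)" by (rule Y_deriv[OF x z])
  show "Y x z \<in> \<Omega>" "Y x z = x + z * h (Y x z)" using Y_props[OF x z'] by auto
  show "3 / 4 * h x \<le> h (Y x z)" using h_Y_bounds(2)[OF x z'] by simp
  show "h (Y x z) \<le> \<delta> * k" by (rule h_le(3)[OF Y_props(1)[OF x z']])
  show "0 < D x z" "D x z \<le> 3 / 2" using D_bounds[OF x z'] by auto
qed (use x \<delta> k C_nonneg h_pos odd1_bound[OF x] odd2_bound[OF x] even_bound[OF x] in auto)

text \<open>With constant \<open>e\<close> and \<open>D = 1\<close> the three symmetry defects are
  exactly 0, so this half fits the same locale with the same constants.\<close>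

lemma constant_piece:
  assumes x: "x \<in> \<Omega>"
  shows "kernel_piece x \<delta> k C (h x) (\<lambda>z. x + z * h x) (\<lambda>z. h x) (\<lambda>z. 1)"
proof
  fix z :: real
  assume z: "\<bar>z\<bar> < 1"
  have "\<bar>z * h x\<bar> \<le> 1 * h x" using z h_pos[OF x] unfolding abs_mult by (intro mult_mono) auto
  then show "x + z * h x \<in> \<Omega>" using h_le[OF x] x by auto
  show "((\<lambda>z. x + z * h x) has_real_derivative h x * 1) (at z)"
    by (auto intro!: derivative_eq_intros)
  show "h x \<le> \<delta> * k" by (rule h_le(3)[OF x])
qed (use x \<delta> k C_nonneg h_pos in auto)

lemma constant_image:
  assumes x: "x \<in> \<Omega>" and "0 < \<epsilon>"
  shows "(\<lambda>z. x + z * h x) ` {z. \<epsilon> < \<bar>z\<bar> \<and> \<bar>z\<bar> < 1} = {y \<in> \<Omega>. \<epsilon> * h x < \<bar>x - y\<bar> \<and> \<bar>x - y\<bar> < h x}"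
proof (intro equalityI subsetI)
  fix y assume "y \<in> (\<lambda>z. x + z * h x) ` {z. \<epsilon> < \<bar>z\<bar> \<and> \<bar>z\<bar> < 1}"
  then obtain z where z: "\<epsilon> < \<bar>z\<bar>" "\<bar>z\<bar> < 1" "y = x + z * h x" by auto
  have "\<bar>x - y\<bar> = \<bar>z\<bar> * h x" using h_pos[OF x] z(3) by (simp add: abs_mult)
  then have "\<epsilon> * h x < \<bar>x - y\<bar>" "\<bar>x - y\<bar> < h x" using z h_pos[OF x] by auto
  moreover from this have "y \<in> \<Omega>" using h_le[OF x] x by auto
  ultimately show "y \<in> {y \<in> \<Omega>. \<epsilon> * h x < \<bar>x - y\<bar> \<and> \<bar>x - y\<bar> < h x}" by auto
next
  fix y assume "y \<in> {y \<in> \<Omega>. \<epsilon> * h x < \<bar>x - y\<bar> \<and> \<bar>x - y\<bar> < h x}"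
  then have y: "\<epsilon> * h x < \<bar>x - y\<bar>" "\<bar>x - y\<bar> < h x" by auto
  define z where "z = (y - x) / h x"
  have p: "0 < h x" using h_pos[OF x] .
  have az: "\<bar>z\<bar> = \<bar>x - y\<bar> / h x" using p by (simp add: z_def abs_minus_commute)
  then have "\<epsilon> < \<bar>z\<bar>" "\<bar>z\<bar> < 1"
    unfolding az using y p by (simp_all add: pos_less_divide_eq pos_divide_less_eq)
  moreover have "y = x + z * h x" using p by (simp add: z_def)
  ultimately show "y \<in> (\<lambda>z. x + z * h x) ` {z. \<epsilon> < \<bar>z\<bar> \<and> \<bar>z\<bar> < 1}" by blast
qed

end

lemma integrable_Omega_extend:
  fixes f :: "real \<Rightarrow> real"
  assumes f: "f absolutely_integrable_on S" and S: "S \<subseteq> \<Omega>"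
  shows "integrable (lebesgue_on \<Omega>) (\<lambda>y. if y \<in> S then f y else 0)"
    and "(\<integral>y. (if y \<in> S then f y else 0) \<partial>lebesgue_on \<Omega>) = integral S f"
proof -
  have eq: "(\<lambda>y. indicator S y *\<^sub>R f y) = (\<lambda>y. if y \<in> \<Omega> then if y \<in> S then f y else 0 else 0)"
    by (rule ext) (use S in \<open>auto simp: indicator_def\<close>)
  have "integrable lebesgue (\<lambda>y. if y \<in> \<Omega> then if y \<in> S then f y else 0 else 0)"
    using f unfolding set_integrable_def eq .
  then show "integrable (lebesgue_on \<Omega>) (\<lambda>y. if y \<in> S then f y else 0)"
    by (subst (asm) Lebesgue_Measure.integrable_restrict_UNIV) auto
  have "(\<integral>y. (if y \<in> S then f y else 0) \<partial>lebesgue_on \<Omega>) = (\<integral>y. indicator S y *\<^sub>R f y \<partial>lebesgue)"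
    unfolding eq by (subst Lebesgue_Measure.integral_restrict_UNIV) auto
  also have "\<dots> = integral S f"
    using set_lebesgue_integral_eq_integral(2)[OF f] by (simp add: set_lebesgue_integral_def)
  finally show "(\<integral>y. (if y \<in> S then f y else 0) \<partial>lebesgue_on \<Omega>) = integral S f" .
qed

subsection \<open>The Taylor remainder\<close>

text \<open>The fourth derivative is only square integrable and has no pointwise bound; its mass on
  a ball controls the oscillation of the third derivative there.\<close>

definition local_mass :: "(real \<Rightarrow> real) \<Rightarrow> real \<Rightarrow> real \<Rightarrow> real" where
  "local_mass g r x = (\<integral>t. of_bool (\<bar>t - x\<bar> \<le> r) * \<bar>g t\<bar> \<partial>lebesgue_on \<Omega>)"

lemma integrable_of_bool_mult:
  fixes f :: "real \<Rightarrow> real"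
  assumes f: "integrable (lebesgue_on \<Omega>) f"
  shows "integrable (lebesgue_on \<Omega>) (\<lambda>t. of_bool (\<bar>t - x\<bar> \<le> r) * f t)"
proof (rule Bochner_Integration.integrable_bound[OF f])
  have [measurable]: "f \<in> borel_measurable (lebesgue_on \<Omega>)" using f by (rule borel_measurable_integrable)
  show "(\<lambda>t. of_bool (\<bar>t - x\<bar> \<le> r) * f t) \<in> borel_measurable (lebesgue_on \<Omega>)"
    using measurable_ident_lebesgue_on[of \<Omega>] by measurable
qed auto

lemma local_mass_ge:
  assumes g: "integrable (lebesgue_on \<Omega>) g" and ab: "a \<in> \<Omega>" "b \<in> \<Omega>" "a \<le> b"
    and near: "x - r \<le> a" "b \<le> x + r"
  shows "\<bar>integral {a..b} g\<bar> \<le> local_mass g r x"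
proof -
  have g': "integrable (lebesgue_on \<Omega>) (\<lambda>t. \<bar>g t\<bar>)" using g by simp
  have int: "g integrable_on {a..b}" "(\<lambda>t. \<bar>g t\<bar>) integrable_on {a..b}"
    using integrable_Omega_subinterval[OF g, of a b] integrable_Omega_subinterval[OF g', of a b] ab by auto
  have "\<bar>integral {a..b} g\<bar> \<le> integral {a..b} (\<lambda>t. \<bar>g t\<bar>)"
    using Henstock_Kurzweil_Integration.integral_norm_bound_integral[OF int] by simp
  also have "\<dots> = (\<integral>t. (if t \<in> {a..b} then \<bar>g t\<bar> else 0) \<partial>lebesgue_on \<Omega>)"
    using ab int by (intro integrable_Omega_extend(2)[symmetric])
      (auto simp: absolutely_integrable_on_def)
  also have "\<dots> \<le> local_mass g r x"
    unfolding local_mass_def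
  proof (rule integral_mono)
    show "integrable (lebesgue_on \<Omega>) (\<lambda>t. if t \<in> {a..b} then \<bar>g t\<bar> else 0)"
      using ab int by (intro integrable_Omega_extend(1)) (auto simp: absolutely_integrable_on_def)
    show "(if t \<in> {a..b} then \<bar>g t\<bar> else 0) \<le> of_bool (\<bar>t - x\<bar> \<le> r) * \<bar>g t\<bar>" for t
      using near by auto
  qed (rule integrable_of_bool_mult[OF g'])
  finally show ?thesis .
qed

lemma local_mass_nonneg: "0 \<le> local_mass g r x"
  unfolding local_mass_def by (rule integral_nonneg_AE) auto

lemma local_mass_le:
  assumes g: "integrable (lebesgue_on \<Omega>) g"
  shows "local_mass g r x \<le> (\<integral>t. \<bar>g t\<bar> \<partial>lebesgue_on \<Omega>)"
  unfolding local_mass_def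
  by (rule integral_mono[OF integrable_of_bool_mult]) (use g in auto)

lemma integral_of_bool_ball_le:
  assumes "0 \<le> r"
  shows "(\<integral>t. of_bool (\<bar>t - x\<bar> \<le> r) \<partial>lebesgue_on \<Omega>) \<le> 2 * r"
proof -
  have "(\<integral>t. of_bool (\<bar>t - x\<bar> \<le> r) \<partial>lebesgue_on \<Omega>) = (\<integral>t. indicat_real ({x-r..x+r} \<inter> \<Omega>) t \<partial>lebesgue_on \<Omega>)"
    by (intro Bochner_Integration.integral_cong refl) (auto simp: indicator_def)
  also have "\<dots> = measure (lebesgue_on \<Omega>) ({x-r..x+r} \<inter> \<Omega>)" by simp
  also have "\<dots> = measure lebesgue ({x-r..x+r} \<inter> \<Omega>)" by (rule measure_restrict_space) auto
  also have "\<dots> \<le> measure lebesgue {x-r..x+r}"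
    by (rule measure_mono_fmeasurable) auto
  also have "\<dots> = 2 * r" using assms by simp
  finally show ?thesis .
qed

text \<open>Cauchy-Schwarz on the ball gives one factor \<open>2 * r\<close>. Integration over x
  with Fubini gives another, because each t lies in the balls around a set of x of measure at most
  \<open>2 * r\<close>.\<close>

lemma local_mass_L2:
  assumes g: "g \<in> L2_space \<Omega>" and r: "0 < r"
  shows "integrable (lebesgue_on \<Omega>) (\<lambda>x. (local_mass g r x)\<^sup>2)"
    and "(\<integral>x. (local_mass g r x)\<^sup>2 \<partial>lebesgue_on \<Omega>) \<le> 4 * r\<^sup>2 * (L2_norm \<Omega> g)\<^sup>2"
proof -
  interpret finite_measure "lebesgue_on \<Omega>" by (rule finite_measure_Omega)
  let ?M = "lebesgue_on \<Omega>"
  have g1: "integrable ?M (\<lambda>t. \<bar>g t\<bar>)" using L2_space_integrable[OF g] by simp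
  have g2: "integrable ?M (\<lambda>t. (g t)\<^sup>2)" using g by (simp add: L2_space_def)
  have one: "(\<lambda>x. 1::real) \<in> borel_measurable ?M" "\<And>x. x \<in> \<Omega> \<Longrightarrow> \<bar>1::real\<bar> \<le> 1" by auto
  have E: "Measurable.pred (?M \<Otimes>\<^sub>M ?M) (\<lambda>(x, t). \<bar>t - x\<bar> \<le> r)"
    unfolding case_prod_beta not_less[symmetric]
    by (intro pred_intros_logic borel_measurable_pred_less borel_measurable_abs borel_measurable_diff
        measurable_fst_snd_lebesgue_on borel_measurable_const)
  define q where "q x = (\<integral>t. of_bool (\<bar>t - x\<bar> \<le> r) * (g t)\<^sup>2 \<partial>?M)" for x
  have qi: "integrable ?M q"
    using lebesgue_on_Omega_Fubini(2)[OF g2 one E] by (simp add: q_def[abs_def])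
  have "(\<integral>x. q x \<partial>?M) = (\<integral>t. (g t)\<^sup>2 * (\<integral>x. of_bool (\<bar>t - x\<bar> \<le> r) \<partial>?M) \<partial>?M)"
    using lebesgue_on_Omega_Fubini(1)[OF g2 one E] by (simp add: q_def[abs_def])
  also have "\<dots> \<le> (\<integral>t. (g t)\<^sup>2 * (2 * r) \<partial>?M)"
  proof (rule integral_mono')
    show "integrable ?M (\<lambda>t. (g t)\<^sup>2 * (2 * r))" using g2 by simp
    show "(g t)\<^sup>2 * (\<integral>x. of_bool (\<bar>t - x\<bar> \<le> r) \<partial>?M) \<le> (g t)\<^sup>2 * (2 * r)" for t
      using integral_of_bool_ball_le[of r t] r by (intro mult_left_mono) (auto simp: abs_minus_commute)
  qed (use r in auto)
  also have "\<dots> = 2 * r * (L2_norm \<Omega> g)\<^sup>2" by (simp add: L2_norm_def integral_nonneg_AE)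
  finally have qb: "(\<integral>x. q x \<partial>?M) \<le> 2 * r * (L2_norm \<Omega> g)\<^sup>2" .
  have CS: "(local_mass g r x)\<^sup>2 \<le> 2 * r * q x" for x
  proof -
    \<comment> \<open>If the ball lies inside \<Omega>, this is the mean of
      \<open>\<bar>g\<bar>\<close> on it. Expanding the nonnegative integral of
      \<open>(\<bar>g t\<bar> - s)\<^sup>2\<close> with this value gives Cauchy-Schwarz, also when
      the ball sticks out of \<Omega>.\<close>
    define s where "s = local_mass g r x / (2 * r)"
    have i1: "integrable ?M (\<lambda>t. of_bool (\<bar>t - x\<bar> \<le> r) * (g t)\<^sup>2)" by (rule integrable_of_bool_mult[OF g2])
    have i2: "integrable ?M (\<lambda>t. of_bool (\<bar>t - x\<bar> \<le> r) * \<bar>g t\<bar>)" by (rule integrable_of_bool_mult[OF g1])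
    have i3: "integrable ?M (\<lambda>t. of_bool (\<bar>t - x\<bar> \<le> r) * (1::real))" by (rule integrable_of_bool_mult) simp
    have "0 \<le> (\<integral>t. of_bool (\<bar>t - x\<bar> \<le> r) * (\<bar>g t\<bar> - s)\<^sup>2 \<partial>?M)" by (rule integral_nonneg_AE) auto
    also have "\<dots> = (\<integral>t. (of_bool (\<bar>t - x\<bar> \<le> r) * (g t)\<^sup>2 - 2 * s * (of_bool (\<bar>t - x\<bar> \<le> r) * \<bar>g t\<bar>))
         + s\<^sup>2 * (of_bool (\<bar>t - x\<bar> \<le> r) * 1) \<partial>?M)"
      by (intro Bochner_Integration.integral_cong refl) (simp add: power2_diff algebra_simps)
    also have "\<dots> = (q x - 2 * s * local_mass g r x) + s\<^sup>2 * (\<integral>t. of_bool (\<bar>t - x\<bar> \<le> r) * 1 \<partial>?M)"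
      using i1 i2 i3 by (simp add: q_def local_mass_def del: mult_1_right)
    also have "\<dots> \<le> (q x - 2 * s * local_mass g r x) + s\<^sup>2 * (2 * r)"
      using integral_of_bool_ball_le[of r x] r by (intro add_left_mono mult_left_mono) auto
    also have "\<dots> = q x - (local_mass g r x)\<^sup>2 / (2 * r)"
      using r by (simp add: s_def field_simps power2_eq_square)
    finally show ?thesis using r by (simp add: field_simps)
  qed
  have Am: "local_mass g r \<in> borel_measurable ?M"
    using borel_measurable_integrable[OF lebesgue_on_Omega_Fubini(2)[OF g1 one E]]
    by (simp add: local_mass_def[abs_def])
  show *: "integrable ?M (\<lambda>x. (local_mass g r x)\<^sup>2)"
  proof (rule Bochner_Integration.integrable_bound)
    show "integrable ?M (\<lambda>x. 2 * r * q x)" using qi by simp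
    show "(\<lambda>x. (local_mass g r x)\<^sup>2) \<in> borel_measurable ?M" using Am by (rule borel_measurable_power)
    have "norm ((local_mass g r x)\<^sup>2) \<le> norm (2 * r * q x)" for x
      using CS[of x] by (simp del: abs_mult)
    then show "AE x in ?M. norm ((local_mass g r x)\<^sup>2) \<le> norm (2 * r * q x)" by simp
  qed
  have "(\<integral>x. (local_mass g r x)\<^sup>2 \<partial>?M) \<le> (\<integral>x. 2 * r * q x \<partial>?M)"
    using * qi CS by (intro integral_mono) auto
  also have "\<dots> = 2 * r * (\<integral>x. q x \<partial>?M)" by simp
  also have "\<dots> \<le> 2 * r * (2 * r * (L2_norm \<Omega> g)\<^sup>2)" using qb r by (intro mult_left_mono) auto
  finally show "(\<integral>x. (local_mass g r x)\<^sup>2 \<partial>?M) \<le> 4 * r\<^sup>2 * (L2_norm \<Omega> g)\<^sup>2"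
    by (simp add: power2_eq_square algebra_simps)
qed

context H4_representative
begin

text \<open>The Lagrange form stops at the third derivative, the last classical one, taken at an
  intermediate point t. Replacing \<open>U3 t\<close> by \<open>U3 x\<close> costs an integral of
  \<open>g\<close> between the two points.\<close>

lemma taylor:
  assumes x: "x \<in> \<Omega>" and y: "y \<in> \<Omega>" and r: "\<bar>y - x\<bar> \<le> r"
  shows "\<bar>U0 y - U0 x - U1 x * (y - x) - U2 x / 2 * (y - x)\<^sup>2 - U3 x / 6 * (y - x) ^ 3\<bar>
    \<le> local_mass g r x / 6 * \<bar>y - x\<bar> ^ 3"
proof (cases "y = x")
  case False
  define df where "df m = (if m = 0 then U0 else if m = 1 then U1 else if m = 2 then U2 else U3)" for m :: nat
  have "\<exists>t. (if y < x then y < t \<and> t < x else x < t \<and> t < y) \<and>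
      U0 y = (\<Sum>m<3. df m x / fact m * (y - x) ^ m) + df 3 t / fact 3 * (y - x) ^ 3"
  proof (rule Taylor[of 3 df U0 "min x y" "max x y"])
    show "\<forall>m t. m < 3 \<and> min x y \<le> t \<and> t \<le> max x y \<longrightarrow> (df m has_real_derivative df (Suc m) t) (at t)"
    proof (intro allI impI)
      fix m :: nat and t assume m: "m < 3 \<and> min x y \<le> t \<and> t \<le> max x y"
      then have t: "t \<in> \<Omega>" using x y by auto
      from m have "m = 0 \<or> m = 1 \<or> m = 2" by linarith
      then show "(df m has_real_derivative df (Suc m) t) (at t)"
        using U_deriv[OF t] by (auto simp: df_def)
    qed
  qed (use False in \<open>auto simp: df_def\<close>)
  then obtain t where t: "if y < x then y < t \<and> t < x else x < t \<and> t < y"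
    and eq: "U0 y = (\<Sum>m<3. df m x / fact m * (y - x) ^ m) + df 3 t / fact 3 * (y - x) ^ 3" by blast
  have g: "integrable (lebesgue_on \<Omega>) g" by (rule L2_space_integrable[OF g_L2])
  have "\<bar>U3 t - U3 x\<bar> \<le> local_mass g r x"
  proof (cases "y < x")
    case True
    then have "U3 x - U3 t = integral {t..x} g" using t x y by (intro U3_diff) auto
    moreover have "\<bar>integral {t..x} g\<bar> \<le> local_mass g r x"
      using True t x y r by (intro local_mass_ge[OF g]) auto
    ultimately show ?thesis by linarith
  next
    case False
    then have "U3 t - U3 x = integral {x..t} g" using t x y by (intro U3_diff) auto
    moreover have "\<bar>integral {x..t} g\<bar> \<le> local_mass g r x"
      using False t x y r by (intro local_mass_ge[OF g]) auto
    ultimately show ?thesis by linarith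
  qed
  then have "\<bar>U3 t - U3 x\<bar> / 6 * \<bar>y - x\<bar> ^ 3 \<le> local_mass g r x / 6 * \<bar>y - x\<bar> ^ 3"
    by (intro mult_right_mono) auto
  moreover have "U0 y - U0 x - U1 x * (y - x) - U2 x / 2 * (y - x)\<^sup>2 - U3 x / 6 * (y - x) ^ 3 = (U3 t - U3 x) / 6 * (y - x) ^ 3"
  proof -
    define s where "s = y - x"
    show ?thesis
      unfolding eq s_def[symmetric]
      by (simp add: df_def numeral_3_eq_3 fact_numeral algebra_simps diff_divide_distrib power2_eq_square)
  qed
  ultimately show ?thesis by (simp only: abs_mult abs_divide power_abs abs_numeral)
next
  case True
  then show ?thesis by (simp add: local_mass_nonneg)
qed

end

subsection \<open>The nonlocal operator\<close>

locale nonlocal_operator = scaled_horizon +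
  fixes \<beta> :: real and q lam :: "real \<Rightarrow> real"
  assumes \<beta>: "0 < \<beta>" "\<beta> < 3" and eta: "\<eta> = eta q lam"
begin

lemma eta_delta_eq: "eta_delta q lam \<delta> = h"
  by (rule ext) (simp add: eta_delta_def h_def eta[symmetric])

lemma w_delta_eq: "w_delta \<beta> q lam \<delta> y = (3 - \<beta>) / 2 * h y powr (- (3 - \<beta>))"
  by (simp add: w_delta_def eta_delta_eq)

text \<open>The part with \<open>C\<close> is of order \<delta>^2 pointwise; the other part shows
  one \<delta> only, and the second appears when the local mass is measured in the mean
  square.\<close>

definition remainder_bound :: "(real \<Rightarrow> real) \<Rightarrow> (real \<Rightarrow> real) \<Rightarrow> (real \<Rightarrow> real) \<Rightarrow> (real \<Rightarrow> real) \<Rightarrow> real \<Rightarrow> real" where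
  "remainder_bound U1 U2 U3 g x =
     \<delta> * (C * \<delta> * (\<bar>U1 x\<bar> + \<bar>U2 x\<bar> + \<bar>U3 x\<bar>) + k * local_mass g (\<delta> * k) x)"

text \<open>Each half carries the constant \<open>(3 - \<beta>) / 2\<close>; together they give
  \<open>3 - \<beta>\<close>, which is \<open>s + 1\<close> for \<open>s = 2 - \<beta>\<close>, so
  the leading term integrates to exactly \<open>- U2 x\<close>. The bound uniform in \<epsilon> is
  recorded for dominated convergence.\<close>

lemma L_eps_pointwise:
  assumes "H4_representative u U0 U1 U2 U3 g" and x: "x \<in> \<Omega>"
  defines "b \<equiv> remainder_bound U1 U2 U3 g x"
  shows "\<exists>F. \<bar>F + U2 x\<bar> \<le> b \<and> ((\<lambda>\<epsilon>. L_eps \<beta> q lam \<delta> \<epsilon> U0 x) \<longlongrightarrow> F) (at_right 0) \<and>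
    (\<forall>\<epsilon>. 0 < \<epsilon> \<longrightarrow> \<epsilon> < 1 \<longrightarrow> \<bar>L_eps \<beta> q lam \<delta> \<epsilon> U0 x\<bar> \<le> \<bar>U2 x\<bar> + b)"
proof -
  interpret H: H4_representative u U0 U1 U2 U3 g by fact
  interpret P1: kernel_piece x \<delta> k C "h x" "\<lambda>z. x + z * h x" "\<lambda>z. h x" "\<lambda>z. 1"
    by (rule constant_piece[OF x])
  interpret P2: kernel_piece x \<delta> k C "3 / 4 * h x" "Y x" "\<lambda>z. h (Y x z)" "D x"
    by (rule variable_piece[OF x])
  define c where "c = (3 - \<beta>) / 2"
  define N1 where "N1 z = c * (P1.kern \<beta> U0 z + P1.kern \<beta> U0 (- z))" for z
  define N2 where "N2 z = c * (P2.kern \<beta> U0 z + P2.kern \<beta> U0 (- z))" for z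
  have c: "0 < c" using \<beta> by (simp add: c_def)
  have cont1: "continuous_on {0<..<1} N1" and cont2: "continuous_on {0<..<1} N2"
  proof -
    have "continuous_on {0<..<1} (\<lambda>z. P1.kern \<beta> U0 (- z))"
      by (rule continuous_on_compose2[OF P1.kern_cont[OF H.U_cont(1)]]) (auto intro: continuous_intros)
    then show "continuous_on {0<..<1} N1"
      unfolding N1_def
      by (intro continuous_intros continuous_on_subset[OF P1.kern_cont[OF H.U_cont(1)]]) auto
    have "continuous_on {0<..<1} (\<lambda>z. P2.kern \<beta> U0 (- z))"
      by (rule continuous_on_compose2[OF P2.kern_cont[OF H.U_cont(1)]]) (auto intro: continuous_intros)
    then show "continuous_on {0<..<1} N2"
      unfolding N2_def
      by (intro continuous_intros continuous_on_subset[OF P2.kern_cont[OF H.U_cont(1)]]) auto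
  qed
  let ?A = "local_mass g (\<delta> * k) x"
  have b_eq: "b = \<delta> * (C * \<delta> * (\<bar>U1 x\<bar> + \<bar>U2 x\<bar> + \<bar>U3 x\<bar>) + k * ?A)"
    by (simp add: b_def remainder_bound_def)
  have near: "\<bar>z * h y\<bar> \<le> \<delta> * k" if "\<bar>z\<bar> < 1" "y \<in> \<Omega>" for z y
  proof -
    have "\<bar>z * h y\<bar> \<le> 1 * h y" using that h_pos[OF that(2)] unfolding abs_mult by (intro mult_mono) auto
    then show ?thesis using h_le(3)[OF that(2)] by simp
  qed
  have exp1: "\<bar>P1.kern \<beta> U0 z + P1.kern \<beta> U0 (- z) + U2 x * z powr (2 - \<beta>)\<bar> \<le> b * z powr (2 - \<beta>)"
    if "0 < z" "z < 1" for z
    unfolding b_eq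
  proof (rule P1.kern_expansion[OF _ that])
    fix z :: real assume z: "\<bar>z\<bar> < 1"
    show "\<bar>U0 (x + z * h x) - U0 x - U1 x * (z * h x) - U2 x / 2 * (z * h x)\<^sup>2 - U3 x / 6 * (z * h x) ^ 3\<bar>
      \<le> ?A / 6 * \<bar>z * h x\<bar> ^ 3"
      using H.taylor[OF x P1.Y_mem[OF z], of "\<delta> * k"] near[OF z x] by simp
  qed
  have exp2: "\<bar>P2.kern \<beta> U0 z + P2.kern \<beta> U0 (- z) + U2 x * z powr (2 - \<beta>)\<bar> \<le> b * z powr (2 - \<beta>)"
    if "0 < z" "z < 1" for z
    unfolding b_eq
  proof (rule P2.kern_expansion[OF _ that])
    fix z :: real assume z: "\<bar>z\<bar> < 1"
    have eq: "Y x z - x = z * h (Y x z)" using P2.Y_eq[OF z] by linarith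
    show "\<bar>U0 (Y x z) - U0 x - U1 x * (z * h (Y x z)) - U2 x / 2 * (z * h (Y x z))\<^sup>2 - U3 x / 6 * (z * h (Y x z)) ^ 3\<bar>
      \<le> ?A / 6 * \<bar>z * h (Y x z)\<bar> ^ 3"
      using H.taylor[OF x P2.Y_mem[OF z], of "\<delta> * k"] near[OF z P2.Y_mem[OF z]] unfolding eq by simp
  qed
  define N where "N z = N1 z + N2 z" for z
  have s: "2 - \<beta> > -1" using \<beta> by simp
  have cont: "continuous_on {0<..<1} N" unfolding N_def using cont1 cont2 by (rule continuous_on_add)
  have bound: "\<bar>N z + (2 - \<beta> + 1) * U2 x * z powr (2 - \<beta>)\<bar> \<le> (2 - \<beta> + 1) * b * z powr (2 - \<beta>)"
    if "z \<in> {0<..<1}" for z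
  proof -
    have z: "0 < z" "z < 1" using that by auto
    have tri: "\<bar>c * X + c * Y\<bar> \<le> c * \<bar>X\<bar> + c * \<bar>Y\<bar>" for X Y
      using c abs_triangle_ineq[of "c * X" "c * Y"] by (simp add: abs_mult)
    have cc: "2 - \<beta> + 1 = c + c" by (simp add: c_def)
    define p where "p = z powr (2 - \<beta>)"
    have N_eq: "N z + (2 - \<beta> + 1) * U2 x * z powr (2 - \<beta>) =
       c * (P1.kern \<beta> U0 z + P1.kern \<beta> U0 (- z) + U2 x * z powr (2 - \<beta>)) +
       c * (P2.kern \<beta> U0 z + P2.kern \<beta> U0 (- z) + U2 x * z powr (2 - \<beta>))"
      unfolding N_def N1_def N2_def cc p_def[symmetric] by (simp only: distrib_left distrib_right ac_simps)
    have "\<bar>N z + (2 - \<beta> + 1) * U2 x * z powr (2 - \<beta>)\<bar> \<le> c * \<bar>P1.kern \<beta> U0 z + P1.kern \<beta> U0 (- z) + U2 x * z powr (2 - \<beta>)\<bar> +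
       c * \<bar>P2.kern \<beta> U0 z + P2.kern \<beta> U0 (- z) + U2 x * z powr (2 - \<beta>)\<bar>"
      unfolding N_eq by (rule tri)
    also have "\<dots> \<le> c * (b * z powr (2 - \<beta>)) + c * (b * z powr (2 - \<beta>))"
      by (intro add_mono mult_left_mono exp1[OF z] exp2[OF z] less_imp_le[OF c])
    also have "\<dots> = (2 - \<beta> + 1) * b * z powr (2 - \<beta>)"
      unfolding cc p_def[symmetric] by (simp only: distrib_left distrib_right ac_simps)
    finally show ?thesis .
  qed
  note asym = powr_integral_asymptotics[OF s cont bound]
  have split: "integral {\<epsilon><..<1} N = integral {\<epsilon><..<1} N1 + integral {\<epsilon><..<1} N2" if "0 < \<epsilon>" "\<epsilon> < 1" for \<epsilon>
  proof -
    have bound1: "\<bar>N1 z\<bar> \<le> c * (\<bar>U2 x\<bar> + b) * z powr (2 - \<beta>)" and bound2: "\<bar>N2 z\<bar> \<le> c * (\<bar>U2 x\<bar> + b) * z powr (2 - \<beta>)"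
      if "z \<in> {0<..<1}" for z
    proof -
      have z: "0 < z" "z < 1" using that by auto
      have *: "c * \<bar>K\<bar> \<le> c * (\<bar>U2 x\<bar> + b) * z powr (2 - \<beta>)"
        if "\<bar>K + U2 x * z powr (2 - \<beta>)\<bar> \<le> b * z powr (2 - \<beta>)" for K
      proof -
        have "\<bar>U2 x * z powr (2 - \<beta>)\<bar> = \<bar>U2 x\<bar> * z powr (2 - \<beta>)" by (simp add: abs_mult)
        then have "\<bar>K\<bar> \<le> \<bar>U2 x\<bar> * z powr (2 - \<beta>) + b * z powr (2 - \<beta>)" using that by linarith
        then have "c * \<bar>K\<bar> \<le> c * (\<bar>U2 x\<bar> * z powr (2 - \<beta>) + b * z powr (2 - \<beta>))"
          using c by (intro mult_left_mono) auto
        then show ?thesis by (simp add: algebra_simps)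
      qed
      show "\<bar>N1 z\<bar> \<le> c * (\<bar>U2 x\<bar> + b) * z powr (2 - \<beta>)" "\<bar>N2 z\<bar> \<le> c * (\<bar>U2 x\<bar> + b) * z powr (2 - \<beta>)"
        using *[OF exp1[OF z]] *[OF exp2[OF z]] c by (auto simp: N1_def N2_def abs_mult)
    qed
    have "N1 integrable_on {\<epsilon><..<1}" "N2 integrable_on {\<epsilon><..<1}"
      using powr_integral_bound(1)[OF s cont1 bound1, of \<epsilon>] powr_integral_bound(1)[OF s cont2 bound2, of \<epsilon>] that
      by (auto simp: absolutely_integrable_on_def)
    then show ?thesis unfolding N_def by (rule integral_add)
  qed
  \<comment> \<open>For \<epsilon> below \<open>\<eta> x\<close> the cutoff indicator is 1, and both
    truncated regions are images of the same set of z.\<close>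
  have L: "L_eps \<beta> q lam \<delta> \<epsilon> U0 x = integral {\<epsilon><..<1} N" if e: "0 < \<epsilon>" "\<epsilon> < 1" "\<epsilon> < \<eta> x" for \<epsilon>
  proof -
    define S1 where "S1 = {y \<in> \<Omega>. \<epsilon> * h x < \<bar>x - y\<bar> \<and> \<bar>x - y\<bar> < h x}"
    define S2 where "S2 = {y \<in> \<Omega>. \<epsilon> * h y < \<bar>x - y\<bar> \<and> \<bar>x - y\<bar> < h y}"
    let ?Q = "\<lambda>y. (U0 x - U0 y) / \<bar>x - y\<bar> powr \<beta>"
    let ?f1 = "\<lambda>y. w_delta \<beta> q lam \<delta> x * ?Q y"
    let ?f2 = "\<lambda>y. w_delta \<beta> q lam \<delta> y * ?Q y"
    have W1: "w_delta \<beta> q lam \<delta> x = c * h x powr (- (3 - \<beta>))"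
      and W2: "w_delta \<beta> q lam \<delta> (Y x z) = c * h (Y x z) powr (- (3 - \<beta>))" for z
      by (simp_all add: w_delta_eq c_def)
    have 1: "?f1 absolutely_integrable_on S1" "integral S1 ?f1 = integral {\<epsilon><..<1} N1"
      using P1.kern_integral[OF H.U_cont(1) e(1,2), of "\<lambda>y. w_delta \<beta> q lam \<delta> x" c \<beta>] W1
      unfolding constant_image[OF x e(1)] S1_def N1_def by auto
    have 2: "?f2 absolutely_integrable_on S2" "integral S2 ?f2 = integral {\<epsilon><..<1} N2"
      using P2.kern_integral[OF H.U_cont(1) e(1,2), of "w_delta \<beta> q lam \<delta>" c \<beta>] W2
      unfolding Y_image[OF x e(1)] S2_def N2_def by auto
    have "L_eps \<beta> q lam \<delta> \<epsilon> U0 x = (\<integral>y. (if y \<in> S1 then ?f1 y else 0) + (if y \<in> S2 then ?f2 y else 0) \<partial>lebesgue_on \<Omega>)"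
      unfolding L_eps_def eta_delta_eq eta[symmetric] using e(3)
      by (simp, intro Bochner_Integration.integral_cong refl) (auto simp: S1_def S2_def indicator_def distrib_right add_divide_distrib)
    also have "\<dots> = integral S1 ?f1 + integral S2 ?f2"
    proof -
      have S: "S1 \<subseteq> \<Omega>" "S2 \<subseteq> \<Omega>" by (auto simp: S1_def S2_def)
      show ?thesis
        unfolding integrable_Omega_extend(2)[OF 1(1) S(1), symmetric] integrable_Omega_extend(2)[OF 2(1) S(2), symmetric]
        by (rule Bochner_Integration.integral_add[OF integrable_Omega_extend(1)[OF 1(1) S(1)] integrable_Omega_extend(1)[OF 2(1) S(2)]])
    qed
    also have "\<dots> = integral {\<epsilon><..<1} N" using 1(2) 2(2) split[OF e(1,2)] by simp
    finally show ?thesis .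
  qed
  have "\<forall>\<^sub>F \<epsilon> in at_right 0. L_eps \<beta> q lam \<delta> \<epsilon> U0 x = integral {\<epsilon><..<1} N"
    unfolding eventually_at_right_field using \<eta>_pos[OF x] L by (intro exI[of _ "min 1 (\<eta> x)"]) auto
  then have "((\<lambda>\<epsilon>. L_eps \<beta> q lam \<delta> \<epsilon> U0 x) \<longlongrightarrow> integral {0<..<1} N) (at_right 0)"
    using asym(3) by (simp add: tendsto_cong)
  moreover have "\<bar>L_eps \<beta> q lam \<delta> \<epsilon> U0 x\<bar> \<le> \<bar>U2 x\<bar> + b" if "0 < \<epsilon>" "\<epsilon> < 1" for \<epsilon>
  proof (cases "\<epsilon> < \<eta> x")
    case True
    then show ?thesis using L[OF that True] asym(2)[of \<epsilon>] that by simp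
  next
    case False
    have "0 \<le> \<bar>U2 x\<bar> + b" using asym(2)[of 0] by linarith
    then show ?thesis using False by (simp add: L_eps_def eta[symmetric])
  qed
  ultimately show ?thesis using asym(1) by blast
qed

end

subsection \<open>Limits in the mean\<close>

lemma L2_space_of_AE_bounded:
  assumes f: "f \<in> borel_measurable (lebesgue_on \<Omega>)" and K: "AE x in lebesgue_on \<Omega>. \<bar>f x\<bar> \<le> K"
  shows "f \<in> L2_space \<Omega>"
proof -
  interpret finite_measure "lebesgue_on \<Omega>" by (rule finite_measure_Omega)
  have "integrable (lebesgue_on \<Omega>) (\<lambda>x. (f x)\<^sup>2)"
  proof (rule Bochner_Integration.integrable_bound)
    show "integrable (lebesgue_on \<Omega>) (\<lambda>x. K\<^sup>2)" by simp
    show "(\<lambda>x. (f x)\<^sup>2) \<in> borel_measurable (lebesgue_on \<Omega>)" using f by (rule borel_measurable_power)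
    show "AE x in lebesgue_on \<Omega>. norm ((f x)\<^sup>2) \<le> norm (K\<^sup>2)"
      using K
    proof eventually_elim
      case (elim x)
      have "\<bar>f x\<bar>\<^sup>2 \<le> K\<^sup>2" using elim by (intro power_mono) auto
      then show ?case by simp
    qed
  qed
  then show ?thesis using f by (simp add: L2_space_def)
qed

lemma square_diff_le: "(a - b)\<^sup>2 \<le> 2 * a\<^sup>2 + 2 * (b :: real)\<^sup>2"
  using zero_le_power2[of "a + b"] by (simp add: power2_sum power2_diff)

lemma L2_space_diff:
  assumes "f \<in> L2_space S" "g \<in> L2_space S"
  shows "(\<lambda>x. f x - g x) \<in> L2_space S"
proof -
  have m: "f \<in> borel_measurable (lebesgue_on S)" "g \<in> borel_measurable (lebesgue_on S)"
    and i: "integrable (lebesgue_on S) (\<lambda>x. (f x)\<^sup>2)" "integrable (lebesgue_on S) (\<lambda>x. (g x)\<^sup>2)"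
    using assms by (auto simp: L2_space_def)
  have "integrable (lebesgue_on S) (\<lambda>x. 2 * (f x)\<^sup>2 + 2 * (g x)\<^sup>2)" using i by simp
  then have "integrable (lebesgue_on S) (\<lambda>x. (f x - g x)\<^sup>2)"
  proof (rule Bochner_Integration.integrable_bound)
    show "(\<lambda>x. (f x - g x)\<^sup>2) \<in> borel_measurable (lebesgue_on S)"
      using m by (intro borel_measurable_power borel_measurable_diff)
    show "AE x in lebesgue_on S. norm ((f x - g x)\<^sup>2) \<le> norm (2 * (f x)\<^sup>2 + 2 * (g x)\<^sup>2)"
      using square_diff_le by (intro AE_I2) (simp add: order_trans[OF _ abs_ge_self])
  qed
  then show ?thesis using m by (simp add: L2_space_def)
qed

lemma L2_norm_power2: "(L2_norm S f)\<^sup>2 = (\<integral>x. (f x)\<^sup>2 \<partial>lebesgue_on S)"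
  by (simp add: L2_norm_def integral_nonneg_AE)

text \<open>Both candidates are close to the same \<open>F \<epsilon>\<close>, and
  \<open>square_diff_le\<close> acts as triangle inequality. This lets the limit chosen in
  \<open>L_delta\<close> be exchanged for an explicit one.\<close>

lemma L2_limit_unique:
  assumes f: "is_L2_limit S F f" and g: "is_L2_limit S F g"
  shows "AE x in lebesgue_on S. f x = g x"
proof -
  let ?M = "lebesgue_on S"
  have fg: "f \<in> L2_space S" "g \<in> L2_space S" and F: "\<forall>\<^sub>F \<epsilon> in at_right 0. F \<epsilon> \<in> L2_space S"
    using f g by (auto simp: is_L2_limit_def)
  have int: "integrable ?M (\<lambda>x. (f x - g x)\<^sup>2)"
    using L2_space_diff[OF fg] by (simp add: L2_space_def)
  have "\<forall>\<^sub>F \<epsilon> in at_right 0. (\<integral>x. (f x - g x)\<^sup>2 \<partial>?M) \<le>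
      2 * (L2_norm S (\<lambda>x. F \<epsilon> x - g x))\<^sup>2 + 2 * (L2_norm S (\<lambda>x. F \<epsilon> x - f x))\<^sup>2"
    using F
  proof eventually_elim
    case (elim \<epsilon>)
    have i: "integrable ?M (\<lambda>x. (F \<epsilon> x - f x)\<^sup>2)" "integrable ?M (\<lambda>x. (F \<epsilon> x - g x)\<^sup>2)"
      using L2_space_diff[OF elim fg(1)] L2_space_diff[OF elim fg(2)] by (auto simp: L2_space_def)
    have "(\<integral>x. (f x - g x)\<^sup>2 \<partial>?M) \<le> (\<integral>x. 2 * (F \<epsilon> x - g x)\<^sup>2 + 2 * (F \<epsilon> x - f x)\<^sup>2 \<partial>?M)"
    proof (rule integral_mono[OF int])
      show "integrable ?M (\<lambda>x. 2 * (F \<epsilon> x - g x)\<^sup>2 + 2 * (F \<epsilon> x - f x)\<^sup>2)" using i by simp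
      show "(f x - g x)\<^sup>2 \<le> 2 * (F \<epsilon> x - g x)\<^sup>2 + 2 * (F \<epsilon> x - f x)\<^sup>2" for x
        using square_diff_le[of "F \<epsilon> x - g x" "F \<epsilon> x - f x"] by simp
    qed
    also have "\<dots> = 2 * (L2_norm S (\<lambda>x. F \<epsilon> x - g x))\<^sup>2 + 2 * (L2_norm S (\<lambda>x. F \<epsilon> x - f x))\<^sup>2"
      unfolding L2_norm_power2 using i by simp
    finally show ?case .
  qed
  moreover have "((\<lambda>\<epsilon>. 2 * (L2_norm S (\<lambda>x. F \<epsilon> x - g x))\<^sup>2 + 2 * (L2_norm S (\<lambda>x. F \<epsilon> x - f x))\<^sup>2)
      \<longlongrightarrow> 2 * 0\<^sup>2 + 2 * 0\<^sup>2) (at_right 0)"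
    using f g unfolding is_L2_limit_def by (intro tendsto_intros) auto
  ultimately have "(\<integral>x. (f x - g x)\<^sup>2 \<partial>?M) \<le> 2 * 0\<^sup>2 + 2 * 0\<^sup>2"
    by (intro tendsto_lowerbound[where F="at_right (0::real)"]) (auto simp: trivial_limit_at_right_real)
  moreover have "0 \<le> (\<integral>x. (f x - g x)\<^sup>2 \<partial>?M)" by (rule integral_nonneg_AE) simp
  ultimately have "(\<integral>x. (f x - g x)\<^sup>2 \<partial>?M) = 0" by simp
  then have "AE x in ?M. (f x - g x)\<^sup>2 = 0"
    using integral_nonneg_eq_0_iff_AE[OF int] by simp
  then show ?thesis by eventually_elim simp
qed

lemma L_eps_integrand_measurable:
  assumes e: "eta q lam \<in> borel_measurable (lebesgue_on \<Omega>)" and u: "u \<in> borel_measurable (lebesgue_on \<Omega>)"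
  shows "(\<lambda>(x, y). (w_delta \<beta> q lam \<delta> x *
          indicator {y. \<epsilon> * eta_delta q lam \<delta> x < \<bar>x - y\<bar> \<and> \<bar>x - y\<bar> < eta_delta q lam \<delta> x} y +
        w_delta \<beta> q lam \<delta> y *
          indicator {y. \<epsilon> * eta_delta q lam \<delta> y < \<bar>x - y\<bar> \<and> \<bar>x - y\<bar> < eta_delta q lam \<delta> y} y) *
       ((u x - u y) / \<bar>x - y\<bar> powr \<beta>)) \<in> borel_measurable (lebesgue_on \<Omega> \<Otimes>\<^sub>M lebesgue_on \<Omega>)"
proof -
  note [measurable] = measurable_fst_snd_lebesgue_on(1)[of \<Omega> "lebesgue_on \<Omega>"]
    measurable_fst_snd_lebesgue_on(2)[of "lebesgue_on \<Omega>" \<Omega>]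
    measurable_compose[OF measurable_fst e, of "lebesgue_on \<Omega>"]
    measurable_compose[OF measurable_snd e, of "lebesgue_on \<Omega>"]
    measurable_compose[OF measurable_fst u, of "lebesgue_on \<Omega>"]
    measurable_compose[OF measurable_snd u, of "lebesgue_on \<Omega>"]
  show ?thesis
    unfolding w_delta_def eta_delta_def indicator_def mem_Collect_eq case_prod_beta
    by measurable
qed

lemma L_eps_measurable:
  assumes e: "eta q lam \<in> borel_measurable (lebesgue_on \<Omega>)" and u: "u \<in> borel_measurable (lebesgue_on \<Omega>)"
  shows "L_eps \<beta> q lam \<delta> \<epsilon> u \<in> borel_measurable (lebesgue_on \<Omega>)"
proof -
  interpret finite_measure "lebesgue_on \<Omega>" by (rule finite_measure_Omega)
  note [measurable] = e
  have "(\<lambda>x. \<integral>y. (w_delta \<beta> q lam \<delta> x *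
          indicator {y. \<epsilon> * eta_delta q lam \<delta> x < \<bar>x - y\<bar> \<and> \<bar>x - y\<bar> < eta_delta q lam \<delta> x} y +
        w_delta \<beta> q lam \<delta> y *
          indicator {y. \<epsilon> * eta_delta q lam \<delta> y < \<bar>x - y\<bar> \<and> \<bar>x - y\<bar> < eta_delta q lam \<delta> y} y) *
       ((u x - u y) / \<bar>x - y\<bar> powr \<beta>) \<partial>lebesgue_on \<Omega>) \<in> borel_measurable (lebesgue_on \<Omega>)"
    by (rule borel_measurable_lebesgue_integral[OF L_eps_integrand_measurable[OF e u]])
  have "(\<lambda>x. indicator {x. eta q lam x > \<epsilon>} x :: real) \<in> borel_measurable (lebesgue_on \<Omega>)"
    unfolding indicator_def mem_Collect_eq by measurable
  then show ?thesis
    unfolding L_eps_def[abs_def] by (rule borel_measurable_times) fact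
qed

text \<open>The function enters under the integral and through its value at x. Agreement almost
  everywhere settles the former; the latter has to be asked for separately.\<close>

lemma L_eps_cong_AE:
  assumes e: "eta q lam \<in> borel_measurable (lebesgue_on \<Omega>)"
    and u: "u \<in> borel_measurable (lebesgue_on \<Omega>)" and v: "v \<in> borel_measurable (lebesgue_on \<Omega>)"
    and AE: "AE y in lebesgue_on \<Omega>. u y = v y" and x: "x \<in> \<Omega>" "u x = v x"
  shows "L_eps \<beta> q lam \<delta> \<epsilon> u x = L_eps \<beta> q lam \<delta> \<epsilon> v x"
proof -
  have xs: "x \<in> space (lebesgue_on \<Omega>)" using x by simp
  show ?thesis
    unfolding L_eps_def
  proof (intro arg_cong2[where f="(*)"] refl integral_cong_AE)
    show "AE y in lebesgue_on \<Omega>. (w_delta \<beta> q lam \<delta> x *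
          indicator {y. \<epsilon> * eta_delta q lam \<delta> x < \<bar>x - y\<bar> \<and> \<bar>x - y\<bar> < eta_delta q lam \<delta> x} y +
        w_delta \<beta> q lam \<delta> y *
          indicator {y. \<epsilon> * eta_delta q lam \<delta> y < \<bar>x - y\<bar> \<and> \<bar>x - y\<bar> < eta_delta q lam \<delta> y} y) *
       ((u x - u y) / \<bar>x - y\<bar> powr \<beta>) = (w_delta \<beta> q lam \<delta> x *
          indicator {y. \<epsilon> * eta_delta q lam \<delta> x < \<bar>x - y\<bar> \<and> \<bar>x - y\<bar> < eta_delta q lam \<delta> x} y +
        w_delta \<beta> q lam \<delta> y *
          indicator {y. \<epsilon> * eta_delta q lam \<delta> y < \<bar>x - y\<bar> \<and> \<bar>x - y\<bar> < eta_delta q lam \<delta> y} y) *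
       ((v x - v y) / \<bar>x - y\<bar> powr \<beta>)"
      using AE by eventually_elim (simp only: x(2))
  qed (use measurable_Pair2[OF L_eps_integrand_measurable[OF e u] xs]
      measurable_Pair2[OF L_eps_integrand_measurable[OF e v] xs] in simp)+
qed

lemma continuous_on_bounded:
  assumes "continuous_on {0..1} (f :: real \<Rightarrow> real)"
  obtains B where "\<And>x. x \<in> \<Omega> \<Longrightarrow> \<bar>f x\<bar> \<le> B"
proof -
  have "compact (f ` {0..1})" using assms by (intro compact_continuous_image) auto
  then obtain B where "\<forall>y\<in>f ` {0..1}. norm y \<le> B"
    using compact_imp_bounded bounded_iff by metis
  then have "\<bar>f x\<bar> \<le> B" if "x \<in> \<Omega>" for x using that by auto
  then show ?thesis using that by blast
qed

context nonlocal_operator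
begin

lemma eta_measurable: "eta q lam \<in> borel_measurable (lebesgue_on \<Omega>)"
  unfolding eta[symmetric]
  by (rule continuous_imp_measurable_on_sets_lebesgue[OF continuous_on_subset[OF \<eta>_cont]]) auto

text \<open>The pointwise limits are already available. Boundedness of the continuous
  representatives and integrability of \<open>g\<close> give a constant that dominates the operator
  for all \<epsilon> below 1, so the convergence also holds in the mean square.\<close>

lemma L_delta_limit:
  assumes H4: "H4_representative u U0 U1 U2 U3 g" and um: "u \<in> borel_measurable (lebesgue_on \<Omega>)"
  shows "\<exists>F K. is_L2_limit \<Omega> (\<lambda>\<epsilon>. L_eps \<beta> q lam \<delta> \<epsilon> u) F \<and>
    (\<forall>x\<in>\<Omega>. \<bar>F x + U2 x\<bar> \<le> remainder_bound U1 U2 U3 g x \<and> remainder_bound U1 U2 U3 g x \<le> K)"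
proof -
  interpret H: H4_representative u U0 U1 U2 U3 g by fact
  interpret finite_measure "lebesgue_on \<Omega>" by (rule finite_measure_Omega)
  let ?M = "lebesgue_on \<Omega>" and ?b = "remainder_bound U1 U2 U3 g"
  have g: "integrable ?M g" by (rule L2_space_integrable[OF H.g_L2])
  have "\<forall>x\<in>\<Omega>. \<exists>F. \<bar>F + U2 x\<bar> \<le> ?b x \<and> ((\<lambda>\<epsilon>. L_eps \<beta> q lam \<delta> \<epsilon> U0 x) \<longlongrightarrow> F) (at_right 0) \<and>
    (\<forall>\<epsilon>. 0 < \<epsilon> \<longrightarrow> \<epsilon> < 1 \<longrightarrow> \<bar>L_eps \<beta> q lam \<delta> \<epsilon> U0 x\<bar> \<le> \<bar>U2 x\<bar> + ?b x)"
    by (intro ballI L_eps_pointwise[OF H4])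
  from bchoice[OF this] obtain F where F: "\<And>x. x \<in> \<Omega> \<Longrightarrow> \<bar>F x + U2 x\<bar> \<le> ?b x"
      "\<And>x. x \<in> \<Omega> \<Longrightarrow> ((\<lambda>\<epsilon>. L_eps \<beta> q lam \<delta> \<epsilon> U0 x) \<longlongrightarrow> F x) (at_right 0)"
      "\<And>x \<epsilon>. x \<in> \<Omega> \<Longrightarrow> 0 < \<epsilon> \<Longrightarrow> \<epsilon> < 1 \<Longrightarrow> \<bar>L_eps \<beta> q lam \<delta> \<epsilon> U0 x\<bar> \<le> \<bar>U2 x\<bar> + ?b x"
    by blast
  obtain B1 B2 B3 where B: "\<And>x. x \<in> \<Omega> \<Longrightarrow> \<bar>U1 x\<bar> \<le> B1" "\<And>x. x \<in> \<Omega> \<Longrightarrow> \<bar>U2 x\<bar> \<le> B2" "\<And>x. x \<in> \<Omega> \<Longrightarrow> \<bar>U3 x\<bar> \<le> B3"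
    using continuous_on_bounded[OF H.U_cont(2)] continuous_on_bounded[OF H.U_cont(3)]
      continuous_on_bounded[OF H.U_cont(4)] by metis
  define Kb where "Kb = \<delta> * (C * \<delta> * (B1 + B2 + B3) + k * (\<integral>t. \<bar>g t\<bar> \<partial>?M))"
  have Kb: "?b x \<le> Kb" if "x \<in> \<Omega>" for x
    unfolding remainder_bound_def Kb_def
    using B[OF that] local_mass_le[OF g] \<delta> k C_nonneg
    by (intro mult_left_mono add_mono) auto
  define K where "K = B2 + Kb"
  have UK: "\<bar>U2 x\<bar> + ?b x \<le> K" if "x \<in> \<Omega>" for x
    using B(2)[OF that] Kb[OF that] by (simp add: K_def)
  have FK: "\<bar>F x\<bar> \<le> K" if "x \<in> \<Omega>" for x
    using F(1)[OF that] UK[OF that] by linarith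
  have U0m: "U0 \<in> borel_measurable ?M"
    by (rule continuous_imp_measurable_on_sets_lebesgue[OF continuous_on_subset[OF H.U_cont(1)]]) auto
  note Lm = L_eps_measurable[OF eta_measurable]
  have seq: "(\<lambda>n. L_eps \<beta> q lam \<delta> (S n) U0 x) \<longlonglongrightarrow> F x"
    if "x \<in> \<Omega>" "\<And>n. 0 < S n" "S \<longlonglongrightarrow> 0" for S x
    by (rule filterlim_compose[OF F(2)[OF that(1)]]) (use that(2,3) that(2)[THEN less_imp_neq, THEN not_sym] in \<open>auto simp: filterlim_at\<close>)
  have Fm: "F \<in> borel_measurable ?M"
  proof (rule borel_measurable_LIMSEQ_real)
    show "L_eps \<beta> q lam \<delta> (inverse (real (Suc n))) U0 \<in> borel_measurable ?M" for n
      by (rule Lm[OF U0m])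
    fix x assume "x \<in> space ?M"
    then show "(\<lambda>n. L_eps \<beta> q lam \<delta> (inverse (real (Suc n))) U0 x) \<longlonglongrightarrow> F x"
      by (intro seq LIMSEQ_inverse_real_of_nat) auto
  qed
  \<comment> \<open>One null set, where \<open>u\<close> and \<open>U0\<close> may differ, serves
    all \<epsilon>; hence the quantifier under the almost everywhere statement.\<close>
  have AE_eq: "AE x in ?M. \<forall>\<epsilon>. L_eps \<beta> q lam \<delta> \<epsilon> u x = L_eps \<beta> q lam \<delta> \<epsilon> U0 x"
    using H.U0_AE AE_space
  proof eventually_elim
    case (elim x)
    then show ?case using L_eps_cong_AE[OF eta_measurable um U0m H.U0_AE, of x] by simp
  qed
  have AE_bound: "AE x in ?M. \<bar>L_eps \<beta> q lam \<delta> \<epsilon> u x\<bar> \<le> K" if "0 < \<epsilon>" "\<epsilon> < 1" for \<epsilon>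
    using AE_eq AE_space
  proof eventually_elim
    case (elim x)
    then show ?case using F(3)[of x \<epsilon>] UK[of x] that by simp
  qed
  have "is_L2_limit \<Omega> (\<lambda>\<epsilon>. L_eps \<beta> q lam \<delta> \<epsilon> u) F"
    unfolding is_L2_limit_def
  proof (intro conjI)
    show "F \<in> L2_space \<Omega>"
      by (rule L2_space_of_AE_bounded[OF Fm, of K]) (intro AE_I2 FK, simp)
    have "L_eps \<beta> q lam \<delta> \<epsilon> u \<in> L2_space \<Omega>" if "0 < \<epsilon>" "\<epsilon> < 1" for \<epsilon>
      by (rule L2_space_of_AE_bounded[OF Lm[OF um] AE_bound[OF that]])
    then show "\<forall>\<^sub>F \<epsilon> in at_right 0. L_eps \<beta> q lam \<delta> \<epsilon> u \<in> L2_space \<Omega>"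
      unfolding eventually_at_right_field by (intro exI[of _ 1]) auto
    show "((\<lambda>\<epsilon>. L2_norm \<Omega> (\<lambda>x. L_eps \<beta> q lam \<delta> \<epsilon> u x - F x)) \<longlongrightarrow> 0) (at_right 0)"
    \<comment> \<open>Dominated convergence speaks about sequences, so the limit at 0 is tested
      along them.\<close>
    proof (rule tendsto_at_right_sequentially[of 0 1])
      fix S :: "nat \<Rightarrow> real"
      assume S: "\<And>n. 0 < S n" "\<And>n. S n < 1" "S \<longlonglongrightarrow> 0"
      have "(\<lambda>n. \<integral>x. (L_eps \<beta> q lam \<delta> (S n) u x - F x)\<^sup>2 \<partial>?M) \<longlonglongrightarrow> (\<integral>x. 0 \<partial>?M)"
      proof (rule integral_dominated_convergence[where w="\<lambda>x. (2 * K)\<^sup>2"])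
        show "(\<lambda>x. (L_eps \<beta> q lam \<delta> (S n) u x - F x)\<^sup>2) \<in> borel_measurable ?M" for n
          by (intro borel_measurable_power borel_measurable_diff Lm[OF um] Fm)
        show "AE x in ?M. norm ((L_eps \<beta> q lam \<delta> (S n) u x - F x)\<^sup>2) \<le> (2 * K)\<^sup>2" for n
          using AE_bound[OF S(1)[of n] S(2)[of n]] AE_space
        proof eventually_elim
          case (elim x)
          then have "\<bar>L_eps \<beta> q lam \<delta> (S n) u x - F x\<bar> \<le> 2 * K" using FK[of x] by simp
          then have "\<bar>L_eps \<beta> q lam \<delta> (S n) u x - F x\<bar>\<^sup>2 \<le> (2 * K)\<^sup>2" by (intro power_mono) auto
          then show ?case by simp
        qed
        show "AE x in ?M. (\<lambda>n. (L_eps \<beta> q lam \<delta> (S n) u x - F x)\<^sup>2) \<longlonglongrightarrow> 0"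
          using AE_eq AE_space
        proof eventually_elim
          case (elim x)
          have "(\<lambda>n. (L_eps \<beta> q lam \<delta> (S n) U0 x - F x)\<^sup>2) \<longlonglongrightarrow> (F x - F x)\<^sup>2"
            using elim(2) by (intro tendsto_intros seq S) auto
          then show ?case using elim(1) by simp
        qed
      qed auto
      then have "(\<lambda>n. sqrt (\<integral>x. (L_eps \<beta> q lam \<delta> (S n) u x - F x)\<^sup>2 \<partial>?M)) \<longlonglongrightarrow> sqrt (\<integral>x. 0 \<partial>?M)"
        by (rule tendsto_real_sqrt)
      then show "(\<lambda>n. L2_norm \<Omega> (\<lambda>x. L_eps \<beta> q lam \<delta> (S n) u x - F x)) \<longlonglongrightarrow> 0"
        by (simp add: L2_norm_def)
    qed simp
  qed
  then show ?thesis using F(1) Kb by blast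
qed

lemma remainder_bound_square:
  "(remainder_bound U1 U2 U3 g x)\<^sup>2 \<le>
    4 * \<delta>\<^sup>2 * (C\<^sup>2 * \<delta>\<^sup>2 * ((U1 x)\<^sup>2 + (U2 x)\<^sup>2 + (U3 x)\<^sup>2) + k\<^sup>2 * (local_mass g (\<delta> * k) x)\<^sup>2)"
proof -
  define c where "c = C * \<delta>"
  define m where "m = k * local_mass g (\<delta> * k) x"
  \<comment> \<open>The difference of the two sides is the sum of the six squared
    differences.\<close>
  have four: "(a + b + d + m)\<^sup>2 \<le> 4 * (a\<^sup>2 + b\<^sup>2 + d\<^sup>2 + m\<^sup>2)" for a b d m :: real
    using zero_le_power2[of "a - b"] zero_le_power2[of "a - d"] zero_le_power2[of "a - m"]
      zero_le_power2[of "b - d"] zero_le_power2[of "b - m"] zero_le_power2[of "d - m"]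
    unfolding power2_eq_square by (simp add: algebra_simps)
  have "remainder_bound U1 U2 U3 g x = \<delta> * (c * \<bar>U1 x\<bar> + c * \<bar>U2 x\<bar> + c * \<bar>U3 x\<bar> + m)"
    by (simp add: remainder_bound_def c_def m_def distrib_left)
  then have "(remainder_bound U1 U2 U3 g x)\<^sup>2 = \<delta>\<^sup>2 * (c * \<bar>U1 x\<bar> + c * \<bar>U2 x\<bar> + c * \<bar>U3 x\<bar> + m)\<^sup>2"
    by (simp only: power_mult_distrib)
  also have "\<dots> \<le> \<delta>\<^sup>2 * (4 * ((c * \<bar>U1 x\<bar>)\<^sup>2 + (c * \<bar>U2 x\<bar>)\<^sup>2 + (c * \<bar>U3 x\<bar>)\<^sup>2 + m\<^sup>2))"
    using four by (intro mult_left_mono) auto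
  also have "\<dots> = 4 * \<delta>\<^sup>2 * (C\<^sup>2 * \<delta>\<^sup>2 * ((U1 x)\<^sup>2 + (U2 x)\<^sup>2 + (U3 x)\<^sup>2) + k\<^sup>2 * (local_mass g (\<delta> * k) x)\<^sup>2)"
    by (simp add: c_def m_def power_mult_distrib algebra_simps)
  finally show ?thesis .
qed

theorem consistency:
  assumes H4: "H4_representative u U0 U1 U2 U3 g" and um: "u \<in> borel_measurable (lebesgue_on \<Omega>)"
  shows "(\<lambda>x. L_delta \<beta> q lam \<delta> u x - (- weak_deriv 2 \<Omega> u x)) \<in> L2_space \<Omega>"
    and "L2_norm \<Omega> (\<lambda>x. L_delta \<beta> q lam \<delta> u x - (- weak_deriv 2 \<Omega> u x))
      \<le> 4 * (C + k\<^sup>2) * \<delta>\<^sup>2 * H_norm 4 \<Omega> u"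
proof -
  interpret H: H4_representative u U0 U1 U2 U3 g by fact
  let ?M = "lebesgue_on \<Omega>" and ?b = "remainder_bound U1 U2 U3 g" and ?H = "H_norm 4 \<Omega> u"
  let ?A = "local_mass g (\<delta> * k)"
  let ?d = "\<lambda>x. L_delta \<beta> q lam \<delta> u x - (- weak_deriv 2 \<Omega> u x)"
  obtain F K where lim: "is_L2_limit \<Omega> (\<lambda>\<epsilon>. L_eps \<beta> q lam \<delta> \<epsilon> u) F"
    and FK: "\<And>x. x \<in> \<Omega> \<Longrightarrow> \<bar>F x + U2 x\<bar> \<le> ?b x" "\<And>x. x \<in> \<Omega> \<Longrightarrow> ?b x \<le> K"
    using L_delta_limit[OF H4 um] by blast
  \<comment> \<open>The existence of a limit makes the choice in \<open>L_delta\<close> a genuine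
    limit, which is then almost everywhere equal to \<open>F\<close>.\<close>
  have lim': "is_L2_limit \<Omega> (\<lambda>\<epsilon>. L_eps \<beta> q lam \<delta> \<epsilon> u) (L_delta \<beta> q lam \<delta> u)"
    unfolding L_delta_def by (rule someI[of "is_L2_limit \<Omega> (\<lambda>\<epsilon>. L_eps \<beta> q lam \<delta> \<epsilon> u)", OF lim])
  have dm: "?d \<in> borel_measurable ?M"
    using lim' H.U_weak(2) unfolding is_L2_limit_def L2_space_def
    by (intro borel_measurable_diff borel_measurable_uminus) auto
  have AE_b: "AE x in ?M. \<bar>?d x\<bar> \<le> ?b x \<and> ?b x \<le> K"
    using L2_limit_unique[OF lim lim'] H.U_weak(1) AE_space
  proof eventually_elim
    case (elim x)
    then show ?case using FK[of x] by simp
  qed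
  show L2: "?d \<in> L2_space \<Omega>"
  proof (rule L2_space_of_AE_bounded[OF dm])
    show "AE x in ?M. \<bar>?d x\<bar> \<le> K" using AE_b by eventually_elim linarith
  qed
  have Hn: "0 \<le> ?H" using H.U_norm(1) by (rule order_trans[rotated]) (simp add: L2_norm_def integral_nonneg_AE)
  have sq: "integrable ?M (\<lambda>x. (V x)\<^sup>2)" if "continuous_on {0..1} V" for V :: "real \<Rightarrow> real"
    by (rule integrable_Omega_continuous) (intro continuous_intros that)
  have A: "integrable ?M (\<lambda>x. (?A x)\<^sup>2)" "(\<integral>x. (?A x)\<^sup>2 \<partial>?M) \<le> 4 * (\<delta> * k)\<^sup>2 * (L2_norm \<Omega> g)\<^sup>2"
    using local_mass_L2[OF H.g_L2, of "\<delta> * k"] \<delta> k by auto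
  let ?R = "\<lambda>x. 4 * \<delta>\<^sup>2 * (C\<^sup>2 * \<delta>\<^sup>2 * ((U1 x)\<^sup>2 + (U2 x)\<^sup>2 + (U3 x)\<^sup>2) + k\<^sup>2 * (?A x)\<^sup>2)"
  note ints = sq[OF H.U_cont(2)] sq[OF H.U_cont(3)] sq[OF H.U_cont(4)] A(1)
  have "(L2_norm \<Omega> ?d)\<^sup>2 \<le> (\<integral>x. ?R x \<partial>?M)"
    unfolding L2_norm_power2
  proof (rule integral_mono_AE)
    show "integrable ?M (\<lambda>x. (?d x)\<^sup>2)" using L2 by (simp add: L2_space_def)
    show "integrable ?M ?R" using ints by simp
    show "AE x in ?M. (?d x)\<^sup>2 \<le> ?R x"
      using AE_b
    proof eventually_elim
      case (elim x)
      have "\<bar>?d x\<bar>\<^sup>2 \<le> (?b x)\<^sup>2" using elim by (intro power_mono) auto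
      then show ?case using remainder_bound_square[of U1 U2 U3 g x] by (simp only: power2_abs)
    qed
  qed
  also have "\<dots> = 4 * \<delta>\<^sup>2 * (C\<^sup>2 * \<delta>\<^sup>2 * ((L2_norm \<Omega> U1)\<^sup>2 + (L2_norm \<Omega> U2)\<^sup>2 + (L2_norm \<Omega> U3)\<^sup>2)
      + k\<^sup>2 * (\<integral>x. (?A x)\<^sup>2 \<partial>?M))"
    unfolding L2_norm_power2 using ints by simp
  also have "\<dots> \<le> 4 * \<delta>\<^sup>2 * (C\<^sup>2 * \<delta>\<^sup>2 * (?H\<^sup>2 + ?H\<^sup>2 + ?H\<^sup>2) + k\<^sup>2 * (4 * (\<delta> * k)\<^sup>2 * ?H\<^sup>2))"
  proof -
    have le: "(L2_norm \<Omega> V)\<^sup>2 \<le> ?H\<^sup>2" if "L2_norm \<Omega> V \<le> ?H" for V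
      using that by (intro power_mono) (auto simp: L2_norm_def integral_nonneg_AE)
    have "4 * (\<delta> * k)\<^sup>2 * (L2_norm \<Omega> g)\<^sup>2 \<le> 4 * (\<delta> * k)\<^sup>2 * ?H\<^sup>2"
      by (intro mult_left_mono le H.U_norm) auto
    then have "(\<integral>x. (?A x)\<^sup>2 \<partial>?M) \<le> 4 * (\<delta> * k)\<^sup>2 * ?H\<^sup>2" using A(2) by linarith
    then show ?thesis by (intro mult_left_mono add_mono le H.U_norm) auto
  qed
  \<comment> \<open>Every term now carries \<open>\<delta>\<^sup>2 * \<delta>\<^sup>2\<close>; in
    the last one the second factor is due to the radius \<open>\<delta> * k\<close> of the
    balls.\<close>
  also have "\<dots> = (12 * C\<^sup>2 + 16 * (k\<^sup>2)\<^sup>2) * (\<delta>\<^sup>2 * ?H)\<^sup>2"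
    by (simp add: power_mult_distrib algebra_simps power2_eq_square)
  also have "\<dots> \<le> (4 * (C + k\<^sup>2))\<^sup>2 * (\<delta>\<^sup>2 * ?H)\<^sup>2"
  proof (rule mult_right_mono)
    have "0 \<le> C * k\<^sup>2" using C_nonneg by simp
    then show "12 * C\<^sup>2 + 16 * (k\<^sup>2)\<^sup>2 \<le> (4 * (C + k\<^sup>2))\<^sup>2"
      by (simp add: power2_sum power_mult_distrib)
  qed simp
  also have "\<dots> = (4 * (C + k\<^sup>2) * \<delta>\<^sup>2 * ?H)\<^sup>2" by (simp add: power_mult_distrib)
  finally show "L2_norm \<Omega> ?d \<le> 4 * (C + k\<^sup>2) * \<delta>\<^sup>2 * ?H"
    by (rule power2_le_imp_le) (use C_nonneg Hn in simp)
qed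

end

subsection \<open>Localization pairs\<close>

lemma closure_Omega: "closure \<Omega> = {0..1}" by simp

lemma frontier_Omega: "frontier \<Omega> = {0, 1}"
  by (auto simp: frontier_def)

lemma bdist_0_1: "bdist 0 = 0" "bdist 1 = 0"
  unfolding bdist_def frontier_Omega by (simp_all add: infdist_zero)

lemma bdist_pos:
  assumes "x \<in> \<Omega>" shows "0 < bdist x" "bdist x \<le> 1"
proof -
  have "x \<notin> {0, 1}" using assms by auto
  then show "0 < bdist x"
    unfolding bdist_def frontier_Omega by (intro infdist_pos_not_in_closed) auto
  have "bdist x \<le> dist x 0" unfolding bdist_def frontier_Omega by (rule infdist_le) simp
  then show "bdist x \<le> 1" using assms by simp
qed

text \<open>Each derivative of \<open>lam\<close> beyond the first costs a power of the distance to
  the boundary. In front of the second and third derivatives, \<open>q1 (lam x)\<close> restores one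
  power where it occurs; in the third order bound the factor \<open>eta q lam x\<close> restores the
  remaining one.\<close>

lemma localization_pair_variable_horizon:
  assumes "smooth_localization_pair q lam Cq \<kappa>0 \<kappa>1 \<kappa>2"
  shows "\<exists>\<eta>1 \<eta>2 \<eta>3 M. variable_horizon (eta q lam) \<eta>1 \<eta>2 \<eta>3 \<kappa>1 M"
proof -
  have P: "localization_pair q lam Cq \<kappa>0 \<kappa>1 \<kappa>2" and lam3: "Ck_on 3 \<Omega> lam"
    using assms by (auto simp: smooth_localization_pair_def)
  obtain \<kappa>3 where \<kappa>3: "0 < \<kappa>3" "\<And>x. x \<in> \<Omega> \<Longrightarrow> \<bar>nth_deriv_on 3 \<Omega> lam x\<bar> \<le> \<kappa>3 * inverse ((bdist x)\<^sup>2)"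
    using assms by (auto simp: smooth_localization_pair_def)
  have \<kappa>: "\<kappa>0 \<ge> 1" "\<kappa>1 > 0" "\<kappa>2 > 0" and qC: "Ck_on 3 {0..} q" and q00: "q 0 = 0"
    and q10: "nth_deriv_on 1 {0..} q 0 = 0" and qb: "\<And>r. r > 0 \<Longrightarrow> 0 < q r \<and> q r \<le> r"
    and q1b: "\<And>r. r \<ge> 0 \<Longrightarrow> 0 \<le> nth_deriv_on 1 {0..} q r \<and> nth_deriv_on 1 {0..} q r \<le> 1"
    and q2b: "\<And>r. r \<ge> 0 \<Longrightarrow> 0 \<le> nth_deriv_on 2 {0..} q r \<and> nth_deriv_on 2 {0..} q r \<le> 1"
    and qCb: "Cb1_on {0..} (nth_deriv_on 2 {0..} q)"
    and lamC: "continuous_on (closure \<Omega>) lam"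
    and lamn: "lam \<in> closure \<Omega> \<rightarrow> {0..}"
    and lamb: "\<And>x. x \<in> closure \<Omega> \<Longrightarrow> inverse \<kappa>0 * bdist x \<le> lam x \<and> lam x \<le> \<kappa>0 * bdist x"
    and l1b: "\<And>x. x \<in> \<Omega> \<Longrightarrow> \<bar>nth_deriv_on 1 \<Omega> lam x\<bar> \<le> \<kappa>1"
    and l2b: "\<And>x. x \<in> \<Omega> \<Longrightarrow> \<bar>nth_deriv_on 2 \<Omega> lam x\<bar> \<le> \<kappa>2 * inverse (bdist x)"
    using P unfolding localization_pair_def by blast+
  define q1 where "q1 = nth_deriv_on 1 {0..} q"
  define q2 where "q2 = nth_deriv_on 2 {0..} q"
  define q3 where "q3 = nth_deriv_on 3 {0..} q"
  define l1 where "l1 = nth_deriv_on 1 \<Omega> lam"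
  define l2 where "l2 = nth_deriv_on 2 \<Omega> lam"
  define l3 where "l3 = nth_deriv_on 3 \<Omega> lam"
  have qw: "(q has_real_derivative q1 r) (at r within {0..})" "(q1 has_real_derivative q2 r) (at r within {0..})"
     "(q2 has_real_derivative q3 r) (at r within {0..})" if "r \<ge> 0" for r
    using Ck_on_nth_deriv[OF qC, of 0 r] Ck_on_nth_deriv[OF qC, of 1 r] Ck_on_nth_deriv[OF qC, of 2 r] that
    by (simp_all add: q1_def q2_def q3_def numeral_2_eq_2 numeral_3_eq_3)
  have qd: "(q has_real_derivative q1 r) (at r)" "(q1 has_real_derivative q2 r) (at r)"
     "(q2 has_real_derivative q3 r) (at r)" if "r > 0" for r
  proof -
    have "at r within {0..} = at r" using that by (intro at_within_interior) auto
    then show "(q has_real_derivative q1 r) (at r)" "(q1 has_real_derivative q2 r) (at r)"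
     "(q2 has_real_derivative q3 r) (at r)" using qw[of r] that by auto
  qed
  have ld: "(lam has_real_derivative l1 x) (at x)" "(l1 has_real_derivative l2 x) (at x)"
     "(l2 has_real_derivative l3 x) (at x)" if "x \<in> \<Omega>" for x
  proof -
    have "at x within \<Omega> = at x" using that by (intro at_within_open) auto
    then show "(lam has_real_derivative l1 x) (at x)" "(l1 has_real_derivative l2 x) (at x)"
     "(l2 has_real_derivative l3 x) (at x)"
      using Ck_on_nth_deriv[OF lam3, of 0 x] Ck_on_nth_deriv[OF lam3, of 1 x] Ck_on_nth_deriv[OF lam3, of 2 x] that
      by (simp_all add: l1_def l2_def l3_def numeral_2_eq_2 numeral_3_eq_3)
  qed
  \<comment> \<open>The first derivative of \<open>q\<close> vanishes at 0 and the second is at most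
    1. Hence \<open>q1 (lam x)\<close> is at most \<open>\<kappa>0 * bdist x\<close>, the factor
    that offsets the singular derivatives of \<open>lam\<close>.\<close>
  have q1_le: "q1 r \<le> r" if r: "r > 0" for r
  proof -
    have "continuous_on {0..} q1"
      using qw(2) by (auto intro!: DERIV_continuous_on)
    then have c: "continuous_on {0..r} q1" by (rule continuous_on_subset) auto
    have d: "(q1 has_derivative (\<lambda>h. q2 t * h)) (at t)" if "0 < t" "t < r" for t
      using qd(2)[OF that(1)] by (simp add: has_field_derivative_def)
    obtain t where t: "0 < t" "t < r" "q1 r - q1 0 = q2 t * (r - 0)"
      by (rule mvt[OF r c d])
    have "q2 t * r \<le> 1 * r" using q2b[of t] t r unfolding q2_def by (intro mult_right_mono) auto
    then show ?thesis using t q10 by (simp add: q1_def)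
  qed
  \<comment> \<open>The derivative of \<open>q2\<close> that \<open>Cb1_on\<close> bounds is
    \<open>q3\<close>.\<close>
  obtain Q where Q: "\<And>r. r \<ge> 0 \<Longrightarrow> \<bar>q3 r\<bar> \<le> Q"
  proof -
    have "bounded (q3 ` {0..})"
      using qCb unfolding Cb1_on_def q3_def nth_deriv_on_add by (simp add: numeral_3_eq_3 numeral_2_eq_2)
    then show ?thesis using that unfolding bounded_iff by auto
  qed
  have Q0: "0 \<le> Q" using Q[of 0] by linarith
  have lam: "0 < lam x" "lam x \<le> \<kappa>0 * bdist x" if "x \<in> \<Omega>" for x
  proof -
    have "x \<in> closure \<Omega>" using that closure_subset by blast
    then have *: "inverse \<kappa>0 * bdist x \<le> lam x" "lam x \<le> \<kappa>0 * bdist x" using lamb by auto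
    have "0 < inverse \<kappa>0 * bdist x" using \<kappa>(1) bdist_pos(1)[OF that] by simp
    then show "0 < lam x" "lam x \<le> \<kappa>0 * bdist x" using * by auto
  qed
  have lam01: "lam 0 = 0" "lam 1 = 0"
    using lamb[of 0] lamb[of 1] by (auto simp: bdist_0_1)
  define \<eta>1 where "\<eta>1 x = q1 (lam x) * l1 x" for x
  define \<eta>2 where "\<eta>2 x = q2 (lam x) * l1 x * l1 x + q1 (lam x) * l2 x" for x
  define \<eta>3 where "\<eta>3 x = q3 (lam x) * l1 x ^ 3 + 3 * q2 (lam x) * l1 x * l2 x + q1 (lam x) * l3 x" for x
  \<comment> \<open>The first summand bounds \<open>\<eta>2\<close>, the second
    \<open>\<bar>\<eta>3\<bar> * \<eta>\<close>; both are nonnegative, so the sum serves for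
    either.\<close>
  define M where "M = (\<kappa>1\<^sup>2 + \<kappa>0 * \<kappa>2) + \<kappa>0 * (Q * \<kappa>1 ^ 3 + 3 * \<kappa>1 * \<kappa>2 + \<kappa>0 * \<kappa>3)"
  have M1: "0 \<le> \<kappa>1\<^sup>2 + \<kappa>0 * \<kappa>2" "0 \<le> \<kappa>0 * (Q * \<kappa>1 ^ 3 + 3 * \<kappa>1 * \<kappa>2 + \<kappa>0 * \<kappa>3)"
    using \<kappa> \<kappa>3(1) Q0 by auto
  have "variable_horizon (eta q lam) \<eta>1 \<eta>2 \<eta>3 \<kappa>1 M"
  proof
    show "0 < \<kappa>1" by (rule \<kappa>(2))
    show "0 \<le> M" using M1 by (simp add: M_def)
    have "continuous_on {0..} q"
      using qw(1) by (auto intro!: DERIV_continuous_on)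
    moreover have "continuous_on {0..1} lam" using lamC unfolding closure_Omega .
    moreover have "lam ` {0..1} \<subseteq> {0..}" using lamn unfolding closure_Omega by blast
    ultimately show "continuous_on {0..1} (eta q lam)"
      unfolding eta_def[abs_def] by (rule continuous_on_compose2)
    show "eta q lam 0 = 0" "eta q lam 1 = 0" by (auto simp: eta_def lam01 q00)
    fix x assume x: "x \<in> \<Omega>"
    note lx = lam[OF x] and dx = bdist_pos[OF x]
    show "0 < eta q lam x" using qb lx by (simp add: eta_def)
    note chain = DERIV_chain2[OF _ ld(1)[OF x]]
    show "(eta q lam has_real_derivative \<eta>1 x) (at x)"
      unfolding eta_def[abs_def] \<eta>1_def by (rule chain[OF qd(1)[OF lx(1)]])
    show "(\<eta>1 has_real_derivative \<eta>2 x) (at x)"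
      unfolding \<eta>1_def[abs_def] \<eta>2_def
      by (rule DERIV_mult[OF chain[OF qd(2)[OF lx(1)]] ld(2)[OF x], THEN DERIV_cong]) (simp add: algebra_simps)
    show "(\<eta>2 has_real_derivative \<eta>3 x) (at x)"
      unfolding \<eta>2_def[abs_def] \<eta>3_def
      by (rule DERIV_add[OF DERIV_mult[OF DERIV_mult[OF chain[OF qd(3)[OF lx(1)]] ld(2)[OF x]] ld(2)[OF x]]
            DERIV_mult[OF chain[OF qd(2)[OF lx(1)]] ld(3)[OF x]], THEN DERIV_cong])
        (simp add: algebra_simps power3_eq_cube)
    have q1x: "0 \<le> q1 (lam x)" "q1 (lam x) \<le> 1" "q1 (lam x) \<le> \<kappa>0 * bdist x"
      using q1b[of "lam x"] q1_le[OF lx(1)] lx by (auto simp: q1_def)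
    have q2x: "0 \<le> q2 (lam x)" "q2 (lam x) \<le> 1" using q2b[of "lam x"] lx by (auto simp: q2_def)
    have q3x: "\<bar>q3 (lam x)\<bar> \<le> Q" using Q lx by simp
    have l1x: "\<bar>l1 x\<bar> \<le> \<kappa>1" using l1b[OF x] by (simp add: l1_def)
    have l2x: "\<bar>l2 x\<bar> \<le> \<kappa>2 / bdist x" using l2b[OF x] by (simp add: l2_def divide_inverse)
    have l3x: "\<bar>l3 x\<bar> \<le> \<kappa>3 / (bdist x)\<^sup>2" using \<kappa>3(2)[OF x] by (simp add: l3_def divide_inverse)
    show "\<bar>\<eta>1 x\<bar> \<le> \<kappa>1"
    proof -
      have "\<bar>q1 (lam x)\<bar> * \<bar>l1 x\<bar> \<le> 1 * \<kappa>1" using q1x l1x by (intro mult_mono) auto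
      then show ?thesis by (simp add: \<eta>1_def abs_mult)
    qed
    show "\<bar>\<eta>2 x\<bar> \<le> M"
    proof -
      have "\<bar>q2 (lam x) * l1 x * l1 x\<bar> \<le> 1 * \<kappa>1 * \<kappa>1"
        unfolding abs_mult using q2x l1x \<kappa> by (intro mult_mono) auto
      moreover have "\<bar>q1 (lam x) * l2 x\<bar> \<le> (\<kappa>0 * bdist x) * (\<kappa>2 / bdist x)"
        unfolding abs_mult using q1x l2x \<kappa> dx by (intro mult_mono) auto
      moreover have "(\<kappa>0 * bdist x) * (\<kappa>2 / bdist x) = \<kappa>0 * \<kappa>2" using dx by simp
      ultimately have "\<bar>\<eta>2 x\<bar> \<le> \<kappa>1\<^sup>2 + \<kappa>0 * \<kappa>2" unfolding \<eta>2_def power2_eq_square by linarith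
      then show ?thesis using M1 by (simp add: M_def)
    qed
    show "\<bar>\<eta>3 x\<bar> * eta q lam x \<le> M"
    proof -
      let ?d = "bdist x"
      have 1: "\<bar>q3 (lam x) * l1 x ^ 3\<bar> \<le> Q * \<kappa>1 ^ 3"
        unfolding abs_mult power_abs using q3x l1x Q0 by (intro mult_mono power_mono) auto
      have 2: "\<bar>3 * q2 (lam x) * l1 x * l2 x\<bar> \<le> 3 * 1 * \<kappa>1 * (\<kappa>2 / ?d)"
        unfolding abs_mult using q2x l1x l2x \<kappa> dx by (intro mult_mono) auto
      have 3: "\<bar>q1 (lam x) * l3 x\<bar> \<le> (\<kappa>0 * ?d) * (\<kappa>3 / ?d\<^sup>2)"
        unfolding abs_mult using q1x l3x \<kappa> dx by (intro mult_mono) auto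
      have "\<bar>\<eta>3 x\<bar> \<le> Q * \<kappa>1 ^ 3 + 3 * 1 * \<kappa>1 * (\<kappa>2 / ?d) + (\<kappa>0 * ?d) * (\<kappa>3 / ?d\<^sup>2)"
        unfolding \<eta>3_def using 1 2 3 by linarith
      moreover have "0 \<le> eta q lam x" "eta q lam x \<le> \<kappa>0 * ?d"
        using qb[OF lx(1)] lx by (auto simp: eta_def)
      ultimately have "\<bar>\<eta>3 x\<bar> * eta q lam x \<le>
          (Q * \<kappa>1 ^ 3 + 3 * 1 * \<kappa>1 * (\<kappa>2 / ?d) + (\<kappa>0 * ?d) * (\<kappa>3 / ?d\<^sup>2)) * (\<kappa>0 * ?d)"
        by (intro mult_mono) auto
      also have "\<dots> = \<kappa>0 * (Q * \<kappa>1 ^ 3 * ?d + 3 * \<kappa>1 * \<kappa>2 + \<kappa>0 * \<kappa>3)"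
        using dx by (simp add: field_simps power2_eq_square)
      also have "\<dots> \<le> \<kappa>0 * (Q * \<kappa>1 ^ 3 * 1 + 3 * \<kappa>1 * \<kappa>2 + \<kappa>0 * \<kappa>3)"
        using \<kappa> Q0 dx by (intro mult_left_mono add_right_mono) auto
      finally show ?thesis using M1 by (simp add: M_def)
    qed
  qed
  then show ?thesis by blast
qed

theorem theorem4p6:
  fixes \<beta> Cq \<kappa>0 \<kappa>1 \<kappa>2 :: real and q lam :: "real \<Rightarrow> real"
  assumes "0 < \<beta>" and "\<beta> < 3"
    and "smooth_localization_pair q lam Cq \<kappa>0 \<kappa>1 \<kappa>2"
  shows "\<exists>C>0. \<forall>\<delta>. 0 < \<delta> \<and> \<delta> < delta_star Cq \<kappa>0 \<kappa>1 \<longrightarrow>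
           (\<forall>u \<in> H_space 4 \<Omega> \<inter> H10_space \<Omega>.
              (\<lambda>x. L_delta \<beta> q lam \<delta> u x - (- weak_deriv 2 \<Omega> u x)) \<in> L2_space \<Omega> \<and>
              L2_norm \<Omega> (\<lambda>x. L_delta \<beta> q lam \<delta> u x - (- weak_deriv 2 \<Omega> u x))
                \<le> C * \<delta>\<^sup>2 * H_norm 4 \<Omega> u)"
proof -
  obtain \<eta>1 \<eta>2 \<eta>3 M where "variable_horizon (eta q lam) \<eta>1 \<eta>2 \<eta>3 \<kappa>1 M"
    using localization_pair_variable_horizon[OF assms(3)] by blast
  then interpret V: variable_horizon "eta q lam" \<eta>1 \<eta>2 \<eta>3 \<kappa>1 M .
  \<comment> \<open>\<open>scaled_horizon.C\<close> is a function of \<open>\<kappa>1\<close> and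
    \<open>M\<close> alone, so \<open>K\<close> can be fixed before \<delta> and
    \<open>u\<close>.\<close>
  define K where "K = 4 * (scaled_horizon.C \<kappa>1 M + \<kappa>1\<^sup>2)"
  have scaled: "scaled_horizon (eta q lam) \<eta>1 \<eta>2 \<eta>3 \<kappa>1 M \<delta>"
    if \<delta>: "0 < \<delta>" "\<delta> < delta_star Cq \<kappa>0 \<kappa>1" for \<delta>
  proof
    \<comment> \<open>\<open>\<kappa>1\<close> is one of the terms under the maximum, so \<delta> <
      1 / (3 m) bounds \<open>3 * \<delta> * \<kappa>1\<close> by 1.\<close>
    define m where "m = Max {1, \<kappa>1, Cq * \<kappa>0 powr log 2 Cq}"
    have m: "1 \<le> m" "\<kappa>1 \<le> m" unfolding m_def by (auto intro: Max_ge)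
    have "\<delta> < inverse (3 * m)" using \<delta> by (simp add: delta_star_def delta_zero_def m_def)
    then have "3 * \<delta> * m < 1" using m by (simp add: field_simps)
    moreover have "3 * \<delta> * \<kappa>1 \<le> 3 * \<delta> * m" using m \<delta> by (intro mult_left_mono) auto
    ultimately show "3 * \<delta> * \<kappa>1 < 1" by linarith
  qed (rule \<delta>)
  have "0 < K"
  proof -
    \<comment> \<open>Nonnegativity of \<open>C\<close> is stated in a locale that fixes some
      admissible \<delta>; \<open>inverse (4 * \<kappa>1)\<close> is one, since 3/4 < 1.\<close>
    have "3 * inverse (4 * \<kappa>1) * \<kappa>1 < 1" using V.k by (simp add: field_simps)
    then interpret S: scaled_horizon "eta q lam" \<eta>1 \<eta>2 \<eta>3 \<kappa>1 M "inverse (4 * \<kappa>1)"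
      by unfold_locales (use V.k in auto)
    show ?thesis unfolding K_def using S.C_nonneg V.k by (simp add: add_nonneg_pos)
  qed
  moreover have "(\<lambda>x. L_delta \<beta> q lam \<delta> u x - (- weak_deriv 2 \<Omega> u x)) \<in> L2_space \<Omega> \<and>
      L2_norm \<Omega> (\<lambda>x. L_delta \<beta> q lam \<delta> u x - (- weak_deriv 2 \<Omega> u x)) \<le> K * \<delta>\<^sup>2 * H_norm 4 \<Omega> u"
    if \<delta>: "0 < \<delta>" "\<delta> < delta_star Cq \<kappa>0 \<kappa>1" and u: "u \<in> H_space 4 \<Omega>" for \<delta> u
  proof -
    interpret S: scaled_horizon "eta q lam" \<eta>1 \<eta>2 \<eta>3 \<kappa>1 M \<delta> by (rule scaled[OF \<delta>])
    interpret N: nonlocal_operator "eta q lam" \<eta>1 \<eta>2 \<eta>3 \<kappa>1 M \<delta> \<beta> q lam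
      by unfold_locales (use assms in auto)
    obtain U0 U1 U2 U3 g where H4: "H4_representative u U0 U1 U2 U3 g"
      using H4_representative_exists[OF u] by blast
    have um: "u \<in> borel_measurable (lebesgue_on \<Omega>)"
      using u by (auto simp: H_space_def L2_space_def)
    show ?thesis using N.consistency[OF H4 um] by (simp add: K_def)
  qed
  ultimately show ?thesis by blast
qed

end
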